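(* Let $K\subseteq\mathbb R^n$ be a symmetric convex body such that $K^\circ$ is isotropic, and let $u\in\mathbb R^n\setminus\{0\}$. Then $$\int_K\langle x,u\rangle^2\,dx\cdot\int_{K^\circ}\langle x,u\rangle^2\,dx\;\le\;\left(\int_{B_2^n}\langle x,u\rangle^2\,dx\right)^2,$$ with equality if and only if $K$ is a Euclidean ball centered at the origin.
   Context: A convex body is a compact convex set with nonempty interior; it is symmetric if $K=-K$. $B_2^n$ is the Euclidean unit ball, $K^\circ=\{x:\langle x,y\rangle\le1\ \forall y\in K\}$ the polar body. A symmetric convex body $L\subseteq\mathbb R^n$ is called isotropic if $\int_L\langle x,u\rangle^2\,dx=\frac{\|u\|^2}{n}\int_L\|x\|^2\,dx$ for all $u\in\mathbb R^n$ (no volume normalization is required). *)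

theory Defs
  imports "HOL-Analysis.Analysis"
begin

definition convex_body :: "'a::euclidean_space set \<Rightarrow> bool" where
  "convex_body K \<longleftrightarrow> compact K \<and> convex K \<and> interior K \<noteq> {}"

definition symmetric_set :: "'a::euclidean_space set \<Rightarrow> bool" where
  "symmetric_set K \<longleftrightarrow> uminus ` K = K"

definition polar_body :: "'a::euclidean_space set \<Rightarrow> 'a set" where
  "polar_body K = {x. \<forall>y\<in>K. inner x y \<le> 1}"

text \<open>Isotropic symmetric convex body (no volume normalisation); dimension n = DIM('a).\<close>
definition isotropic :: "'a::euclidean_space set \<Rightarrow> bool" where
  "isotropic L \<longleftrightarrow> convex_body L \<and> symmetric_set L \<and>
     (\<forall>u. (LINT x:L|lborel. (inner x u)\<^sup>2) =
           (norm u)\<^sup>2 / real DIM('a) * (LINT x:L|lborel. (norm x)\<^sup>2))"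

end

(* Replace K and its polar L by the even functions f = exp (- h_L^2 / 2) and g = exp (- h_K^2 / 2) built from
   the support functions; they satisfy f x * g y <= exp (- <x, y>), and a layer-cake computation turns
   the second moments of K and L into those of f and g.  A linear change of variables makes u a
   coordinate functional and centres the half-space marginals of <x, u>^2 f; the one-dimensional
   transport inequality on the half-line then gives marginals on the hyperplane that satisfy the same
   duality relation, and the functional Santalo inequality for functions with barycentre 0 (Lehec's
   induction on the dimension by bisecting one of the functions) yields
   int <x, u>^2 f * int <y, v>^2 g <= (2 pi)^n for some v with <v, u> = 1.  Isotropy replaces v by u at
   the cost of |v| |u| >= 1.  Equality propagates through each step: the transport map is
   linear, so g is a Gaussian, and isotropy together with Gaussian integration by parts makes it
   radial. *)

theory Submission
  imports Defs "HOL-Probability.Distributions"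
begin

text \<open>The weight <x, u>^2 vanishes on a hyperplane and is log-concave only on each side of it.
  On the half-line, however, s^k * t^k = (sqrt (s * t) ^ k)^2, and the bound exp (- s * t) depends
  on s * t alone, so transport along geometric means absorbs every power at once. This is why
  everything is cut into half-spaces, and why one half-space statement serves twice: exponent 0
  gives the induction step of the functional inequality, exponent 2 the weighted inequality. Both
  half-line constants agree because a standard normal variable has variance 1. The direction v
  cannot be prescribed: the shear that centres the weighted half of f acts on g by its inverse
  transpose, and only the pairing with u stays under control. Isotropy makes the second moment of
  the polar body depend on |v| alone, which is why the body K goes with the centred side f. The
  equality case travels inside the induction, since Gaussian marginals on the hyperplane are what
  forces Gaussian fibres above it. Dimension is encoded by subsets of the basis of one fixed
  type.\<close>

section \<open>Transport and the sharp inequality on the half-line\<close>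

text \<open>Supplies what inverting a distribution function needs: a positive density gives strict
  monotonicity, so the limit \<open>A\<close> is never attained, and the intermediate value theorem
  reaches every value between 0 and \<open>A\<close>. At 0 continuity suffices, so derivatives are
  taken at positive arguments only.\<close>

lemma cumulative_properties:
  fixes F p :: "real \<Rightarrow> real"
  assumes cont: "continuous_on {0..} F" and F0: "F 0 = 0"
    and der: "\<forall>s>0. (F has_real_derivative p s) (at s)"
    and pos: "\<forall>s>0. p s > 0"
    and lim: "(F \<longlongrightarrow> A) at_top"
  shows "\<And>s t. 0 \<le> s \<Longrightarrow> s < t \<Longrightarrow> F s < F t"
    and "\<And>s. s > 0 \<Longrightarrow> 0 < F s"
    and "\<And>s. s \<ge> 0 \<Longrightarrow> F s < A"
    and "A > 0"
    and "\<And>y. 0 < y \<Longrightarrow> y < A \<Longrightarrow> \<exists>s>0. F s = y"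
proof -
  show mono: "F s < F t" if "0 \<le> s" "s < t" for s t
  proof (rule DERIV_pos_imp_increasing_open[OF \<open>s < t\<close>])
    show "\<exists>y. (F has_real_derivative y) (at x) \<and> 0 < y" if "s < x" "x < t" for x
      using der pos that \<open>0 \<le> s\<close> by (meson le_less_trans)
    show "continuous_on {s..t} F"
      by (rule continuous_on_subset[OF cont]) (use \<open>0 \<le> s\<close> in auto)
  qed
  show pos': "0 < F s" if "s > 0" for s
    using mono[of 0 s] that F0 by simp
  show ltA: "F s < A" if "s \<ge> 0" for s
  proof -
    have "F (s + 1) \<le> A"
    proof (rule tendsto_lowerbound[OF lim])
      show "\<forall>\<^sub>F x in at_top. F (s + 1) \<le> F x"
        using eventually_gt_at_top[of "s + 1"]
        by eventually_elim (use mono[of "s + 1"] that in force)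
    qed simp
    with mono[of s "s + 1"] that show ?thesis by simp
  qed
  show "A > 0" using ltA[of 0] F0 by simp
  show "\<exists>s>0. F s = y" if "0 < y" "y < A" for y
  proof -
    have "\<forall>\<^sub>F x in at_top. y < F x"
      using order_tendstoD(1)[OF lim \<open>y < A\<close>] .
    then have "\<forall>\<^sub>F x in at_top. y < F x \<and> x > 0"
      using eventually_gt_at_top[of 0] by eventually_elim simp
    then obtain M where M: "y < F M" "M > 0"
      by (auto simp: eventually_at_top_linorder)
    have "\<exists>x\<ge>0. x \<le> M \<and> F x = y"
      by (rule IVT') (use M F0 that in \<open>auto intro: continuous_on_subset[OF cont]\<close>)
    then obtain x where "x \<ge> 0" "F x = y" by auto
    with F0 that have "x > 0" by (cases "x = 0") auto
    with \<open>F x = y\<close> show ?thesis by auto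
  qed
qed

text \<open>Monotone transport: with \<open>\<tau>\<close> defined by \<open>F s / A = G (\<tau> s) / B\<close>, the arithmetic-geometric
  mean inequality for the derivative of \<open>sqrt (s * \<tau> s)\<close> makes
  \<open>H (sqrt (s * \<tau> s)) - sqrt (B / A) * F s\<close> nondecreasing.\<close>

lemma transport_inequality:
  fixes F G H p q h :: "real \<Rightarrow> real"
  assumes F: "continuous_on {0..} F" "F 0 = 0" "\<forall>s>0. (F has_real_derivative p s) (at s)"
      "\<forall>s>0. p s > 0" "(F \<longlongrightarrow> A) at_top"
    and G: "continuous_on {0..} G" "G 0 = 0" "\<forall>s>0. (G has_real_derivative q s) (at s)"
      "\<forall>s>0. q s > 0" "(G \<longlongrightarrow> B) at_top"
    and H: "continuous_on {0..} H" "H 0 = 0" "\<forall>s>0. (H has_real_derivative h s) (at s)"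
      "\<forall>s>0. h s > 0" "(H \<longlongrightarrow> c) at_top"
    and le: "\<And>s t. s > 0 \<Longrightarrow> t > 0 \<Longrightarrow> p s * q t \<le> (h (sqrt (s * t)))\<^sup>2"
  shows "A * B \<le> c\<^sup>2"
    and "A * B = c\<^sup>2 \<Longrightarrow> \<exists>\<mu>>0. \<forall>s>0. p s * q (\<mu> * s) = (h (sqrt (s * (\<mu> * s))))\<^sup>2"
proof -
  note Fp = cumulative_properties[OF F]
  note Gp = cumulative_properties[OF G]
  note Hp = cumulative_properties[OF H]
  note F = F(1,2) F(3,4)[rule_format] F(5)
  note G = G(1,2) G(3,4)[rule_format] G(5)
  note H = H(1,2) H(3,4)[rule_format] H(5)
  have inj: "inj_on G {0<..}"
    by (rule linorder_inj_onI) (use Gp(1) in \<open>auto simp: less_imp_neq\<close>)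
  define Gi where "Gi = the_inv_into {0<..} G"
  have Gi: "Gi (G t) = t" if "t > 0" for t
    unfolding Gi_def using the_inv_into_f_f[OF inj] that by simp
  define \<tau> where "\<tau> s = Gi (B / A * F s)" for s
  have \<tau>: "\<tau> s > 0" "G (\<tau> s) = B / A * F s" if "s > 0" for s
  proof -
    have "0 < B / A * F s" "B / A * F s < B"
      using Fp(2)[OF that] Fp(3)[of s] that Fp(4) Gp(4) by (auto simp: field_simps)
    then obtain t where "t > 0" "G t = B / A * F s"
      using Gp(5) by blast
    then show "\<tau> s > 0" "G (\<tau> s) = B / A * F s"
      using Gi[of t] by (auto simp: \<tau>_def)
  qed
  have Gi': "(Gi has_real_derivative inverse (q t)) (at (G t))" if "t > 0" for t
    unfolding has_field_derivative_def
  proof (rule has_derivative_inverse_strong[where S = "{0<..}" and f = G and x = t and f' = "(*) (q t)"])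
    show "(*) (q t) \<circ> (*) (inverse (q t)) = id"
      using G(4)[OF that] by (auto simp: fun_eq_iff)
    show "continuous_on {0<..} G"
      by (rule continuous_on_subset[OF G(1)]) auto
    show "(G has_derivative (*) (q t)) (at t)"
      using G(3)[OF that] by (simp add: has_field_derivative_def)
  qed (use that Gi in auto)
  have \<tau>': "(\<tau> has_real_derivative (B / A * p s) / q (\<tau> s)) (at s)" if "s > 0" for s
  proof -
    have 1: "((\<lambda>s. B / A * F s) has_real_derivative B / A * p s) (at s)"
      by (rule DERIV_cmult[OF F(3)[OF that]])
    have 2: "(Gi has_real_derivative inverse (q (\<tau> s))) (at (B / A * F s))"
      using Gi'[OF \<tau>(1)[OF that]] \<tau>(2)[OF that] by simp
    show ?thesis
      using DERIV_chain2[OF 2 1] unfolding \<tau>_def by (simp add: field_simps)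
  qed
  define R where "R s = sqrt (s * \<tau> s)" for s
  have Rpos: "R s > 0" if "s > 0" for s
    using \<tau>(1)[OF that] that by (simp add: R_def)
  define T where "T s = (B / A * p s) / q (\<tau> s)" for s
  have Tpos: "T s > 0" if "s > 0" for s
    unfolding T_def using F(4)[OF that] G(4)[OF \<tau>(1)[OF that]] Fp(4) Gp(4) by simp
  have R': "(R has_real_derivative (\<tau> s + s * T s) / (2 * R s)) (at s)" if "s > 0" for s
  proof -
    have 1: "((\<lambda>s. s * \<tau> s) has_real_derivative \<tau> s + s * T s) (at s)"
      using DERIV_mult[OF DERIV_ident \<tau>'[OF that]] by (simp add: T_def algebra_simps)
    have 2: "(sqrt has_real_derivative inverse (sqrt (s * \<tau> s)) / 2) (at (s * \<tau> s))"
      by (rule DERIV_real_sqrt) (use \<tau>(1)[OF that] that in simp)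
    show ?thesis using DERIV_chain2[OF 2 1] unfolding R_def by (simp add: field_simps)
  qed
  define k where "k = sqrt (B / A)"
  define D where "D s = H (R s) - k * F s" for s
  define D' where "D' s = h (R s) * ((\<tau> s + s * T s) / (2 * R s)) - k * p s" for s
  have D': "(D has_real_derivative D' s) (at s)" if "s > 0" for s
    unfolding D_def D'_def
    by (rule DERIV_diff[OF DERIV_chain2[OF H(3)[OF Rpos[OF that]] R'[OF that]] DERIV_cmult[OF F(3)[OF that]]])
  \<comment> \<open>Since \<open>T\<close> is (B / A) * p / q(\<tau>), the product p * q(\<tau>) * T
    equals (B / A) * p^2. The subtracted term thus becomes a geometric mean, to be set against the
    arithmetic mean in the derivative of \<open>R\<close>.\<close>
  have kp: "k * p s = sqrt (p s * q (\<tau> s)) * sqrt (T s)" if "s > 0" for s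
  proof -
    have "q (\<tau> s) > 0" using G(4) \<tau>(1) that by blast
    then have "sqrt (p s * q (\<tau> s)) * sqrt (T s) = sqrt (B / A * (p s)\<^sup>2)"
      by (simp flip: real_sqrt_mult) (simp add: T_def power2_eq_square)
    then show ?thesis using F(4)[OF that] by (simp add: k_def real_sqrt_mult real_sqrt_divide)
  qed
  have a: "sqrt (p s * q (\<tau> s)) \<le> h (R s)" if "s > 0" for s
  proof -
    have "sqrt (p s * q (\<tau> s)) \<le> sqrt ((h (R s))\<^sup>2)"
      using le[OF that \<tau>(1)[OF that]] unfolding R_def by (rule real_sqrt_le_mono)
    then show ?thesis using H(4)[OF Rpos[OF that]] by simp
  qed
  have b: "(\<tau> s + s * T s) / (2 * R s) - sqrt (T s) = (sqrt (\<tau> s) - sqrt (s * T s))\<^sup>2 / (2 * R s)"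
    if "s > 0" for s
  proof -
    have "(sqrt (\<tau> s) - sqrt (s * T s))\<^sup>2 = \<tau> s + s * T s - 2 * (R s * sqrt (T s))"
      using that \<tau>(1)[OF that] Tpos[OF that]
      by (simp add: power2_diff R_def real_sqrt_mult power_mult_distrib)
    then show ?thesis using Rpos[OF that] by (simp add: field_simps)
  qed
  \<comment> \<open>The derivative splits into the slack of the hypothesis at (s, \<tau> s) and the
    gap in the arithmetic-geometric mean inequality. Both are nonnegative, and both must vanish in
    the equality case.\<close>
  have D'_eq: "D' s = (h (R s) - sqrt (p s * q (\<tau> s))) * sqrt (T s)
      + h (R s) * ((sqrt (\<tau> s) - sqrt (s * T s))\<^sup>2 / (2 * R s))" if "s > 0" for s
    unfolding D'_def kp[OF that] b[OF that, symmetric] by (simp add: algebra_simps)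
  have t1: "0 \<le> (h (R s) - sqrt (p s * q (\<tau> s))) * sqrt (T s)" if "s > 0" for s
    using a[OF that] Tpos[OF that] by simp
  have t2: "0 \<le> h (R s) * ((sqrt (\<tau> s) - sqrt (s * T s))\<^sup>2 / (2 * R s))" if "s > 0" for s
    using H(4)[OF Rpos[OF that]] Rpos[OF that] by simp
  have D'_nonneg: "D' s \<ge> 0" if "s > 0" for s
    using t1[OF that] t2[OF that] D'_eq[OF that] by simp
  have D_mono: "D s \<le> D t" if "0 < s" "s \<le> t" for s t
    by (rule DERIV_nonneg_imp_nondecreasing[OF \<open>s \<le> t\<close>])
      (use D' D'_nonneg that in \<open>meson less_le_trans\<close>)
  \<comment> \<open>Positivity of \<open>H\<close> bounds \<open>D\<close> near 0 from below by
    \<open>- k * F\<close>, which tends to 0; monotonicity carries the bound to every s.\<close>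
  have D_nonneg: "D s \<ge> 0" if "s > 0" for s
  proof (rule tendsto_upperbound)
    have "((\<lambda>x. - k * F x) \<longlongrightarrow> - k * F 0) (at_right 0)"
      using F(1) by (intro tendsto_intros)
        (auto simp: continuous_on_def intro: tendsto_within_subset)
    then show "((\<lambda>x. - k * F x) \<longlongrightarrow> 0) (at_right 0)" using F(2) by simp
    show "\<forall>\<^sub>F x in at_right 0. - k * F x \<le> D s"
      using eventually_at_right_less[of 0] eventually_at_right_real[OF \<open>s > 0\<close>]
    proof eventually_elim
      case (elim x)
      have "- k * F x \<le> D x" using Hp(2)[OF Rpos[of x]] elim by (simp add: D_def)
      also have "\<dots> \<le> D s" using D_mono[of x s] elim by simp
      finally show ?case .
    qed
  qed simp
  have lim: "((\<lambda>x. c - k * F x) \<longlongrightarrow> c - k * A) at_top"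
    by (intro tendsto_intros F)
  have D_le: "D s \<le> c - k * A" if "s > 0" for s
  proof (rule tendsto_lowerbound[OF lim])
    show "\<forall>\<^sub>F x in at_top. D s \<le> c - k * F x"
      using eventually_ge_at_top[of s]
    proof eventually_elim
      case (elim x)
      with D_mono[of s x] that have "D s \<le> D x" by simp
      also have "\<dots> \<le> c - k * F x"
        using Hp(3)[of "R x"] Rpos[of x] elim that by (simp add: D_def)
      finally show ?case .
    qed
  qed simp
  \<comment> \<open>With this \<open>k\<close> the monotone function \<open>D\<close> is confined
    between 0 and c - sqrt (A * B). This gives the inequality, and equality forces \<open>D\<close>
    to vanish identically.\<close>
  have kA: "k * A = sqrt (A * B)"
    using Fp(4) Gp(4) by (simp add: k_def real_sqrt_mult real_sqrt_divide field_simps)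
  have "sqrt (A * B) \<le> c"
    using D_nonneg[of 1] D_le[of 1] kA by simp
  then have "(sqrt (A * B))\<^sup>2 \<le> c\<^sup>2"
    using Fp(4) Gp(4) by (intro power_mono) auto
  then show "A * B \<le> c\<^sup>2" using Fp(4) Gp(4) by simp
  assume eq: "A * B = c\<^sup>2"
  have "sqrt (A * B) = c" using eq Hp(4) by simp
  then have D0: "D s = 0" if "s > 0" for s
    using D_nonneg[OF that] D_le[OF that] kA by simp
  have D'0: "D' s = 0" if "s > 0" for s
  proof (rule DERIV_unique[OF D'[OF that]])
    show "(D has_real_derivative 0) (at s)"
      by (rule has_field_derivative_transform_within_open[of "\<lambda>_. 0" _ _ "{0<..}"])
        (use that D0 in auto)
  qed
  have e1: "h (R s) = sqrt (p s * q (\<tau> s))" if "s > 0" for s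
    using D'_eq[OF that] D'0[OF that] t1[OF that] t2[OF that] Tpos[OF that]
    by (smt (verit) mult_eq_0_iff real_sqrt_gt_zero)
  have e2: "\<tau> s = s * T s" if "s > 0" for s
  proof -
    have "h (R s) * ((sqrt (\<tau> s) - sqrt (s * T s))\<^sup>2 / (2 * R s)) = 0"
      using D'_eq[OF that] D'0[OF that] t1[OF that] t2[OF that] by linarith
    then have "(sqrt (\<tau> s) - sqrt (s * T s))\<^sup>2 = 0"
      using H(4)[OF Rpos[OF that]] Rpos[OF that]
      by (metis divide_eq_0_iff less_irrefl mult_eq_0_iff zero_neq_numeral)
    then show ?thesis by simp
  qed
  \<comment> \<open>The vanishing gap says \<tau> = s * \<tau>', so the quotient \<tau> s / s has
    derivative zero: the transport map is linear.\<close>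
  have "((\<lambda>s. \<tau> s / s) has_real_derivative 0) (at s)" if "s > 0" for s
  proof -
    have "((\<lambda>s. \<tau> s / s) has_real_derivative (T s * s - \<tau> s * 1) / (s * s)) (at s)"
      using \<tau>'[OF that] that unfolding T_def by (intro DERIV_divide) auto
    then show ?thesis using e2[OF that] by (simp add: mult.commute)
  qed
  then have "\<exists>m. \<forall>s\<in>{0<..}. \<tau> s / s = m"
    by (intro has_field_derivative_zero_constant) (auto intro: has_field_derivative_at_within)
  then obtain m where m: "\<And>s. s > 0 \<Longrightarrow> \<tau> s / s = m" by auto
  have "m > 0" using m[of 1] \<tau>(1)[of 1] by simp
  moreover have "p s * q (m * s) = (h (sqrt (s * (m * s))))\<^sup>2" if "s > 0" for s
  proof -
    have ts: "\<tau> s = m * s" using m[OF that] that by (simp add: field_simps)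
    have "(h (R s))\<^sup>2 = p s * q (\<tau> s)"
      using e1[OF that] F(4)[OF that] G(4)[OF \<tau>(1)[OF that]] by simp
    then show ?thesis by (simp add: R_def ts)
  qed
  ultimately show "\<exists>\<mu>>0. \<forall>s>0. p s * q (\<mu> * s) = (h (sqrt (s * (\<mu> * s))))\<^sup>2" by blast
qed

text \<open>Zero at the origin even for k = 0, so exponent 0 is the indicator of the open half-line.
  Bare and weighted half-spaces are then one family.\<close>

definition half_power :: "nat \<Rightarrow> real \<Rightarrow> real" where
  "half_power k s = (if s > 0 then s ^ k else 0)"

lemma half_power_nonneg [simp]: "half_power k s \<ge> 0"
  by (simp add: half_power_def)

lemma half_power_le_abs: "half_power k s \<le> \<bar>s\<bar> ^ k"
  by (simp add: half_power_def)

lemma borel_measurable_half_power [measurable]: "half_power k \<in> borel_measurable borel"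
  unfolding half_power_def by measurable

definition half_moment :: "nat \<Rightarrow> real" where
  "half_moment k = (LINT s|lborel. half_power k s * exp (- s\<^sup>2 / 2))"

lemma integrable_moment_gauss:
  fixes e :: real
  assumes "e > 0"
  shows "integrable lborel (\<lambda>s. \<bar>s\<bar> ^ k * exp (- e * s\<^sup>2))"
proof -
  define \<sigma> where "\<sigma> = 1 / sqrt (2 * e)"
  have s: "\<sigma> > 0" "\<sigma>\<^sup>2 = 1 / (2 * e)" using assms by (auto simp: \<sigma>_def power_divide)
  have "integrable lborel (\<lambda>x. sqrt (2 * pi * \<sigma>\<^sup>2) * (normal_density 0 \<sigma> x * \<bar>x - 0\<bar> ^ k))"
    by (intro integrable_mult_right integrable_normal_moment_abs s)
  moreover have "sqrt (2 * pi * \<sigma>\<^sup>2) * (normal_density 0 \<sigma> x * \<bar>x - 0\<bar> ^ k) = \<bar>x\<bar> ^ k * exp (- e * x\<^sup>2)" for x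
    using s assms by (simp add: normal_density_def)
  ultimately show ?thesis by (simp only: cong: integrable_cong)
qed

lemma integrable_half_power_gauss:
  fixes e :: real
  assumes "e > 0"
  shows "integrable lborel (\<lambda>s. half_power k s * exp (- e * s\<^sup>2))"
  by (rule Bochner_Integration.integrable_bound[OF integrable_moment_gauss[OF assms, of k]])
    (auto intro!: AE_I2 mult_right_mono half_power_le_abs simp: abs_mult)

lemma cumulative_half_power:
  fixes \<phi> :: "real \<Rightarrow> real"
  assumes cont: "continuous_on {0..} \<phi>"
    and int: "integrable lborel (\<lambda>s. half_power k s * \<phi> s)"
  obtains F where "continuous_on {0..} F" "F 0 = 0"
    "\<forall>s>0. (F has_real_derivative s ^ k * \<phi> s) (at s)"
    "(F \<longlongrightarrow> (LINT s|lborel. half_power k s * \<phi> s)) at_top"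
proof
  define p where "p s = s ^ k * \<phi> s" for s
  define F where "F s = integral {0..s} p" for s
  have contp: "continuous_on {0..b} p" for b
    unfolding p_def by (intro continuous_intros continuous_on_subset[OF cont]) auto
  have der: "(F has_real_derivative p s) (at s within {0..b})" if "0 \<le> s" "s \<le> b" for s b
    unfolding F_def by (rule integral_has_real_derivative[OF contp]) (use that in auto)
  have der': "(F has_real_derivative p s) (at s)" if "s > 0" for s
    using der[of s "s + 1"] that at_within_Icc_at[of 0 s "s + 1"] by simp
  show "\<forall>s>0. (F has_real_derivative s ^ k * \<phi> s) (at s)"
    using der' by (simp add: p_def)
  show "continuous_on {0..} F"
    unfolding continuous_on_eq_continuous_within
  proof
    fix x :: real assume x: "x \<in> {0..}"
    have "continuous (at x within {0..x+1}) F"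
      using der[of x "x + 1"] x by (intro DERIV_continuous) auto
    moreover have "at x within {0..x+1} = at x within {0..}"
      by (rule at_within_nhd[of _ "{..<x+1}"]) auto
    ultimately show "continuous (at x within {0..}) F"
      by (simp add: continuous_def)
  qed
  show "F 0 = 0" by (simp add: F_def)
  have "F y = (LINT x|lborel. indicator {..y} x *\<^sub>R (half_power k x * \<phi> x))" for y
  proof -
    have "(LINT x|lborel. indicator {..y} x *\<^sub>R (half_power k x * \<phi> x)) = (LINT x:{0..y}|lborel. p x)"
      unfolding set_lebesgue_integral_def
    proof (rule integral_cong_AE)
      \<comment> \<open>The integrands can differ only at 0: for k = 0 the power is 1 there while
        \<open>half_power\<close> vanishes.\<close>
      show "AE x in lborel. indicator {..y} x *\<^sub>R (half_power k x * \<phi> x) = indicator {0..y} x *\<^sub>R p x"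
        using AE_lborel_singleton[of 0]
        by eventually_elim (auto simp: indicator_def half_power_def p_def)
      show "(\<lambda>x. indicator {0..y} x *\<^sub>R p x) \<in> borel_measurable lborel"
        using borel_integrable_compact[OF _ contp[of y]] by (auto simp: mult.commute)
    qed (use int in measurable)
    also have "\<dots> = F y"
      unfolding F_def
      by (intro set_borel_integral_eq_integral(2) borel_integrable_atLeastAtMost')
        (rule contp)
    finally show ?thesis by simp
  qed
  then have "F = (\<lambda>y. LINT x|lborel. indicator {..y} x *\<^sub>R (half_power k x * \<phi> x))"
    by blast
  then show "(F \<longlongrightarrow> (LINT s|lborel. half_power k s * \<phi> s)) at_top"
    using tendsto_integral_at_top[OF _ int] by simp
qed

text \<open>Exchanging s and t makes the bound two-sided, so difference quotients are at most a
  multiple of |s - t| and the derivative is zero. No differentiability of \<open>L\<close> has to be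
  known beforehand.\<close>

lemma constant_if_quadratic_modulus:
  fixes L :: "real \<Rightarrow> real"
  assumes L: "\<And>s t. s > 0 \<Longrightarrow> t > 0 \<Longrightarrow> L s - L t \<le> C * (s - t)\<^sup>2"
  obtains c where "\<And>s. s > 0 \<Longrightarrow> L s = c"
proof -
  have "(L has_real_derivative 0) (at s)" if "s > 0" for s
    unfolding has_field_derivative_iff
  proof (rule Lim_null_comparison)
    show "((\<lambda>y. C * \<bar>y - s\<bar>) \<longlongrightarrow> 0) (at s)"
      by (auto intro!: tendsto_eq_intros)
    show "\<forall>\<^sub>F y in at s. norm ((L y - L s) / (y - s)) \<le> C * \<bar>y - s\<bar>"
      using eventually_at_in_open[of "{0<..}" s]
    proof (rule eventually_mono)
      fix y assume y: "y \<in> {0<..} - {s}"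
      have "\<bar>L y - L s\<bar> \<le> C * (y - s)\<^sup>2"
        using L[of y s] L[of s y] y that by (auto simp: power2_commute abs_le_iff)
      also have "\<dots> = (C * \<bar>y - s\<bar>) * \<bar>y - s\<bar>" by (simp add: power2_eq_square)
      finally show "norm ((L y - L s) / (y - s)) \<le> C * \<bar>y - s\<bar>"
        using y by (simp add: abs_divide divide_le_eq)
    qed (use that in auto)
  qed
  then have "\<exists>c. \<forall>s\<in>{0<..}. L s = c"
    by (intro has_field_derivative_zero_constant) (auto intro: has_field_derivative_at_within)
  then show ?thesis using that by auto
qed

lemma eq_on_half_line_closure:
  fixes f g :: "real \<Rightarrow> real"
  assumes "continuous_on {0..} f" "continuous_on {0..} g" "\<And>s. s > 0 \<Longrightarrow> f s = g s" "s \<ge> 0"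
  shows "f s = g s"
proof -
  have lim: "((\<lambda>x. f x - g x) \<longlongrightarrow> f s - g s) (at_right s)"
    using assms(1,2,4) by (intro tendsto_diff)
      (auto simp: continuous_on_def intro: tendsto_within_subset)
  have "((\<lambda>x. f x - g x) \<longlongrightarrow> 0) (at_right s)"
    by (rule tendsto_eventually, use eventually_at_right_less[of s] in \<open>rule eventually_mono\<close>)
      (use assms(3,4) in auto)
  with lim have "f s - g s = 0" by (intro tendsto_unique[of "at_right s"]) auto
  then show ?thesis by simp
qed

text \<open>The factor s^k on both densities is harmless because (s * t)^k is the square of sqrt (s
  * t)^k; the reference density is the half-Gaussian with the same power. In the equality case
  linear transport yields \<phi> s * \<psi> (\<mu> * s) = exp (- \<mu> * s^2), an identity along one
  ray only; playing it against the inequality off the ray determines both functions.\<close>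

lemma half_line_santalo:
  fixes \<phi> \<psi> :: "real \<Rightarrow> real"
  assumes \<phi>: "continuous_on {0..} \<phi>" "\<forall>s\<ge>0. \<phi> s > 0"
      "integrable lborel (\<lambda>s. half_power k s * \<phi> s)"
    and \<psi>: "continuous_on {0..} \<psi>" "\<forall>s\<ge>0. \<psi> s > 0"
      "integrable lborel (\<lambda>s. half_power k s * \<psi> s)"
    and le: "\<forall>s>0. \<forall>t>0. \<phi> s * \<psi> t \<le> exp (- (s * t))"
  shows "(LINT s|lborel. half_power k s * \<phi> s) * (LINT s|lborel. half_power k s * \<psi> s) \<le> (half_moment k)\<^sup>2"
    and "(LINT s|lborel. half_power k s * \<phi> s) * (LINT s|lborel. half_power k s * \<psi> s) = (half_moment k)\<^sup>2 \<Longrightarrow>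
      \<exists>a>0. \<exists>\<mu>>0. \<forall>s\<ge>0. \<phi> s = a * exp (- \<mu> * s\<^sup>2 / 2) \<and> \<psi> s = exp (- s\<^sup>2 / \<mu> / 2) / a"
proof -
  note \<phi> = \<phi>(1) \<phi>(2)[rule_format] \<phi>(3)
  note \<psi> = \<psi>(1) \<psi>(2)[rule_format] \<psi>(3)
  note le = le[rule_format]
  define A where "A = (LINT s|lborel. half_power k s * \<phi> s)"
  define B where "B = (LINT s|lborel. half_power k s * \<psi> s)"
  obtain F where F: "continuous_on {0..} F" "F 0 = 0"
    "\<forall>s>0. (F has_real_derivative s ^ k * \<phi> s) (at s)" "(F \<longlongrightarrow> A) at_top"
    by (rule cumulative_half_power[OF \<phi>(1,3), folded A_def])
  obtain G where G: "continuous_on {0..} G" "G 0 = 0"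
    "\<forall>s>0. (G has_real_derivative s ^ k * \<psi> s) (at s)" "(G \<longlongrightarrow> B) at_top"
    by (rule cumulative_half_power[OF \<psi>(1,3), folded B_def])
  have ce: "continuous_on {0..} (\<lambda>s::real. exp (- s\<^sup>2 / 2))"
    by (intro continuous_intros) auto
  have ie: "integrable lborel (\<lambda>s. half_power k s * exp (- s\<^sup>2 / 2))"
    using integrable_half_power_gauss[of "1/2" k] by simp
  obtain H where H: "continuous_on {0..} H" "H 0 = 0"
    "\<forall>s>0. (H has_real_derivative s ^ k * exp (- s\<^sup>2 / 2)) (at s)" "(H \<longlongrightarrow> half_moment k) at_top"
    by (rule cumulative_half_power[OF ce ie, folded half_moment_def])
  have sq: "(sqrt (s * t) ^ k * exp (- (sqrt (s * t))\<^sup>2 / 2))\<^sup>2 = (s * t) ^ k * exp (- (s * t))"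
    if "s > 0" "t > 0" for s t
  proof -
    have "(sqrt (s * t) ^ k)\<^sup>2 = (s * t) ^ k"
      using that by (simp add: power_commuting_commutes power2_eq_square flip: power_mult_distrib)
    moreover have "(exp (- (sqrt (s * t))\<^sup>2 / 2))\<^sup>2 = exp (- (s * t))"
      using that by (simp flip: exp_double)
    ultimately show ?thesis by (simp add: power_mult_distrib)
  qed
  have le': "s ^ k * \<phi> s * (t ^ k * \<psi> t) \<le> (sqrt (s * t) ^ k * exp (- (sqrt (s * t))\<^sup>2 / 2))\<^sup>2"
    if "s > 0" "t > 0" for s t
  proof -
    have "(s * t) ^ k * (\<phi> s * \<psi> t) \<le> (s * t) ^ k * exp (- (s * t))"
      using le[OF that] that by (intro mult_left_mono) auto
    then show ?thesis unfolding sq[OF that] by (simp add: power_mult_distrib mult_ac)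
  qed
  have pos: "\<forall>s>0. s ^ k * \<phi> s > 0" "\<forall>s>0. s ^ k * \<psi> s > 0" "\<forall>s>0. s ^ k * exp (- s\<^sup>2 / 2) > (0::real)"
    using \<phi>(2) \<psi>(2) by auto
  note T = transport_inequality[OF F(1-3) pos(1) F(4) G(1-3) pos(2) G(4) H(1-3) pos(3) H(4), OF le']
  show "(LINT s|lborel. half_power k s * \<phi> s) * (LINT s|lborel. half_power k s * \<psi> s) \<le> (half_moment k)\<^sup>2"
    using T(1) by (simp add: A_def B_def)
  assume "(LINT s|lborel. half_power k s * \<phi> s) * (LINT s|lborel. half_power k s * \<psi> s) = (half_moment k)\<^sup>2"
  then have "A * B = (half_moment k)\<^sup>2" by (simp add: A_def B_def)
  with T(2) obtain \<mu> where \<mu>: "\<mu> > 0" and eq0: "\<And>s. s > 0 \<Longrightarrow>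
      s ^ k * \<phi> s * ((\<mu> * s) ^ k * \<psi> (\<mu> * s)) = (sqrt (s * (\<mu> * s)) ^ k * exp (- (sqrt (s * (\<mu> * s)))\<^sup>2 / 2))\<^sup>2"
    by blast
  have eq: "\<phi> s * \<psi> (\<mu> * s) = exp (- (\<mu> * s\<^sup>2))" if "s > 0" for s
  proof -
    have "(s * (\<mu> * s)) ^ k * (\<phi> s * \<psi> (\<mu> * s)) = (s * (\<mu> * s)) ^ k * exp (- (s * (\<mu> * s)))"
      using eq0[OF that] sq[OF that, of "\<mu> * s"] that \<mu> by (simp add: power_mult_distrib mult_ac)
    moreover have "(s * (\<mu> * s)) ^ k \<noteq> 0" using that \<mu> by simp
    moreover have "s * (\<mu> * s) = \<mu> * s\<^sup>2" by (simp add: power2_eq_square)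
    ultimately show ?thesis by (metis mult_cancel_left)
  qed
  define L where "L s = ln (\<phi> s) + \<mu> * s\<^sup>2 / 2" for s
  \<comment> \<open>The inequality at (s, \<mu> * t) divided by the identity on the ray at t
    compares \<phi> s with \<phi> t; completing the square leaves a quadratic modulus.\<close>
  have "L s - L t \<le> \<mu> / 2 * (s - t)\<^sup>2" if "s > 0" "t > 0" for s t
  proof -
    have "\<phi> s * exp (- (\<mu> * t\<^sup>2)) = \<phi> s * \<psi> (\<mu> * t) * \<phi> t"
      unfolding eq[OF that(2), symmetric] by (simp only: mult_ac)
    also have "\<dots> \<le> exp (- (s * (\<mu> * t))) * \<phi> t"
      using le[of s "\<mu> * t"] that \<mu> \<phi>(2)[of t] by (intro mult_right_mono) auto
    finally have "ln (\<phi> s * exp (- (\<mu> * t\<^sup>2))) \<le> ln (exp (- (s * (\<mu> * t))) * \<phi> t)"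
      using \<phi>(2)[of s] \<phi>(2)[of t] that by simp
    then have "ln (\<phi> s) - \<mu> * t\<^sup>2 \<le> - (s * (\<mu> * t)) + ln (\<phi> t)"
      using \<phi>(2)[of s] \<phi>(2)[of t] that by (simp add: ln_mult_pos)
    then show ?thesis by (simp add: L_def power2_diff) (simp add: algebra_simps)
  qed
  then obtain c where c: "\<And>s. s > 0 \<Longrightarrow> L s = c"
    using constant_if_quadratic_modulus[of L "\<mu> / 2"] by blast
  have p1: "\<phi> s = exp c * exp (- \<mu> * s\<^sup>2 / 2)" if "s > 0" for s
  proof -
    have "ln (\<phi> s) = c + - \<mu> * s\<^sup>2 / 2" using c[OF that] by (simp add: L_def)
    then show ?thesis using \<phi>(2)[of s] that by (metis exp_add exp_ln less_imp_le)
  qed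
  have p2: "\<psi> t = exp (- t\<^sup>2 / \<mu> / 2) / exp c" if "t > 0" for t
  proof -
    have "\<phi> (t / \<mu>) * \<psi> t = exp (- (t\<^sup>2 / \<mu>))"
      using eq[of "t / \<mu>"] that \<mu> by (simp add: power_divide power2_eq_square)
    moreover have "\<phi> (t / \<mu>) = exp c * exp (- (t\<^sup>2 / \<mu>) / 2)"
      using p1[of "t / \<mu>"] that \<mu> by (simp add: power_divide power2_eq_square)
    moreover have "exp (- (t\<^sup>2 / \<mu>)) = exp (- (t\<^sup>2 / \<mu>) / 2) * exp (- (t\<^sup>2 / \<mu>) / 2)"
      by (simp flip: exp_add)
    ultimately have "exp c * (exp (- (t\<^sup>2 / \<mu>) / 2) * \<psi> t) = exp (- (t\<^sup>2 / \<mu>) / 2) * exp (- (t\<^sup>2 / \<mu>) / 2)"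
      by (simp only: mult_ac)
    then have "exp c * \<psi> t = exp (- (t\<^sup>2 / \<mu>) / 2)" by simp
    then show ?thesis by (simp add: eq_divide_eq mult.commute)
  qed
  have "\<phi> s = exp c * exp (- \<mu> * s\<^sup>2 / 2)" if "s \<ge> 0" for s
    by (rule eq_on_half_line_closure[OF \<phi>(1) _ p1 that]) (auto intro!: continuous_intros)
  moreover have "\<psi> s = exp (- s\<^sup>2 / \<mu> / 2) / exp c" if "s \<ge> 0" for s
    by (rule eq_on_half_line_closure[OF \<psi>(1) _ p2 that]) (use \<mu> in \<open>auto intro!: continuous_intros\<close>)
  ultimately show "\<exists>a>0. \<exists>\<mu>>0. \<forall>s\<ge>0. \<phi> s = a * exp (- \<mu> * s\<^sup>2 / 2) \<and> \<psi> s = exp (- s\<^sup>2 / \<mu> / 2) / a"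
    using \<mu> by (intro exI[of _ "exp c"] exI[of _ \<mu>]) auto
qed

section \<open>Lebesgue measure on coordinate subspaces\<close>

text \<open>Lebesgue measure of the subspace spanned by \<open>B\<close>, carried by the ambient
  type so that an induction may change the dimension without changing types. For empty
  \<open>B\<close> it is the unit mass at 0.\<close>

definition span_lborel :: "'a::euclidean_space set \<Rightarrow> 'a measure" where
  "span_lborel B = distr (\<Pi>\<^sub>M b\<in>B. lborel) borel (\<lambda>f. \<Sum>b\<in>B. f b *\<^sub>R b)"

lemma sets_span_lborel [simp, measurable_cong]: "sets (span_lborel B) = sets borel"
  by (simp add: span_lborel_def)

lemma space_span_lborel [simp]: "space (span_lborel B) = UNIV"
  by (simp add: span_lborel_def)

lemma span_lborel_Basis: "span_lborel Basis = (lborel :: 'a::euclidean_space measure)"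
  unfolding span_lborel_def by (rule lborel_eq[symmetric])

lemma span_lborel_embedding_measurable [measurable]:
  fixes B :: "'a::euclidean_space set"
  shows "(\<lambda>f. \<Sum>b\<in>B. f b *\<^sub>R b) \<in> borel_measurable (\<Pi>\<^sub>M b\<in>B. lborel)"
proof (intro borel_measurable_sum borel_measurable_scaleR)
  show "(\<lambda>f. f b) \<in> borel_measurable (\<Pi>\<^sub>M b\<in>B. lborel)" if "b \<in> B" for b :: 'a
    using measurable_component_singleton[OF that, of "\<lambda>_. lborel"] by simp
qed simp

interpretation lborel_product: product_sigma_finite "\<lambda>_. lborel :: real measure"
  by standard

lemma nn_integral_span_lborel_empty:
  "f \<in> borel_measurable borel \<Longrightarrow> (\<integral>\<^sup>+x. f x \<partial>span_lborel {}) = f 0"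
  by (simp add: span_lborel_def nn_integral_distr PiM_empty nn_integral_count_space_finite)

lemma nn_integral_span_lborel_insert:
  fixes f :: "'a::euclidean_space \<Rightarrow> ennreal"
  assumes [simp]: "finite B" "b \<notin> B" and [measurable]: "f \<in> borel_measurable borel"
  shows "(\<integral>\<^sup>+x. f x \<partial>span_lborel (insert b B)) = (\<integral>\<^sup>+x. \<integral>\<^sup>+s. f (x + s *\<^sub>R b) \<partial>lborel \<partial>span_lborel B)"
proof -
  have "(\<Sum>c\<in>B. (if c = b then s else x c) *\<^sub>R c) = (\<Sum>c\<in>B. x c *\<^sub>R c)" for x :: "'a \<Rightarrow> real" and s
    by (rule sum.cong) auto
  then show ?thesis
    unfolding span_lborel_def
    by (simp add: nn_integral_distr lborel_product.product_nn_integral_insert fun_upd_def add.commute)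
qed

lemma AE_span_lborel: "finite B \<Longrightarrow> AE x in span_lborel B. x \<in> span (B :: 'a::euclidean_space set)"
  unfolding span_lborel_def
  by (subst AE_distr_iff)
    (auto intro!: borel_closed closed_subspace span_sum span_scale intro: span_base)

lemma nn_integral_lborel_translate:
  fixes f :: "real \<Rightarrow> ennreal"
  assumes [measurable]: "f \<in> borel_measurable borel"
  shows "(\<integral>\<^sup>+s. f (s + t) \<partial>lborel) = (\<integral>\<^sup>+s. f s \<partial>lborel)"
  by (subst (2) lborel_distr_plus[symmetric, of t]) (simp add: nn_integral_distr add.commute)

lemma span_insert_decompose:
  assumes "w \<in> span (insert b B)"
  obtains v t where "v \<in> span B" "w = v + t *\<^sub>R b"
  using assms by (metis diff_add_cancel span_breakdown_eq)

lemma nn_integral_span_lborel_translate: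
  fixes f :: "'a::euclidean_space \<Rightarrow> ennreal"
  assumes "finite B" "w \<in> span B" "f \<in> borel_measurable borel"
  shows "(\<integral>\<^sup>+x. f (x + w) \<partial>span_lborel B) = (\<integral>\<^sup>+x. f x \<partial>span_lborel B)"
  using assms
proof (induction B arbitrary: w f rule: finite_induct)
  case (insert b B)
  note [measurable] = insert.prems(2)
  obtain v t where v: "v \<in> span B" and w: "w = v + t *\<^sub>R b"
    using span_insert_decompose[OF insert.prems(1)] .
  have "(\<integral>\<^sup>+x. f (x + w) \<partial>span_lborel (insert b B))
      = (\<integral>\<^sup>+x. \<integral>\<^sup>+s. f (x + v + (s + t) *\<^sub>R b) \<partial>lborel \<partial>span_lborel B)"
    using insert.hyps by (subst nn_integral_span_lborel_insert) (auto simp: w algebra_simps)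
  also have "\<dots> = (\<integral>\<^sup>+x. \<integral>\<^sup>+s. f (x + v + s *\<^sub>R b) \<partial>lborel \<partial>span_lborel B)"
    by (subst nn_integral_lborel_translate) auto
  also have "\<dots> = (\<integral>\<^sup>+x. \<integral>\<^sup>+s. f (x + s *\<^sub>R b) \<partial>lborel \<partial>span_lborel B)"
    by (rule insert.IH[OF v]) measurable
  also have "\<dots> = (\<integral>\<^sup>+x. f x \<partial>span_lborel (insert b B))"
    using insert.hyps by (subst nn_integral_span_lborel_insert) auto
  finally show ?case .
qed simp

lemma nn_integral_lborel_uminus:
  fixes f :: "real \<Rightarrow> ennreal"
  assumes [measurable]: "f \<in> borel_measurable borel"
  shows "(\<integral>\<^sup>+s. f (- s) \<partial>lborel) = (\<integral>\<^sup>+s. f s \<partial>lborel)"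
  by (subst (2) lborel_distr_uminus[symmetric]) (simp add: nn_integral_distr)

lemma nn_integral_span_lborel_uminus:
  fixes f :: "'a::euclidean_space \<Rightarrow> ennreal"
  assumes "finite B" "f \<in> borel_measurable borel"
  shows "(\<integral>\<^sup>+x. f (- x) \<partial>span_lborel B) = (\<integral>\<^sup>+x. f x \<partial>span_lborel B)"
  using assms
proof (induction B arbitrary: f rule: finite_induct)
  case empty
  then show ?case by (simp add: nn_integral_span_lborel_empty)
next
  case (insert b B)
  note [measurable] = insert.prems
  have "(\<integral>\<^sup>+x. f (- x) \<partial>span_lborel (insert b B))
      = (\<integral>\<^sup>+x. \<integral>\<^sup>+s. f (- x + (- s) *\<^sub>R b) \<partial>lborel \<partial>span_lborel B)"
    using insert.hyps by (subst nn_integral_span_lborel_insert) (auto simp: algebra_simps)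
  also have "\<dots> = (\<integral>\<^sup>+x. \<integral>\<^sup>+s. f (- x + s *\<^sub>R b) \<partial>lborel \<partial>span_lborel B)"
    by (subst nn_integral_lborel_uminus[of "\<lambda>s. f (- _ + s *\<^sub>R b)"]) auto
  also have "\<dots> = (\<integral>\<^sup>+x. \<integral>\<^sup>+s. f (x + s *\<^sub>R b) \<partial>lborel \<partial>span_lborel B)"
    by (rule insert.IH) measurable
  also have "\<dots> = (\<integral>\<^sup>+x. f x \<partial>span_lborel (insert b B))"
    using insert.hyps by (subst nn_integral_span_lborel_insert) auto
  finally show ?case .
qed

lemma span_Basis_orthogonal:
  fixes x :: "'a::euclidean_space"
  assumes "insert b B \<subseteq> Basis" "b \<notin> B" "x \<in> span B"
  shows "inner x b = 0" "inner b x = 0"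
proof -
  show "inner x b = 0"
    using assms(3)
  proof (induction x rule: span_induct_alt)
    case (step t c y)
    then have "c \<in> Basis" "b \<in> Basis" "c \<noteq> b" using assms by auto
    with step show ?case by (simp add: inner_add_left inner_Basis)
  qed simp
  then show "inner b x = 0" by (simp add: inner_commute)
qed

lemma norm_add_Basis:
  fixes x :: "'a::euclidean_space"
  assumes "insert b B \<subseteq> Basis" "b \<notin> B" "x \<in> span B"
  shows "(norm (x + s *\<^sub>R b))\<^sup>2 = (norm x)\<^sup>2 + s\<^sup>2"
proof -
  have "inner b b = 1" using assms(1) by (simp add: inner_Basis)
  then show ?thesis
    using span_Basis_orthogonal[OF assms] unfolding power2_norm_eq_inner
    by (simp add: inner_add_left inner_add_right power2_eq_square)
qed

lemma nn_integral_gauss_real: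
  assumes "e > 0"
  shows "(\<integral>\<^sup>+s. ennreal (exp (- e * s\<^sup>2)) \<partial>lborel) = ennreal (sqrt (pi / e))"
proof -
  define \<sigma> where "\<sigma> = 1 / sqrt (2 * e)"
  have s: "\<sigma> > 0" "\<sigma>\<^sup>2 = 1 / (2 * e)" using assms by (auto simp: \<sigma>_def power_divide)
  have "exp (- e * s\<^sup>2) = sqrt (pi / e) * normal_density 0 \<sigma> s" for s
    using s assms by (simp add: normal_density_def)
  moreover have "(\<integral>\<^sup>+s. ennreal (sqrt (pi / e) * normal_density 0 \<sigma> s) \<partial>lborel)
      = ennreal (sqrt (pi / e)) * (\<integral>\<^sup>+s. ennreal (normal_density 0 \<sigma> s) \<partial>lborel)"
    using assms by (simp add: ennreal_mult nn_integral_cmult)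
  moreover have "(\<integral>\<^sup>+s. ennreal (normal_density 0 \<sigma> s) \<partial>lborel) = 1"
    using integral_normal_density[OF s(1)] s(1)
    by (subst nn_integral_eq_integral) (auto intro: integrable_normal_density)
  ultimately show ?thesis by simp
qed

lemma nn_integral_gauss:
  assumes "finite B" "B \<subseteq> Basis" "e > 0"
  shows "(\<integral>\<^sup>+x. ennreal (exp (- e * (norm x)\<^sup>2)) \<partial>span_lborel B) = ennreal (sqrt (pi / e) ^ card B)"
  using assms
proof (induction B rule: finite_induct)
  case empty
  then show ?case by (simp add: nn_integral_span_lborel_empty)
next
  case (insert b B)
  have "(\<integral>\<^sup>+x. ennreal (exp (- e * (norm x)\<^sup>2)) \<partial>span_lborel (insert b B))
      = (\<integral>\<^sup>+x. \<integral>\<^sup>+s. ennreal (exp (- e * (norm (x + s *\<^sub>R b))\<^sup>2)) \<partial>lborel \<partial>span_lborel B)"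
    using insert.hyps by (intro nn_integral_span_lborel_insert) auto
  also have "\<dots> = (\<integral>\<^sup>+x. ennreal (exp (- e * (norm x)\<^sup>2)) * ennreal (sqrt (pi / e)) \<partial>span_lborel B)"
  proof (rule nn_integral_cong_AE, use AE_span_lborel[OF insert.hyps(1)] in eventually_elim)
    case (elim x)
    have "exp (- e * (norm (x + s *\<^sub>R b))\<^sup>2) = exp (- e * (norm x)\<^sup>2) * exp (- e * s\<^sup>2)" for s
      using norm_add_Basis[OF insert.prems(1) insert.hyps(2) elim]
      by (simp add: algebra_simps flip: exp_add)
    then show ?case
      using nn_integral_gauss_real[OF \<open>e > 0\<close>] by (simp add: ennreal_mult nn_integral_cmult)
  qed
  also have "\<dots> = ennreal (sqrt (pi / e) ^ card (insert b B))"
    using insert by (subst nn_integral_multc) (auto simp: ennreal_mult' mult.commute)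
  finally show ?case .
qed

text \<open>Balls have finite measure because the indicator of the ball of radius r is dominated by
  exp (r^2) * exp (- |x|^2), whose integral is already known.\<close>

lemma sigma_finite_span_lborel:
  assumes "finite B" "B \<subseteq> Basis"
  shows "sigma_finite_measure (span_lborel (B :: 'a::euclidean_space set))"
proof
  let ?C = "range (\<lambda>n::nat. cball 0 (real n) :: 'a set)"
  have "emeasure (span_lborel B) (cball 0 r) \<noteq> \<infinity>" for r
  proof -
    have "emeasure (span_lborel B) (cball 0 r)
        = (\<integral>\<^sup>+x. indicator (cball 0 r) x \<partial>span_lborel B)"
      by simp
    also have "\<dots> \<le> (\<integral>\<^sup>+x. ennreal (exp (r\<^sup>2)) * ennreal (exp (- 1 * (norm x)\<^sup>2)) \<partial>span_lborel B)"
    proof (rule nn_integral_mono)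
      fix x :: 'a
      have "1 \<le> exp (r\<^sup>2) * exp (- 1 * (norm x)\<^sup>2)" if "norm x \<le> r"
        using power_mono[OF that norm_ge_zero, of 2] by (simp flip: exp_add)
      then show "indicator (cball 0 r) x \<le> ennreal (exp (r\<^sup>2)) * ennreal (exp (- 1 * (norm x)\<^sup>2))"
        by (auto simp: indicator_def simp flip: ennreal_mult'')
    qed
    also have "\<dots> < \<infinity>"
      using nn_integral_gauss[OF assms, of 1]
      by (simp add: nn_integral_cmult ennreal_mult_less_top)
    finally show ?thesis by simp
  qed
  moreover have "\<Union>?C = UNIV"
    by (auto simp: real_arch_simple)
  ultimately show "\<exists>A. countable A \<and> A \<subseteq> sets (span_lborel B) \<and> \<Union> A = space (span_lborel B) \<and>
      (\<forall>a\<in>A. emeasure (span_lborel B) a \<noteq> \<infinity>)"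
    by (intro exI[of _ ?C]) auto
qed

text \<open>Presents the measure as an image of a product measure, so that Fubini becomes available
  for real-valued integrals and not only for nonnegative ones.\<close>

lemma span_lborel_insert_distr:
  fixes B :: "'a::euclidean_space set"
  assumes "finite B" "B \<subseteq> Basis" "b \<notin> B"
  shows "span_lborel (insert b B) = distr (span_lborel B \<Otimes>\<^sub>M lborel) borel (\<lambda>(x, s). x + s *\<^sub>R b)"
proof (rule measure_eqI)
  fix A assume "A \<in> sets (span_lborel (insert b B))"
  then have [measurable]: "A \<in> sets borel" by simp
  have "emeasure (span_lborel (insert b B)) A = (\<integral>\<^sup>+x. indicator A x \<partial>span_lborel (insert b B))"
    by simp
  also have "\<dots> = (\<integral>\<^sup>+x. \<integral>\<^sup>+s. indicator A (x + s *\<^sub>R b) \<partial>lborel \<partial>span_lborel B)"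
    using assms by (intro nn_integral_span_lborel_insert) auto
  also have "\<dots> = (\<integral>\<^sup>+z. indicator A (fst z + snd z *\<^sub>R b) \<partial>(span_lborel B \<Otimes>\<^sub>M lborel))"
    by (subst lborel.nn_integral_fst[symmetric]) auto
  also have "\<dots> = (\<integral>\<^sup>+z. indicator A z \<partial>distr (span_lborel B \<Otimes>\<^sub>M lborel) borel (\<lambda>(x, s). x + s *\<^sub>R b))"
    by (subst nn_integral_distr) (auto simp: case_prod_beta)
  finally show "emeasure (span_lborel (insert b B)) A
      = emeasure (distr (span_lborel B \<Otimes>\<^sub>M lborel) borel (\<lambda>(x, s). x + s *\<^sub>R b)) A"
    by simp
qed simp

lemma integral_span_lborel_insert:
  fixes f :: "'a::euclidean_space \<Rightarrow> real"
  assumes B: "finite B" "B \<subseteq> Basis" "b \<notin> B"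
    and int: "integrable (span_lborel (insert b B)) f"
  shows "(LINT x|span_lborel (insert b B). f x) = (LINT x|span_lborel B. LINT s|lborel. f (x + s *\<^sub>R b))"
    and "(LINT x|span_lborel (insert b B). f x) = (LINT s|lborel. LINT x|span_lborel B. f (x + s *\<^sub>R b))"
    and "integrable (span_lborel B) (\<lambda>x. LINT s|lborel. f (x + s *\<^sub>R b))"
    and "integrable lborel (\<lambda>s. LINT x|span_lborel B. f (x + s *\<^sub>R b))"
proof -
  interpret pair_sigma_finite "span_lborel B" "lborel :: real measure"
    by (intro pair_sigma_finite.intro sigma_finite_span_lborel[OF B(1,2)] sigma_finite_lborel)
  have [measurable]: "f \<in> borel_measurable borel" using int by auto
  have int': "integrable (span_lborel B \<Otimes>\<^sub>M lborel) (\<lambda>z. f (fst z + snd z *\<^sub>R b))"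
    using int unfolding span_lborel_insert_distr[OF B] 
    by (subst (asm) integrable_distr_eq) (auto simp: case_prod_beta)
  have eq: "(LINT x|span_lborel (insert b B). f x) = integral\<^sup>L (span_lborel B \<Otimes>\<^sub>M lborel) (\<lambda>z. f (fst z + snd z *\<^sub>R b))"
    unfolding span_lborel_insert_distr[OF B] by (subst integral_distr) (auto simp: case_prod_beta)
  show "(LINT x|span_lborel (insert b B). f x) = (LINT x|span_lborel B. LINT s|lborel. f (x + s *\<^sub>R b))"
    unfolding eq using integral_fst'[OF int'] by simp
  show "(LINT x|span_lborel (insert b B). f x) = (LINT s|lborel. LINT x|span_lborel B. f (x + s *\<^sub>R b))"
    unfolding eq using integral_snd[of "\<lambda>x s. f (x + s *\<^sub>R b)"] int' by (simp add: case_prod_beta')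
  show "integrable (span_lborel B) (\<lambda>x. LINT s|lborel. f (x + s *\<^sub>R b))"
    using integrable_fst'[OF int'] by simp
  show "integrable lborel (\<lambda>s. LINT x|span_lborel B. f (x + s *\<^sub>R b))"
    using integrable_snd[of "\<lambda>x s. f (x + s *\<^sub>R b)"] int' by (simp add: case_prod_beta')
qed

lemma distr_span_lborel_translate:
  fixes w :: "'a::euclidean_space"
  assumes "finite B" "w \<in> span B"
  shows "distr (span_lborel B) borel (\<lambda>x. x + w) = span_lborel B"
proof (rule measure_eqI)
  fix A assume "A \<in> sets (distr (span_lborel B) borel (\<lambda>x. x + w))"
  then have [measurable]: "A \<in> sets borel" by simp
  have "emeasure (distr (span_lborel B) borel (\<lambda>x. x + w)) A = (\<integral>\<^sup>+x. indicator A (x + w) \<partial>span_lborel B)"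
    by (subst nn_integral_indicator[symmetric], simp, subst nn_integral_distr) auto
  also have "\<dots> = (\<integral>\<^sup>+x. indicator A x \<partial>span_lborel B)"
    by (rule nn_integral_span_lborel_translate[OF assms]) measurable
  finally show "emeasure (distr (span_lborel B) borel (\<lambda>x. x + w)) A = emeasure (span_lborel B) A"
    by simp
qed simp

lemma distr_span_lborel_uminus:
  fixes B :: "'a::euclidean_space set"
  assumes "finite B"
  shows "distr (span_lborel B) borel uminus = span_lborel B"
proof (rule measure_eqI)
  fix A assume "A \<in> sets (distr (span_lborel B) borel uminus)"
  then have [measurable]: "A \<in> sets borel" by simp
  have "emeasure (distr (span_lborel B) borel uminus) A = (\<integral>\<^sup>+x. indicator A (- x) \<partial>span_lborel B)"
    by (subst nn_integral_indicator[symmetric], simp, subst nn_integral_distr) auto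
  also have "\<dots> = (\<integral>\<^sup>+x. indicator A x \<partial>span_lborel B)"
    by (rule nn_integral_span_lborel_uminus[OF assms]) measurable
  finally show "emeasure (distr (span_lborel B) borel uminus) A = emeasure (span_lborel B) A"
    by simp
qed simp

lemma integral_span_lborel_translate:
  fixes f :: "'a::euclidean_space \<Rightarrow> real"
  assumes "finite B" "w \<in> span B" "f \<in> borel_measurable borel"
  shows "(LINT x|span_lborel B. f (x + w)) = (LINT x|span_lborel B. f x)"
  by (subst (2) distr_span_lborel_translate[OF assms(1,2), symmetric])
    (use assms in \<open>simp add: integral_distr\<close>)

lemma integral_span_lborel_uminus:
  fixes f :: "'a::euclidean_space \<Rightarrow> real"
  assumes "finite B" "f \<in> borel_measurable borel"
  shows "(LINT x|span_lborel B. f (- x)) = (LINT x|span_lborel B. f x)"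
  by (subst (2) distr_span_lborel_uminus[OF assms(1), symmetric])
    (use assms in \<open>simp add: integral_distr\<close>)

lemma span_lborel_not_AE_False:
  assumes "finite B" "B \<subseteq> (Basis :: 'a::euclidean_space set)"
  shows "\<not> (AE x in span_lborel B. False)"
proof
  assume "AE x in span_lborel B. False"
  then have "(\<integral>\<^sup>+x. ennreal (exp (- 1 * (norm x)\<^sup>2)) \<partial>span_lborel B) = (\<integral>\<^sup>+x. 0 \<partial>span_lborel B)"
    by (intro nn_integral_cong_AE) (auto elim: eventually_mono)
  then show False using nn_integral_gauss[OF assms, of 1] by simp
qed

text \<open>Translation by z preserves the measure but moves the hyperplane orthogonal to z off
  itself. For nonzero z two disjoint sets would both have full measure.\<close>

lemma eq_0_if_AE_inner_eq_0:
  assumes B: "finite B" "B \<subseteq> (Basis :: 'a::euclidean_space set)" and z: "z \<in> span B"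
    and ae: "AE x in span_lborel B. inner z x = 0"
  shows "z = 0"
proof (rule ccontr)
  assume "z \<noteq> 0"
  have "AE x in distr (span_lborel B) borel (\<lambda>x. x + z). inner z x = 0"
    unfolding distr_span_lborel_translate[OF B(1) z] by (rule ae)
  then have "AE x in span_lborel B. inner z (x + z) = 0"
    by (subst (asm) AE_distr_iff) auto
  with ae have "AE x in span_lborel B. False"
    by eventually_elim (use \<open>z \<noteq> 0\<close> in \<open>simp add: inner_add_right\<close>)
  with span_lborel_not_AE_False[OF B] show False by blast
qed

section \<open>Continuous functions with Gaussian decay\<close>

text \<open>The working class of densities: stable under invertible affine changes of variables,
  under factors of exponential growth and under half-line marginals. Continuity and decay are asked
  on \<open>span B\<close>, which carries the measure; continuity is what turns equality of
  integrals into pointwise identities.\<close>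

definition gauss_bounded :: "'a::euclidean_space set \<Rightarrow> ('a \<Rightarrow> real) \<Rightarrow> bool" where
  "gauss_bounded B f \<longleftrightarrow> f \<in> borel_measurable borel \<and> continuous_on (span B) f \<and>
     (\<exists>C e. e > 0 \<and> (\<forall>x\<in>span B. \<bar>f x\<bar> \<le> C * exp (- e * (norm x)\<^sup>2)))"

lemma gauss_boundedD:
  assumes "gauss_bounded B f"
  shows "f \<in> borel_measurable borel" "continuous_on (span B) f"
  using assms by (auto simp: gauss_bounded_def)

lemma gauss_boundedE:
  assumes "gauss_bounded B f"
  obtains C e where "C \<ge> 0" "e > 0" "\<And>x. x \<in> span B \<Longrightarrow> \<bar>f x\<bar> \<le> C * exp (- e * (norm x)\<^sup>2)"
proof -
  obtain C e where *: "e > 0" "\<And>x. x \<in> span B \<Longrightarrow> \<bar>f x\<bar> \<le> C * exp (- e * (norm x)\<^sup>2)"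
    using assms by (auto simp: gauss_bounded_def)
  have "0 \<le> \<bar>f 0\<bar>" by simp
  also have "\<dots> \<le> C" using *(2)[of 0] by (simp add: span_zero)
  finally show ?thesis using * that by blast
qed

text \<open>Complete the square (e * r - c)^2: half of the Gaussian rate pays for the linear
  exponent.\<close>

lemma gauss_absorbs_exponential:
  fixes e c r :: real
  assumes "e > 0"
  shows "exp (c * r) * exp (- e * r\<^sup>2) \<le> exp (c\<^sup>2 / (2 * e)) * exp (- (e / 2) * r\<^sup>2)"
proof -
  have "0 \<le> (e * r - c)\<^sup>2 / (2 * e)" using assms by simp
  also have "\<dots> = e / 2 * r\<^sup>2 - c * r + c\<^sup>2 / (2 * e)"
    using assms by (simp add: power2_diff power_mult_distrib field_simps power2_eq_square)
  finally have "c * r + - e * r\<^sup>2 \<le> c\<^sup>2 / (2 * e) + - (e / 2) * r\<^sup>2"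
    by (simp add: field_simps)
  then show ?thesis by (simp flip: exp_add)
qed

lemma gauss_bound_mult_exponential:
  assumes f: "gauss_bounded B f" and h: "\<And>x. x \<in> span B \<Longrightarrow> \<bar>h x\<bar> \<le> D * exp (c * norm x)"
  shows "\<exists>C e. e > 0 \<and> (\<forall>x\<in>span B. \<bar>h x * f x\<bar> \<le> C * exp (- e * (norm x)\<^sup>2))"
proof -
  obtain C e where C: "C \<ge> 0" "e > 0" "\<And>x. x \<in> span B \<Longrightarrow> \<bar>f x\<bar> \<le> C * exp (- e * (norm x)\<^sup>2)"
    using gauss_boundedE[OF f] by blast
  have "\<bar>h 0\<bar> \<le> D" using h[of 0] by (simp add: span_zero)
  then have D: "D \<ge> 0" by linarith
  have "\<bar>h x * f x\<bar> \<le> (D * C * exp (c\<^sup>2 / (2 * e))) * exp (- (e / 2) * (norm x)\<^sup>2)" if "x \<in> span B" for x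
  proof -
    have "\<bar>h x * f x\<bar> \<le> (D * exp (c * norm x)) * (C * exp (- e * (norm x)\<^sup>2))"
      unfolding abs_mult using h[OF that] C(3)[OF that] by (intro mult_mono) (auto simp: D)
    also have "\<dots> = D * C * (exp (c * norm x) * exp (- e * (norm x)\<^sup>2))" by (simp only: mult_ac)
    also have "\<dots> \<le> D * C * (exp (c\<^sup>2 / (2 * e)) * exp (- (e / 2) * (norm x)\<^sup>2))"
      using D C(1) by (intro mult_left_mono gauss_absorbs_exponential C(2)) auto
    finally show ?thesis by (simp only: mult_ac)
  qed
  then show ?thesis using C(2) by (intro exI[of _ "D * C * exp (c\<^sup>2 / (2 * e))"] exI[of _ "e / 2"]) auto
qed

lemma gauss_bounded_mult:
  assumes "gauss_bounded B f" "h \<in> borel_measurable borel" "continuous_on (span B) h"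
    "\<And>x. x \<in> span B \<Longrightarrow> \<bar>h x\<bar> \<le> D * exp (c * norm x)"
  shows "gauss_bounded B (\<lambda>x. h x * f x)"
proof -
  note [measurable] = gauss_boundedD(1)[OF assms(1)] assms(2)
  have "continuous_on (span B) (\<lambda>x. h x * f x)"
    by (intro continuous_on_mult assms gauss_boundedD(2)[OF assms(1)])
  then show ?thesis
    using gauss_bound_mult_exponential[OF assms(1,4)] unfolding gauss_bounded_def by simp
qed

lemma gauss_bounded_cmult: "gauss_bounded B f \<Longrightarrow> gauss_bounded B (\<lambda>x. c * f x)"
  by (rule gauss_bounded_mult[where D = "\<bar>c\<bar>" and c = 0]) auto

lemma gauss_bounded_exp_inner: "gauss_bounded B f \<Longrightarrow> gauss_bounded B (\<lambda>x. exp (inner z x) * f x)"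
proof (rule gauss_bounded_mult[where D = 1 and c = "norm z"])
  show "\<bar>exp (inner z x)\<bar> \<le> 1 * exp (norm z * norm x)" for x
    using norm_cauchy_schwarz[of z x] by simp
qed (auto intro!: continuous_intros)

lemma gauss_bounded_inner:
  assumes "gauss_bounded B f" shows "gauss_bounded B (\<lambda>x. inner x a * f x)"
proof (rule gauss_bounded_mult[where D = 1 and c = "norm a"])
  show "\<bar>inner x a\<bar> \<le> 1 * exp (norm a * norm x)" for x
  proof -
    have "norm a * norm x \<le> exp (norm a * norm x)"
      using exp_ge_add_one_self[of "norm a * norm x"] by linarith
    then show ?thesis using Cauchy_Schwarz_ineq2[of x a] by (simp add: mult.commute)
  qed
qed (use assms in \<open>auto intro!: continuous_intros\<close>)

lemma gauss_bounded_inner_power: "gauss_bounded B f \<Longrightarrow> gauss_bounded B (\<lambda>x. inner x a ^ k * f x)"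
proof (induction k)
  case (Suc k)
  then show ?case using gauss_bounded_inner[of B "\<lambda>x. inner x a ^ k * f x" a] by (simp add: mult.assoc)
qed simp

text \<open>Decay survives because the bounded left inverse \<open>L'\<close> makes |x| at most a
  multiple of |L x|. The translation costs the factor exp (e * |z|^2) and half of the rate, through
  (a + b)^2 \<le> 2 * a^2 + 2 * b^2.\<close>

lemma gauss_bounded_affine:
  fixes L L' :: "'a::euclidean_space \<Rightarrow> 'a"
  assumes f: "gauss_bounded B f" and L: "linear L" "linear L'"
    and LB: "\<And>x. x \<in> span B \<Longrightarrow> L x \<in> span B" and inv: "\<And>x. x \<in> span B \<Longrightarrow> L' (L x) = x"
    and z: "z \<in> span B"
  shows "gauss_bounded B (\<lambda>x. f (L x + z))"
proof -
  have contL: "continuous_on S L" for S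
    using L(1) by (simp add: linear_continuous_on linear_conv_bounded_linear)
  note [measurable] = gauss_boundedD(1)[OF f] borel_measurable_continuous_onI[OF contL]
  obtain C e where C: "C \<ge> 0" "e > 0" "\<And>x. x \<in> span B \<Longrightarrow> \<bar>f x\<bar> \<le> C * exp (- e * (norm x)\<^sup>2)"
    using gauss_boundedE[OF f] by blast
  obtain K where K: "K > 0" "\<And>x. norm (L' x) \<le> K * norm x"
    using linear_bounded_pos[OF L(2)] by blast
  have LzB: "L x + z \<in> span B" if "x \<in> span B" for x
    using LB[OF that] z by (rule span_add)
  have "\<bar>f (L x + z)\<bar> \<le> (C * exp (e * (norm z)\<^sup>2)) * exp (- (e / (2 * K\<^sup>2)) * (norm x)\<^sup>2)" if x: "x \<in> span B" for x
  proof -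
    have "norm x \<le> K * norm (L x)" using K(2)[of "L x"] inv[OF x] by simp
    then have "(norm x)\<^sup>2 \<le> (K * norm (L x))\<^sup>2" by (intro power_mono) auto
    then have 1: "(norm x)\<^sup>2 / K\<^sup>2 \<le> (norm (L x))\<^sup>2"
      using K(1) by (simp add: power_mult_distrib field_simps)
    have "norm (L x) \<le> norm (L x + z) + norm z"
      using norm_triangle_ineq4[of "L x + z" z] by simp
    then have "(norm (L x))\<^sup>2 \<le> (norm (L x + z) + norm z)\<^sup>2" by (intro power_mono) auto
    also have "\<dots> \<le> 2 * (norm (L x + z))\<^sup>2 + 2 * (norm z)\<^sup>2"
      using sum_squares_bound[of "norm (L x + z)" "norm z"] by (simp add: power2_sum)
    finally have "(norm x)\<^sup>2 / K\<^sup>2 \<le> 2 * (norm (L x + z))\<^sup>2 + 2 * (norm z)\<^sup>2" using 1 by linarith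
    then have "e * ((norm x)\<^sup>2 / K\<^sup>2) / 2 \<le> e * (2 * (norm (L x + z))\<^sup>2 + 2 * (norm z)\<^sup>2) / 2"
      using C(2) by (intro divide_right_mono mult_left_mono) auto
    then have "- e * (norm (L x + z))\<^sup>2 \<le> e * (norm z)\<^sup>2 + - (e / (2 * K\<^sup>2)) * (norm x)\<^sup>2"
      by (simp add: distrib_left mult.commute)
    then have "exp (- e * (norm (L x + z))\<^sup>2) \<le> exp (e * (norm z)\<^sup>2) * exp (- (e / (2 * K\<^sup>2)) * (norm x)\<^sup>2)"
      by (simp flip: exp_add)
    then have "C * exp (- e * (norm (L x + z))\<^sup>2) \<le> C * (exp (e * (norm z)\<^sup>2) * exp (- (e / (2 * K\<^sup>2)) * (norm x)\<^sup>2))"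
      using C(1) by (rule mult_left_mono)
    with C(3)[OF LzB[OF x]] show ?thesis by (simp only: mult.assoc)
  qed
  moreover have "e / (2 * K\<^sup>2) > 0" using C(2) K(1) by simp
  moreover have "continuous_on (span B) (\<lambda>x. f (L x + z))"
    by (rule continuous_on_compose2[OF gauss_boundedD(2)[OF f] continuous_on_add[OF contL continuous_on_const]])
      (use LzB in auto)
  ultimately show ?thesis unfolding gauss_bounded_def by (intro conjI exI[of _ "C * exp (e * (norm z)\<^sup>2)"] exI[of _ "e / (2 * K\<^sup>2)"]) auto
qed

lemma integrable_gauss_bounded_mult:
  fixes f h :: "'a::euclidean_space \<Rightarrow> real"
  assumes B: "finite B" "B \<subseteq> Basis" and f: "gauss_bounded B f" and [measurable]: "h \<in> borel_measurable borel"
    and h: "\<And>x. x \<in> span B \<Longrightarrow> \<bar>h x\<bar> \<le> D * exp (c * norm x)"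
  shows "integrable (span_lborel B) (\<lambda>x. h x * f x)"
proof -
  note [measurable] = gauss_boundedD(1)[OF f]
  obtain C e where C: "e > 0" "\<And>x. x \<in> span B \<Longrightarrow> \<bar>h x * f x\<bar> \<le> C * exp (- e * (norm x)\<^sup>2)"
    using gauss_bound_mult_exponential[OF f h] by blast
  have "integrable (span_lborel B) (\<lambda>x. exp (- e * (norm x)\<^sup>2))"
    by (rule integrableI_nonneg) (use nn_integral_gauss[OF B C(1)] in auto)
  then have "integrable (span_lborel B) (\<lambda>x. C * exp (- e * (norm x)\<^sup>2))" by simp
  then show ?thesis
  proof (rule Bochner_Integration.integrable_bound)
    show "AE x in span_lborel B. norm (h x * f x) \<le> norm (C * exp (- e * (norm x)\<^sup>2))"
      using AE_span_lborel[OF B(1)] by eventually_elim (use C(2) in \<open>fastforce intro: order_trans\<close>)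
  qed measurable
qed

lemma integrable_gauss_bounded:
  assumes "finite B" "B \<subseteq> Basis" "gauss_bounded B f"
  shows "integrable (span_lborel B) f"
  using integrable_gauss_bounded_mult[OF assms, of "\<lambda>_. 1" 1 0] by simp

lemma power_le_exp:
  fixes t :: real
  assumes "t \<ge> 0" shows "t ^ k \<le> exp (real k * t)"
proof -
  have "t \<le> exp t" using exp_ge_add_one_self[of t] by linarith
  then have "t ^ k \<le> exp t ^ k" using assms by (rule power_mono)
  then show ?thesis by (simp add: exp_of_nat_mult)
qed

lemma integrable_half_power_inner:
  assumes B: "finite B" "B \<subseteq> Basis" and f: "gauss_bounded B f" and b: "norm b = 1"
  shows "integrable (span_lborel B) (\<lambda>x. half_power k (inner x b) * f x)"
proof (rule integrable_gauss_bounded_mult[OF B f, where D = 1 and c = "real k"])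
  fix x
  have "\<bar>half_power k (inner x b)\<bar> \<le> \<bar>inner x b\<bar> ^ k" using half_power_le_abs[of k "inner x b"] by simp
  also have "\<dots> \<le> norm x ^ k"
    using Cauchy_Schwarz_ineq2[of x b] b by (intro power_mono) auto
  also have "\<dots> \<le> exp (real k * norm x)" by (rule power_le_exp) simp
  finally show "\<bar>half_power k (inner x b)\<bar> \<le> 1 * exp (real k * norm x)" by simp
qed measurable

context
  fixes B :: "'a::euclidean_space set" and b :: 'a
  assumes bB: "insert b B \<subseteq> Basis" "b \<notin> B"
begin

lemma finite_subbasis: "finite B"
  by (rule finite_subset[of _ Basis]) (use bB(1) in auto)

lemma subbasis_subset: "B \<subseteq> Basis" and subbasis_mem: "b \<in> Basis"
  using bB(1) by auto

lemma span_insert_add: "x \<in> span B \<Longrightarrow> x + s *\<^sub>R b \<in> span (insert b B)"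
  by (meson insertI1 span_add span_base span_mono span_scale subset_insertI subsetD)

lemma inner_add_Basis: "x \<in> span B \<Longrightarrow> inner (x + s *\<^sub>R b) b = s"
  using span_Basis_orthogonal[OF bB] subbasis_mem by (simp add: inner_add_left inner_Basis)

lemma slice_bound:
  assumes f: "gauss_bounded (insert b B) f"
  obtains C e where "C \<ge> 0" "e > 0" "\<And>x s. x \<in> span B \<Longrightarrow>
    \<bar>f (x + s *\<^sub>R b)\<bar> \<le> C * exp (- e * (norm x)\<^sup>2) * exp (- e * s\<^sup>2)"
proof -
  obtain C e where C: "C \<ge> 0" "e > 0" "\<And>x. x \<in> span (insert b B) \<Longrightarrow> \<bar>f x\<bar> \<le> C * exp (- e * (norm x)\<^sup>2)"
    using gauss_boundedE[OF f] by blast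
  have "\<bar>f (x + s *\<^sub>R b)\<bar> \<le> C * exp (- e * (norm x)\<^sup>2) * exp (- e * s\<^sup>2)" if "x \<in> span B" for x s
    using C(3)[OF span_insert_add[OF that]] norm_add_Basis[OF bB that]
    by (simp add: algebra_simps flip: exp_add)
  with C show ?thesis using that by blast
qed

lemma continuous_slice:
  assumes f: "gauss_bounded (insert b B) f" and x: "x \<in> span B"
  shows "continuous_on S (\<lambda>s. f (x + s *\<^sub>R b))"
  by (rule continuous_on_compose2[OF gauss_boundedD(2)[OF f]])
    (use span_insert_add[OF x] in \<open>auto intro!: continuous_intros\<close>)

lemma integrable_slice:
  assumes f: "gauss_bounded (insert b B) f" and x: "x \<in> span B"
  shows "integrable lborel (\<lambda>s. half_power k s * f (x + s *\<^sub>R b))"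
proof -
  note [measurable] = gauss_boundedD(1)[OF f]
  obtain C e where C: "C \<ge> 0" "e > 0" "\<And>x s. x \<in> span B \<Longrightarrow>
    \<bar>f (x + s *\<^sub>R b)\<bar> \<le> C * exp (- e * (norm x)\<^sup>2) * exp (- e * s\<^sup>2)"
    using slice_bound[OF f] by blast
  have "integrable lborel (\<lambda>s. C * exp (- e * (norm x)\<^sup>2) * (half_power k s * exp (- e * s\<^sup>2)))"
    by (intro integrable_mult_right integrable_half_power_gauss C)
  then show ?thesis
  proof (rule Bochner_Integration.integrable_bound)
    show "AE s in lborel. norm (half_power k s * f (x + s *\<^sub>R b)) \<le> norm (C * exp (- e * (norm x)\<^sup>2) * (half_power k s * exp (- e * s\<^sup>2)))"
    proof (rule AE_I2)
      fix s
      have "half_power k s * \<bar>f (x + s *\<^sub>R b)\<bar> \<le> half_power k s * (C * exp (- e * (norm x)\<^sup>2) * exp (- e * s\<^sup>2))"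
        by (intro mult_left_mono C(3)[OF x]) simp
      then show "norm (half_power k s * f (x + s *\<^sub>R b)) \<le> norm (C * exp (- e * (norm x)\<^sup>2) * (half_power k s * exp (- e * s\<^sup>2)))"
        using C(1) by (simp add: abs_mult mult_ac)
    qed
  qed measurable
qed

text \<open>Since |x + s * b|^2 = |x|^2 + s^2, the Gaussian bound factors. The factor in s dominates
  the integrand for continuity in x, and the factor in x is the decay of the marginal.\<close>

lemma gauss_bounded_half_marginal:
  assumes f: "gauss_bounded (insert b B) f"
  shows "gauss_bounded B (\<lambda>x. LINT s|lborel. half_power k s * f (x + s *\<^sub>R b))"
  unfolding gauss_bounded_def
proof (intro conjI)
  note [measurable] = gauss_boundedD(1)[OF f]
  show "(\<lambda>x. LINT s|lborel. half_power k s * f (x + s *\<^sub>R b)) \<in> borel_measurable borel"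
    by measurable
  obtain C e where C: "C \<ge> 0" "e > 0" "\<And>x s. x \<in> span B \<Longrightarrow>
    \<bar>f (x + s *\<^sub>R b)\<bar> \<le> C * exp (- e * (norm x)\<^sup>2) * exp (- e * s\<^sup>2)"
    using slice_bound[OF f] by blast
  define w where "w s = half_power k s * exp (- e * s\<^sup>2)" for s
  have w: "integrable lborel w" unfolding w_def by (rule integrable_half_power_gauss[OF C(2)])
  have bd: "\<bar>half_power k s * f (x + s *\<^sub>R b)\<bar> \<le> C * exp (- e * (norm x)\<^sup>2) * w s" if "x \<in> span B" for x s
  proof -
    have "half_power k s * \<bar>f (x + s *\<^sub>R b)\<bar> \<le> half_power k s * (C * exp (- e * (norm x)\<^sup>2) * exp (- e * s\<^sup>2))"
      by (intro mult_left_mono C(3)[OF that]) simp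
    then show ?thesis by (simp add: w_def abs_mult mult_ac)
  qed
  have w0: "w s \<ge> 0" for s by (simp add: w_def)
  show "continuous_on (span B) (\<lambda>x. LINT s|lborel. half_power k s * f (x + s *\<^sub>R b))"
    unfolding continuous_on_sequentially comp_def
  proof (intro allI ballI impI, elim conjE)
    fix X a assume a: "a \<in> span B" and X: "\<forall>n. X n \<in> span B" "X \<longlonglongrightarrow> a"
    show "(\<lambda>n. LINT s|lborel. half_power k s * f (X n + s *\<^sub>R b)) \<longlonglongrightarrow> (LINT s|lborel. half_power k s * f (a + s *\<^sub>R b))"
    proof (rule integral_dominated_convergence[where w = "\<lambda>s. C * w s"])
      show "AE s in lborel. (\<lambda>n. half_power k s * f (X n + s *\<^sub>R b)) \<longlonglongrightarrow> half_power k s * f (a + s *\<^sub>R b)"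
      proof (rule AE_I2, rule tendsto_mult_left)
        fix s
        have "(\<lambda>n. X n + s *\<^sub>R b) \<longlonglongrightarrow> a + s *\<^sub>R b" by (intro tendsto_intros X)
        then show "(\<lambda>n. f (X n + s *\<^sub>R b)) \<longlonglongrightarrow> f (a + s *\<^sub>R b)"
          by (rule continuous_on_tendsto_compose[OF gauss_boundedD(2)[OF f]])
            (use a X span_insert_add in auto)
      qed
      show "AE s in lborel. norm (half_power k s * f (X n + s *\<^sub>R b)) \<le> C * w s" for n
      proof (rule AE_I2)
        fix s
        have "exp (- e * (norm (X n))\<^sup>2) \<le> 1" using C(2) by simp
        then have "C * exp (- e * (norm (X n))\<^sup>2) * w s \<le> C * 1 * w s"
          using C(1) w0 by (intro mult_right_mono mult_left_mono) auto
        then show "norm (half_power k s * f (X n + s *\<^sub>R b)) \<le> C * w s"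
          using bd[of "X n" s] X(1) by simp
      qed
    qed (use w in auto)
  qed
  show "\<exists>C e. e > 0 \<and> (\<forall>x\<in>span B. \<bar>LINT s|lborel. half_power k s * f (x + s *\<^sub>R b)\<bar> \<le> C * exp (- e * (norm x)\<^sup>2))"
  proof (intro exI conjI ballI)
    fix x assume x: "x \<in> span B"
    have "\<bar>LINT s|lborel. half_power k s * f (x + s *\<^sub>R b)\<bar> \<le> (LINT s|lborel. \<bar>half_power k s * f (x + s *\<^sub>R b)\<bar>)"
      by (rule integral_abs_bound)
    also have "\<dots> \<le> (LINT s|lborel. C * exp (- e * (norm x)\<^sup>2) * w s)"
      by (rule integral_mono) (use integrable_slice[OF f x] w bd[OF x] in auto)
    finally show "\<bar>LINT s|lborel. half_power k s * f (x + s *\<^sub>R b)\<bar> \<le> (C * (LINT s|lborel. w s)) * exp (- e * (norm x)\<^sup>2)"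
      by (simp add: mult_ac)
  qed (rule C(2))
qed

lemma integral_half_power_inner:
  assumes f: "gauss_bounded (insert b B) f"
  shows "(LINT x|span_lborel (insert b B). half_power k (inner x b) * f x)
    = (LINT x|span_lborel B. LINT s|lborel. half_power k s * f (x + s *\<^sub>R b))"
proof -
  note [measurable] = gauss_boundedD(1)[OF f]
  have "(LINT x|span_lborel (insert b B). half_power k (inner x b) * f x)
    = (LINT x|span_lborel B. LINT s|lborel. half_power k (inner (x + s *\<^sub>R b) b) * f (x + s *\<^sub>R b))"
    by (rule integral_span_lborel_insert(1)[OF finite_subbasis subbasis_subset bB(2)])
      (use bB(1) f subbasis_mem finite_subbasis in \<open>auto intro!: integrable_half_power_inner\<close>)
  also have "\<dots> = (LINT x|span_lborel B. LINT s|lborel. half_power k s * f (x + s *\<^sub>R b))"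
    by (rule integral_cong_AE, measurable, use AE_span_lborel[OF finite_subbasis] in eventually_elim)
      (simp add: inner_add_Basis)
  finally show ?thesis .
qed

end

lemma half_power_integral_pos:
  fixes \<phi> :: "real \<Rightarrow> real"
  assumes int: "integrable lborel (\<lambda>s. half_power k s * \<phi> s)" and pos: "\<And>s. s > 0 \<Longrightarrow> \<phi> s > 0"
  shows "(LINT s|lborel. half_power k s * \<phi> s) > 0"
proof -
  have nn: "half_power k s * \<phi> s \<ge> 0" for s
    using pos[of s] by (cases "s > 0") (auto simp: half_power_def)
  have "(LINT s|lborel. half_power k s * \<phi> s) \<noteq> 0"
  proof
    assume "(LINT s|lborel. half_power k s * \<phi> s) = 0"
    then have "AE s in lborel. half_power k s * \<phi> s = 0"
      using integral_nonneg_eq_0_iff_AE[OF int] nn by auto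
    then have "AE s in lborel. s \<notin> {0<..1::real}"
      by eventually_elim (use pos in \<open>force simp: half_power_def\<close>)
    then have "emeasure lborel {0<..1::real} = 0"
      by (subst (asm) AE_iff_measurable[of "{0<..1}"]) auto
    then show False by simp
  qed
  moreover have "(LINT s|lborel. half_power k s * \<phi> s) \<ge> 0" using nn by simp
  ultimately show ?thesis by linarith
qed

lemma integral_pos_gauss_bounded:
  assumes B: "finite B" "B \<subseteq> Basis" and f: "gauss_bounded B f" and pos: "\<And>x. x \<in> span B \<Longrightarrow> f x > 0"
  shows "(LINT x|span_lborel B. f x) > 0"
proof -
  have ae: "AE x in span_lborel B. f x > 0"
    using AE_span_lborel[OF B(1)] by eventually_elim (rule pos)
  then have nn: "AE x in span_lborel B. 0 \<le> f x" by eventually_elim simp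
  have "(LINT x|span_lborel B. f x) \<noteq> 0"
  proof
    assume "(LINT x|span_lborel B. f x) = 0"
    then have "AE x in span_lborel B. f x = 0"
      using integral_nonneg_eq_0_iff_AE[OF integrable_gauss_bounded[OF B f] nn] by simp
    with ae have "AE x in span_lborel B. False" by eventually_elim simp
    then show False using span_lborel_not_AE_False[OF B] by simp
  qed
  then show ?thesis using integral_nonneg_AE[OF nn] by linarith
qed

section \<open>The functional Santalo inequality and its half-space form\<close>

text \<open>On \<open>span B\<close> each map is the inverse transpose of the other. Recording only
  the pairing avoids inverses and determinants and keeps the roles symmetric.\<close>

definition dual_linear_maps :: "'a::euclidean_space set \<Rightarrow> ('a \<Rightarrow> 'a) \<Rightarrow> ('a \<Rightarrow> 'a) \<Rightarrow> bool" where
  "dual_linear_maps B A A' \<longleftrightarrow> linear A \<and> linear A' \<and> A ` span B \<subseteq> span B \<and> A' ` span B \<subseteq> span B \<and>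
     (\<forall>x\<in>span B. \<forall>y\<in>span B. inner (A x) (A' y) = inner x y)"

text \<open>The extremal pairs: centred Gaussians with mutually inverse quadratic forms and
  reciprocal constants.\<close>

definition gauss_pair :: "'a::euclidean_space set \<Rightarrow> ('a \<Rightarrow> real) \<Rightarrow> ('a \<Rightarrow> real) \<Rightarrow> bool" where
  "gauss_pair B f g \<longleftrightarrow> (\<exists>A A' \<beta>. dual_linear_maps B A A' \<and> \<beta> > 0 \<and>
     (\<forall>x\<in>span B. f x = \<beta> * exp (- (norm (A x))\<^sup>2 / 2) \<and> g x = exp (- (norm (A' x))\<^sup>2 / 2) / \<beta>))"

text \<open>A predicate of \<open>B\<close>, so that it can be an induction hypothesis. It includes
  the equality case because the next dimension needs to know that the marginals are Gaussian. The
  barycentre condition falls on the first function, the asymmetry on which the bisection argument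
  relies.\<close>

definition santalo :: "'a::euclidean_space set \<Rightarrow> bool" where
  "santalo B \<longleftrightarrow> (\<forall>f g. gauss_bounded B f \<longrightarrow> gauss_bounded B g \<longrightarrow>
     (\<forall>x\<in>span B. f x > 0) \<longrightarrow> (\<forall>x\<in>span B. g x > 0) \<longrightarrow>
     (\<forall>x\<in>span B. \<forall>y\<in>span B. f x * g y \<le> exp (- inner x y)) \<longrightarrow>
     (\<forall>i\<in>B. (LINT x|span_lborel B. inner x i * f x) = 0) \<longrightarrow>
     (LINT x|span_lborel B. f x) * (LINT x|span_lborel B. g x) \<le> (2 * pi) ^ card B \<and>
     ((LINT x|span_lborel B. f x) * (LINT x|span_lborel B. g x) = (2 * pi) ^ card B \<longrightarrow> gauss_pair B f g))"

lemma dual_linear_maps_commute: "dual_linear_maps B A A' \<Longrightarrow> dual_linear_maps B A' A"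
  unfolding dual_linear_maps_def by (metis inner_commute)

text \<open>If \<open>A' y\<close> = 0 then |y|^2 = <A y, A' y> = 0, so \<open>A'\<close> is
  injective on \<open>span B\<close> and hence onto it by dimension. It provides the partner y at
  which a Gaussian pair saturates the duality bound for a given x.\<close>

lemma dual_linear_maps_surj:
  assumes D: "dual_linear_maps B A A'" and x: "x \<in> span B"
  obtains y where "y \<in> span B" "A' y = A x"
proof -
  have lin: "linear A'" and D': "A ` span B \<subseteq> span B" "A' ` span B \<subseteq> span B"
    and inn: "\<And>x y. x \<in> span B \<Longrightarrow> y \<in> span B \<Longrightarrow> inner (A x) (A' y) = inner x y"
    using D by (auto simp: dual_linear_maps_def)
  have "inj_on A' (span B)"
  proof (subst linear_injective_on_subspace_0[OF lin subspace_span], intro ballI impI)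
    fix y assume "y \<in> span B" "A' y = 0"
    with inn[of y y] show "y = 0" by simp
  qed
  then have "dim (A' ` B) = dim B" by (rule dim_image_eq[OF lin])
  then have "dim (A' ` span B) = dim (span B)"
    using dim_span[of "A' ` B"] linear_span_image[OF lin, of B] by simp
  then have "A' ` span B = span B"
    using D'(2) by (intro subspace_dim_equal linear_subspace_image[OF lin]) auto
  with D'(1) x have "A x \<in> A' ` span B" by auto
  with that show ?thesis by auto
qed

lemma half_moment_pos: "half_moment k > 0"
  unfolding half_moment_def
  using integrable_half_power_gauss[of "1/2" k] by (intro half_power_integral_pos) auto

context
  fixes B :: "'a::euclidean_space set" and b :: 'a and p q :: "'a \<Rightarrow> real" and k :: nat
  assumes bB: "insert b B \<subseteq> Basis" "b \<notin> B"
    and santalo: "santalo B"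
    and p: "gauss_bounded (insert b B) p" "\<forall>x\<in>span (insert b B). p x > 0"
    and q: "gauss_bounded (insert b B) q" "\<forall>x\<in>span (insert b B). q x > 0"
    and le: "\<forall>x\<in>span B. \<forall>y\<in>span B. \<forall>s>0. \<forall>t>0.
      p (x + s *\<^sub>R b) * q (y + t *\<^sub>R b) \<le> exp (- (inner x y + s * t))"
    and bary: "\<forall>i\<in>B.
      (LINT x|span_lborel (insert b B). half_power k (inner x b) * (inner x i * p x)) = 0"
begin

private definition "P x = (LINT s|lborel. half_power k s * p (x + s *\<^sub>R b))"
private definition "Q x = (LINT s|lborel. half_power k s * q (x + s *\<^sub>R b))"

private lemma half_marginal_bary:
  assumes "i \<in> B"
  shows "(LINT x|span_lborel B. inner x i * P x) = 0"
proof -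
  note [measurable] = gauss_boundedD(1)[OF p(1)]
  have "0 = (LINT x|span_lborel B. LINT s|lborel. half_power k s * (inner (x + s *\<^sub>R b) i * p (x + s *\<^sub>R b)))"
    using bary[rule_format, OF assms] integral_half_power_inner[OF bB gauss_bounded_inner[OF p(1)], of k i] by simp
  also have "\<dots> = (LINT x|span_lborel B. inner x i * P x)"
  proof -
    have "inner b i = 0" using assms bB by (auto simp: inner_Basis)
    then have eq: "half_power k s * (inner (x + s *\<^sub>R b) i * p (x + s *\<^sub>R b)) = inner x i * (half_power k s * p (x + s *\<^sub>R b))" for x s
      by (simp add: inner_add_left)
    show ?thesis unfolding P_def by (simp only: eq integral_mult_right_zero)
  qed
  finally show ?thesis by simp
qed

text \<open>Multiplying \<open>p\<close> by exp <x, y> turns the bound on the two rays over x and y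
  into the half-line bound. The marginals therefore inherit the duality relation up to the constant
  \<open>(half_moment k)\<^sup>2\<close>.\<close>

private lemma fiber:
  assumes x: "x \<in> span B" and y: "y \<in> span B"
  shows "P x * Q y \<le> (half_moment k)\<^sup>2 * exp (- inner x y)"
    and "P x * Q y = (half_moment k)\<^sup>2 * exp (- inner x y) \<Longrightarrow>
      \<exists>\<alpha>>0. \<exists>\<mu>>0. \<forall>s\<ge>0. p (x + s *\<^sub>R b) = \<alpha> * exp (- \<mu> * s\<^sup>2 / 2) \<and>
        q (y + s *\<^sub>R b) = exp (- inner x y) * exp (- s\<^sup>2 / \<mu> / 2) / \<alpha>"
proof -
  define \<phi> where "\<phi> s = exp (inner x y) * p (x + s *\<^sub>R b)" for s
  define \<psi> where "\<psi> s = q (y + s *\<^sub>R b)" for s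
  have \<phi>: "continuous_on {0..} \<phi>" "\<forall>s\<ge>0. \<phi> s > 0"
    unfolding \<phi>_def using p(2) span_insert_add[OF bB x]
    by (auto intro!: continuous_intros continuous_slice[OF bB p(1) x])
  have \<psi>: "continuous_on {0..} \<psi>" "\<forall>s\<ge>0. \<psi> s > 0"
    unfolding \<psi>_def using q(2) span_insert_add[OF bB y]
    by (auto intro!: continuous_intros continuous_slice[OF bB q(1) y])
  have hp: "half_power k s * \<phi> s = exp (inner x y) * (half_power k s * p (x + s *\<^sub>R b))" for s
    by (simp add: \<phi>_def)
  have i\<phi>: "integrable lborel (\<lambda>s. half_power k s * \<phi> s)"
    unfolding hp using integrable_slice[OF bB p(1) x] by simp
  have i\<psi>: "integrable lborel (\<lambda>s. half_power k s * \<psi> s)"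
    unfolding \<psi>_def using integrable_slice[OF bB q(1) y] by simp
  have le': "\<forall>s>0. \<forall>t>0. \<phi> s * \<psi> t \<le> exp (- (s * t))"
  proof (intro allI impI)
    fix s t :: real assume that: "s > 0" "t > 0"
    have "exp (inner x y) * (p (x + s *\<^sub>R b) * q (y + t *\<^sub>R b)) \<le> exp (inner x y) * exp (- (inner x y + s * t))"
      using le[rule_format, OF x y that] by simp
    then show "\<phi> s * \<psi> t \<le> exp (- (s * t))" by (simp add: \<phi>_def \<psi>_def mult.assoc flip: exp_add)
  qed
  have I: "(LINT s|lborel. half_power k s * \<phi> s) = exp (inner x y) * P x"
    unfolding hp P_def by simp
  have J: "(LINT s|lborel. half_power k s * \<psi> s) = Q y"
    unfolding \<psi>_def Q_def by simp
  note H = half_line_santalo[OF \<phi> i\<phi> \<psi> i\<psi> le', unfolded I J]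
  have e: "exp (inner x y) * exp (- inner x y) = 1" by (simp flip: exp_add)
  have "P x * Q y = exp (- inner x y) * (exp (inner x y) * P x * Q y)" by (simp flip: exp_add mult.assoc)
  also have "\<dots> \<le> exp (- inner x y) * (half_moment k)\<^sup>2" using H(1) by (intro mult_left_mono) auto
  finally show "P x * Q y \<le> (half_moment k)\<^sup>2 * exp (- inner x y)" by (simp add: mult.commute)
  assume "P x * Q y = (half_moment k)\<^sup>2 * exp (- inner x y)"
  then have "exp (inner x y) * P x * Q y = (half_moment k)\<^sup>2"
    using e by (simp add: mult.assoc mult.left_commute)
  from H(2)[OF this] obtain a \<mu> where a: "a > 0" "\<mu> > 0" "\<And>s. s \<ge> 0 \<Longrightarrow> \<phi> s = a * exp (- \<mu> * s\<^sup>2 / 2)"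
      "\<And>s. s \<ge> 0 \<Longrightarrow> \<psi> s = exp (- s\<^sup>2 / \<mu> / 2) / a"
    by blast
  show "\<exists>\<alpha>>0. \<exists>\<mu>>0. \<forall>s\<ge>0. p (x + s *\<^sub>R b) = \<alpha> * exp (- \<mu> * s\<^sup>2 / 2) \<and>
        q (y + s *\<^sub>R b) = exp (- inner x y) * exp (- s\<^sup>2 / \<mu> / 2) / \<alpha>"
  proof (rule exI[of _ "a * exp (- inner x y)"], rule conjI[OF _ exI[of _ \<mu>]], goal_cases)
    case 2
    show ?case
    proof (intro conjI allI impI)
    fix s :: real assume s: "s \<ge> 0"
    have "p (x + s *\<^sub>R b) = exp (- inner x y) * \<phi> s"
      using e by (simp add: \<phi>_def mult.commute flip: mult.assoc)
    then show "p (x + s *\<^sub>R b) = a * exp (- inner x y) * exp (- \<mu> * s\<^sup>2 / 2)"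
      using a(3)[OF s] by simp
    show "q (y + s *\<^sub>R b) = exp (- inner x y) * exp (- s\<^sup>2 / \<mu> / 2) / (a * exp (- inner x y))"
      using a(4)[OF s] by (simp add: \<psi>_def)
    qed (rule a(2))
  qed (use a(1) in simp)
qed

private lemma PQ:
  shows "gauss_bounded B P" "gauss_bounded B Q"
    and "\<And>x. x \<in> span B \<Longrightarrow> P x > 0" "\<And>x. x \<in> span B \<Longrightarrow> Q x > 0"
proof -
  show "gauss_bounded B P" "gauss_bounded B Q"
    unfolding P_def Q_def by (rule gauss_bounded_half_marginal[OF bB p(1)] gauss_bounded_half_marginal[OF bB q(1)])+
  show "P x > 0" "Q x > 0" if "x \<in> span B" for x
    unfolding P_def Q_def
    using integrable_slice[OF bB p(1) that] integrable_slice[OF bB q(1) that]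
      p(2) q(2) span_insert_add[OF bB that] by (auto intro!: half_power_integral_pos)
qed

private lemma half_space_santalo_aux:
  "(LINT x|span_lborel B. P x) * (LINT x|span_lborel B. Q x) \<le> (2 * pi) ^ card B * (half_moment k)\<^sup>2 \<and>
   ((LINT x|span_lborel B. P x) * (LINT x|span_lborel B. Q x) = (2 * pi) ^ card B * (half_moment k)\<^sup>2 \<longrightarrow>
    gauss_pair B (\<lambda>x. (1 / half_moment k) * P x) (\<lambda>x. (1 / half_moment k) * Q x))"
proof -
  let ?c = "half_moment k"
  have c: "?c > 0" by (rule half_moment_pos)
  have 1: "(1 / ?c * P x) * (1 / ?c * Q y) \<le> exp (- inner x y)" if "x \<in> span B" "y \<in> span B" for x y
    using fiber(1)[OF that] c by (simp add: power2_eq_square field_simps)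
  have 2: "(LINT x|span_lborel B. inner x i * (1 / ?c * P x)) = 0" if "i \<in> B" for i
  proof -
    have "(LINT x|span_lborel B. inner x i * (1 / ?c * P x)) = (LINT x|span_lborel B. 1 / ?c * (inner x i * P x))"
      by (simp only: mult_ac)
    then show ?thesis using half_marginal_bary[OF that] by simp
  qed
  have "(LINT x|span_lborel B. 1 / ?c * P x) * (LINT x|span_lborel B. 1 / ?c * Q x) \<le> (2 * pi) ^ card B \<and>
   ((LINT x|span_lborel B. 1 / ?c * P x) * (LINT x|span_lborel B. 1 / ?c * Q x) = (2 * pi) ^ card B \<longrightarrow>
    gauss_pair B (\<lambda>x. 1 / ?c * P x) (\<lambda>x. 1 / ?c * Q x))"
    using santalo[unfolded santalo_def, rule_format, of "\<lambda>x. 1 / ?c * P x" "\<lambda>x. 1 / ?c * Q x"] 1 2 PQ c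
      gauss_bounded_cmult[OF PQ(1), of "1 / ?c"] gauss_bounded_cmult[OF PQ(2), of "1 / ?c"]
    by simp
  moreover have eq: "(LINT x|span_lborel B. 1 / ?c * P x) * (LINT x|span_lborel B. 1 / ?c * Q x)
     = (LINT x|span_lborel B. P x) * (LINT x|span_lborel B. Q x) / ?c\<^sup>2"
    by (simp add: power2_eq_square)
  moreover have "X / ?c\<^sup>2 \<le> N \<longleftrightarrow> X \<le> N * ?c\<^sup>2" "X / ?c\<^sup>2 = N \<longleftrightarrow> X = N * ?c\<^sup>2" for X N
    using c by (simp_all add: divide_le_eq divide_eq_eq)
  ultimately show ?thesis by (auto simp only:)
qed

text \<open>Equality on the hyperplane makes \<open>P\<close> and \<open>Q\<close> a Gaussian pair.
  Whenever A' y = A x, one has <x, y> = |A x|^2 = |A' y|^2, so the fibre inequality over (x, y) is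
  an equality too and both fibres are Gaussian. It remains to see that their rates do not depend on
  x.\<close>

private lemma half_space_gauss:
  assumes "(LINT x|span_lborel B. P x) * (LINT x|span_lborel B. Q x) = (2 * pi) ^ card B * (half_moment k)\<^sup>2"
  shows "\<exists>A A' \<beta> \<mu>. dual_linear_maps B A A' \<and> \<beta> > 0 \<and> \<mu> > 0 \<and>
    (\<forall>x\<in>span B. \<forall>s\<ge>0. p (x + s *\<^sub>R b) = \<beta> * exp (- ((norm (A x))\<^sup>2 + \<mu> * s\<^sup>2) / 2) \<and>
       q (x + s *\<^sub>R b) = exp (- ((norm (A' x))\<^sup>2 + s\<^sup>2 / \<mu>) / 2) / \<beta>)"
proof -
  let ?c = "half_moment k"
  have c: "?c > 0" by (rule half_moment_pos)
  obtain A A' \<gamma> where D: "dual_linear_maps B A A'" and \<gamma>: "\<gamma> > 0"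
    and P: "\<And>x. x \<in> span B \<Longrightarrow> 1 / ?c * P x = \<gamma> * exp (- (norm (A x))\<^sup>2 / 2)"
    and Q: "\<And>x. x \<in> span B \<Longrightarrow> 1 / ?c * Q x = exp (- (norm (A' x))\<^sup>2 / 2) / \<gamma>"
    using half_space_santalo_aux assms unfolding gauss_pair_def by blast
  have lin: "linear A" "linear A'" and inn: "\<And>x y. x \<in> span B \<Longrightarrow> y \<in> span B \<Longrightarrow> inner (A x) (A' y) = inner x y"
    using D by (auto simp: dual_linear_maps_def)
  have xy: "inner x y = (norm (A x))\<^sup>2" if "x \<in> span B" "y \<in> span B" "A' y = A x" for x y
    using inn[OF that(1,2)] that(3) by (simp add: power2_norm_eq_inner)
  have fib: "\<exists>\<alpha>>0. \<exists>\<mu>>0. \<forall>s\<ge>0. p (x + s *\<^sub>R b) = \<alpha> * exp (- \<mu> * s\<^sup>2 / 2) \<and>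
        q (y + s *\<^sub>R b) = exp (- inner x y) * exp (- s\<^sup>2 / \<mu> / 2) / \<alpha>"
    if "x \<in> span B" "y \<in> span B" "A' y = A x" for x y
  proof (rule fiber(2)[OF that(1,2)])
    have "(1 / ?c * P x) * (1 / ?c * Q y) = exp (- (norm (A x))\<^sup>2 / 2) * exp (- (norm (A x))\<^sup>2 / 2)"
      unfolding P[OF that(1)] Q[OF that(2)] that(3) using \<gamma> by simp
    also have "\<dots> = exp (- inner x y)"
      unfolding xy[OF that] by (simp flip: exp_add)
    finally show "P x * Q y = ?c\<^sup>2 * exp (- inner x y)"
      using c by (simp add: power2_eq_square field_simps)
  qed
  \<comment> \<open>A fibre of \<open>p\<close> with rate \<mu> and a fibre of \<open>q\<close> with
    rate 1 / \<mu>' need not be partners, yet the bound at (s, \<mu>' * s) still holds and keeps exp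
    ((\<mu>' - \<mu>) * s^2 / 2) bounded in s. Comparison with the fibres over 0, in both roles,
    then fixes every rate.\<close>
  have rate_le: "\<mu>' \<le> \<mu>"
    if x: "x \<in> span B" and y: "y' \<in> span B" and pos: "\<alpha> > 0" "\<alpha>' > 0" "\<mu> > 0" "\<mu>' > 0"
      and px: "\<And>s. s \<ge> 0 \<Longrightarrow> p (x + s *\<^sub>R b) = \<alpha> * exp (- \<mu> * s\<^sup>2 / 2)"
      and qy: "\<And>s. s \<ge> 0 \<Longrightarrow> q (y' + s *\<^sub>R b) = \<alpha>' * exp (- s\<^sup>2 / \<mu>' / 2)"
    for x y' \<alpha> \<alpha>' \<mu> \<mu>'
  proof (rule ccontr)
    assume "\<not> \<mu>' \<le> \<mu>"
    then have d: "\<mu>' - \<mu> > 0" by simp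
    define K where "K = exp (- inner x y') / (\<alpha> * \<alpha>')"
    have bound: "exp ((\<mu>' - \<mu>) * s\<^sup>2 / 2) \<le> K" if "s > 0" for s
    proof -
      have "\<alpha> * exp (- \<mu> * s\<^sup>2 / 2) * (\<alpha>' * exp (- (\<mu>' * s)\<^sup>2 / \<mu>' / 2)) \<le> exp (- (inner x y' + s * (\<mu>' * s)))"
        using le[rule_format, OF x y that, of "\<mu>' * s"] px[of s] qy[of "\<mu>' * s"] pos that by simp
      also have "exp (- (inner x y' + s * (\<mu>' * s))) = exp (- inner x y') * exp (- \<mu>' * s\<^sup>2)"
        by (simp add: power2_eq_square flip: exp_add)
      finally have "(\<alpha> * \<alpha>') * (exp (- \<mu> * s\<^sup>2 / 2) * exp (- (\<mu>' * s)\<^sup>2 / \<mu>' / 2)) \<le> exp (- inner x y') * exp (- \<mu>' * s\<^sup>2)"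
        by (simp only: mult_ac)
      then have "exp (- \<mu> * s\<^sup>2 / 2) * exp (- (\<mu>' * s)\<^sup>2 / \<mu>' / 2) \<le> K * exp (- \<mu>' * s\<^sup>2)"
        using pos by (simp add: K_def field_simps)
      moreover have "exp (- \<mu> * s\<^sup>2 / 2) * exp (- (\<mu>' * s)\<^sup>2 / \<mu>' / 2) = exp ((\<mu>' - \<mu>) * s\<^sup>2 / 2) * exp (- \<mu>' * s\<^sup>2)"
        using pos by (simp add: power2_eq_square field_simps flip: exp_add)
      ultimately show ?thesis by simp
    qed
    \<comment> \<open>Chosen so that the exponent equals |K| + 1, whose exponential exceeds
      \<open>K\<close>.\<close>
    define s where "s = sqrt (2 * (\<bar>K\<bar> + 1) / (\<mu>' - \<mu>))"
    have "s > 0" "s\<^sup>2 = 2 * (\<bar>K\<bar> + 1) / (\<mu>' - \<mu>)"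
      unfolding s_def using d by auto
    then have "(\<mu>' - \<mu>) * s\<^sup>2 / 2 = \<bar>K\<bar> + 1" using d by simp
    with bound[OF \<open>s > 0\<close>] exp_ge_add_one_self[of "\<bar>K\<bar> + 1"] show False by simp
  qed
  obtain \<alpha>0 \<mu> where 0: "\<alpha>0 > 0" "\<mu> > 0" "\<And>s. s \<ge> 0 \<Longrightarrow> p (0 + s *\<^sub>R b) = \<alpha>0 * exp (- \<mu> * s\<^sup>2 / 2)"
      "\<And>s. s \<ge> 0 \<Longrightarrow> q (0 + s *\<^sub>R b) = exp (- inner 0 0) * exp (- s\<^sup>2 / \<mu> / 2) / \<alpha>0"
    using fib[of 0 0] lin by (auto simp: linear_0 span_zero)
  have q0: "q (0 + s *\<^sub>R b) = 1 / \<alpha>0 * exp (- s\<^sup>2 / \<mu> / 2)" if "s \<ge> 0" for s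
    using 0(4)[OF that] by simp
  define m where "m = (LINT s|lborel. half_power k s * exp (- \<mu> * s\<^sup>2 / 2))"
  have m: "m > 0"
    unfolding m_def using integrable_half_power_gauss[of "\<mu> / 2" k] 0(2)
    by (intro half_power_integral_pos) auto
  \<comment> \<open>Integrating a fibre gives \<open>P x\<close> = \<alpha> * m, and
    \<open>P x\<close> is also ?c * \<gamma> * exp (- |A x|^2 / 2); this \<open>\<beta>\<close> is
    the part of \<alpha> that is independent of x.\<close>
  define \<beta> where "\<beta> = ?c * \<gamma> / m"
  have fin: "p (x + s *\<^sub>R b) = \<beta> * exp (- ((norm (A x))\<^sup>2 + \<mu> * s\<^sup>2) / 2) \<and>
      q (y + s *\<^sub>R b) = exp (- ((norm (A' y))\<^sup>2 + s\<^sup>2 / \<mu>) / 2) / \<beta>"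
    if x: "x \<in> span B" and y: "y \<in> span B" and AA: "A' y = A x" and s: "s \<ge> 0" for x y s
  proof -
    obtain \<alpha> \<nu> where a: "\<alpha> > 0" "\<nu> > 0" "\<And>s. s \<ge> 0 \<Longrightarrow> p (x + s *\<^sub>R b) = \<alpha> * exp (- \<nu> * s\<^sup>2 / 2)"
      "\<And>s. s \<ge> 0 \<Longrightarrow> q (y + s *\<^sub>R b) = exp (- inner x y) * exp (- s\<^sup>2 / \<nu> / 2) / \<alpha>"
      using fib[OF x y AA] by auto
    have qy: "q (y + s *\<^sub>R b) = (exp (- inner x y) / \<alpha>) * exp (- s\<^sup>2 / \<nu> / 2)" if "s \<ge> 0" for s
      using a(4)[OF that] by simp
    have "\<nu> = \<mu>"
      using rate_le[OF x span_zero, of \<alpha> "1 / \<alpha>0" \<nu> \<mu>] rate_le[OF span_zero y, of \<alpha>0 "exp (- inner x y) / \<alpha>" \<mu> \<nu>]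
        a 0(1,2,3) q0 qy by force
    have "P x = (LINT s|lborel. \<alpha> * (half_power k s * exp (- \<mu> * s\<^sup>2 / 2)))"
      unfolding P_def
      by (rule Bochner_Integration.integral_cong[OF refl]) (use a(3) \<open>\<nu> = \<mu>\<close> in \<open>auto simp: half_power_def\<close>)
    then have "P x = \<alpha> * m" by (simp add: m_def)
    then have al: "\<alpha> = \<beta> * exp (- (norm (A x))\<^sup>2 / 2)"
      using P[OF x] m c by (simp add: \<beta>_def field_simps)
    have e1: "exp (- ((norm (A x))\<^sup>2 + r) / 2) = exp (- (norm (A x))\<^sup>2 / 2) * exp (- r / 2)" for r
      by (simp add: field_simps flip: exp_add)
    have e2: "exp (- inner x y) = exp (- (norm (A x))\<^sup>2 / 2) * exp (- (norm (A x))\<^sup>2 / 2)"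
      unfolding xy[OF x y AA] by (simp flip: exp_add)
    show ?thesis
      unfolding AA e1 using a(3,4)[OF s] unfolding e2 al \<open>\<nu> = \<mu>\<close> by simp
  qed
  have "\<beta> > 0" using c \<gamma> m by (simp add: \<beta>_def)
  moreover have "p (x + s *\<^sub>R b) = \<beta> * exp (- ((norm (A x))\<^sup>2 + \<mu> * s\<^sup>2) / 2) \<and>
       q (x + s *\<^sub>R b) = exp (- ((norm (A' x))\<^sup>2 + s\<^sup>2 / \<mu>) / 2) / \<beta>" if x: "x \<in> span B" "s \<ge> 0" for x s
  proof -
    \<comment> \<open>Each x needs a partner in both roles: as first component to identify
      \<open>p\<close> and as second component to identify \<open>q\<close>.\<close>
    obtain y where "y \<in> span B" "A' y = A x" using dual_linear_maps_surj[OF D x(1)] .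
    moreover obtain z where "z \<in> span B" "A z = A' x"
      using dual_linear_maps_surj[OF dual_linear_maps_commute[OF D] x(1)] .
    ultimately show ?thesis using fin[OF x(1) _ _ x(2), of y] fin[OF _ x(1) _ x(2), of z] by simp
  qed
  ultimately show ?thesis using D 0(2) by blast
qed

text \<open>The half-line inequality is applied on every fibre and the inequality in
  \<open>span B\<close> to the resulting marginals. Centring is demanded along \<open>B\<close>
  because that is the barycentre of the weighted marginal.\<close>

lemma half_space_santalo:
  shows "(LINT x|span_lborel (insert b B). half_power k (inner x b) * p x) *
      (LINT x|span_lborel (insert b B). half_power k (inner x b) * q x) \<le> (2 * pi) ^ card B * (half_moment k)\<^sup>2"
    and "(LINT x|span_lborel (insert b B). half_power k (inner x b) * p x) *
      (LINT x|span_lborel (insert b B). half_power k (inner x b) * q x) = (2 * pi) ^ card B * (half_moment k)\<^sup>2 \<Longrightarrow>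
      \<exists>A A' \<beta> \<mu>. dual_linear_maps B A A' \<and> \<beta> > 0 \<and> \<mu> > 0 \<and>
        (\<forall>x\<in>span B. \<forall>s\<ge>0. p (x + s *\<^sub>R b) = \<beta> * exp (- ((norm (A x))\<^sup>2 + \<mu> * s\<^sup>2) / 2) \<and>
           q (x + s *\<^sub>R b) = exp (- ((norm (A' x))\<^sup>2 + s\<^sup>2 / \<mu>) / 2) / \<beta>)"
  using half_space_santalo_aux half_space_gauss
  unfolding integral_half_power_inner[OF bB p(1)] integral_half_power_inner[OF bB q(1)] P_def[symmetric] Q_def[symmetric]
  by blast+

end

section \<open>Measure-preserving maps and bisection by a hyperplane\<close>

lemma integral_measure_preserving:
  fixes f :: "'a::euclidean_space \<Rightarrow> real"
  assumes "distr M borel T = M" "T \<in> borel_measurable borel" "sets M = sets borel" "f \<in> borel_measurable borel"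
  shows "(LINT x|M. f (T x)) = (LINT x|M. f x)"
proof -
  have "T \<in> measurable M borel" using assms(2,3) by (simp cong: measurable_cong_sets)
  then have "(LINT x|M. f (T x)) = (LINT x|distr M borel T. f x)"
    using assms(4) by (subst integral_distr) auto
  then show ?thesis using assms(1) by simp
qed

lemma distr_eq_if_nn_integral_eq:
  fixes M :: "'a::euclidean_space measure"
  assumes M [simp, measurable_cong]: "sets M = sets borel" and [measurable]: "T \<in> borel_measurable borel"
    and eq: "\<And>f. f \<in> borel_measurable borel \<Longrightarrow> (\<integral>\<^sup>+x. f (T x) \<partial>M) = (\<integral>\<^sup>+x. f x \<partial>M)"
  shows "distr M borel T = M"
proof (rule measure_eqI)
  fix A assume "A \<in> sets (distr M borel T)"
  then have [measurable]: "A \<in> sets borel" by simp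
  have "emeasure (distr M borel T) A = (\<integral>\<^sup>+x. indicator A (T x) \<partial>M)"
    by (subst nn_integral_indicator[symmetric], simp, subst nn_integral_distr) auto
  also have "\<dots> = (\<integral>\<^sup>+x. indicator A x \<partial>M)" by (rule eq) measurable
  finally show "emeasure (distr M borel T) A = emeasure M A" by simp
qed simp

definition reflect :: "'a::euclidean_space \<Rightarrow> 'a \<Rightarrow> 'a" where
  "reflect b x = x - (2 * inner x b) *\<^sub>R b"

lemma linear_reflect: "linear (reflect b)"
  unfolding reflect_def[abs_def] by (rule linearI) (simp_all add: inner_add_left algebra_simps)

lemma borel_measurable_reflect [measurable]: "reflect b \<in> borel_measurable borel"
  unfolding reflect_def[abs_def] by measurable

context
  fixes B :: "'a::euclidean_space set" and b :: 'a
  assumes bB: "insert b B \<subseteq> Basis" "b \<notin> B"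
begin

lemma nn_integral_span_lborel_insert_rev:
  assumes [measurable]: "f \<in> borel_measurable borel"
  shows "(\<integral>\<^sup>+x. f x \<partial>span_lborel (insert b B)) = (\<integral>\<^sup>+s. \<integral>\<^sup>+x. f (x + s *\<^sub>R b) \<partial>span_lborel B \<partial>lborel)"
proof -
  interpret pair_sigma_finite "span_lborel B" "lborel :: real measure"
    by (intro pair_sigma_finite.intro sigma_finite_span_lborel[OF finite_subbasis[OF bB] subbasis_subset[OF bB]] sigma_finite_lborel)
  show ?thesis
    unfolding nn_integral_span_lborel_insert[OF finite_subbasis[OF bB] bB(2) assms]
    by (rule Fubini'[symmetric]) measurable
qed

text \<open>At height s the shear translates the slice by s * w, so slicing by height and
  translation invariance of each slice suffice.\<close>

lemma distr_span_lborel_shear: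
  assumes w: "w \<in> span B"
  shows "distr (span_lborel (insert b B)) borel (\<lambda>x. x + inner x b *\<^sub>R w) = span_lborel (insert b B)"
proof (rule distr_eq_if_nn_integral_eq)
  fix f :: "'a \<Rightarrow> ennreal" assume [measurable]: "f \<in> borel_measurable borel"
  have "(\<integral>\<^sup>+x. f (x + inner x b *\<^sub>R w) \<partial>span_lborel (insert b B))
      = (\<integral>\<^sup>+s. \<integral>\<^sup>+x. f (x + s *\<^sub>R b + inner (x + s *\<^sub>R b) b *\<^sub>R w) \<partial>span_lborel B \<partial>lborel)"
    by (rule nn_integral_span_lborel_insert_rev) measurable
  also have "\<dots> = (\<integral>\<^sup>+s. \<integral>\<^sup>+x. f ((x + s *\<^sub>R w) + s *\<^sub>R b) \<partial>span_lborel B \<partial>lborel)"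
    by (rule nn_integral_cong, rule nn_integral_cong_AE, use AE_span_lborel[OF finite_subbasis[OF bB]] in eventually_elim)
      (simp add: inner_add_Basis[OF bB] add_ac)
  also have "\<dots> = (\<integral>\<^sup>+s. \<integral>\<^sup>+x. f (x + s *\<^sub>R b) \<partial>span_lborel B \<partial>lborel)"
    by (intro nn_integral_cong nn_integral_span_lborel_translate[OF finite_subbasis[OF bB] span_scale[OF w]]) measurable
  also have "\<dots> = (\<integral>\<^sup>+x. f x \<partial>span_lborel (insert b B))"
    by (rule nn_integral_span_lborel_insert_rev[symmetric]) measurable
  finally show "(\<integral>\<^sup>+x. f (x + inner x b *\<^sub>R w) \<partial>span_lborel (insert b B)) = (\<integral>\<^sup>+x. f x \<partial>span_lborel (insert b B))" .
qed auto

text \<open>Here each line parallel to b is translated along itself by an amount depending on its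
  base point; w orthogonal to b makes that amount constant on the line.\<close>

lemma distr_span_lborel_dual_shear:
  assumes w: "w \<in> span B"
  shows "distr (span_lborel (insert b B)) borel (\<lambda>x. x - inner w x *\<^sub>R b) = span_lborel (insert b B)"
proof (rule distr_eq_if_nn_integral_eq)
  note ins = nn_integral_span_lborel_insert[OF finite_subbasis[OF bB] bB(2)]
  fix f :: "'a \<Rightarrow> ennreal" assume [measurable]: "f \<in> borel_measurable borel"
  have "(\<integral>\<^sup>+x. f (x - inner w x *\<^sub>R b) \<partial>span_lborel (insert b B))
      = (\<integral>\<^sup>+x. \<integral>\<^sup>+s. f (x + s *\<^sub>R b - inner w (x + s *\<^sub>R b) *\<^sub>R b) \<partial>lborel \<partial>span_lborel B)"
    by (rule ins) measurable
  also have "\<dots> = (\<integral>\<^sup>+x. \<integral>\<^sup>+s. f (x + (s + - inner w x) *\<^sub>R b) \<partial>lborel \<partial>span_lborel B)"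
    using span_Basis_orthogonal[OF bB w] by (intro nn_integral_cong) (simp add: algebra_simps)
  also have "\<dots> = (\<integral>\<^sup>+x. \<integral>\<^sup>+s. f (x + s *\<^sub>R b) \<partial>lborel \<partial>span_lborel B)"
    by (intro nn_integral_cong nn_integral_lborel_translate[of "\<lambda>s. f (_ + s *\<^sub>R b)"]) measurable
  also have "\<dots> = (\<integral>\<^sup>+x. f x \<partial>span_lborel (insert b B))"
    by (rule ins[symmetric]) measurable
  finally show "(\<integral>\<^sup>+x. f (x - inner w x *\<^sub>R b) \<partial>span_lborel (insert b B)) = (\<integral>\<^sup>+x. f x \<partial>span_lborel (insert b B))" .
qed auto

lemma reflect_add:
  assumes "x \<in> span B"
  shows "reflect b (x + s *\<^sub>R b) = x + (- s) *\<^sub>R b"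
proof -
  have "x + s *\<^sub>R b - (2 * s) *\<^sub>R b = x + (s - 2 * s) *\<^sub>R b"
    by (simp only: scaleR_diff_left add_diff_eq)
  then show ?thesis by (simp only: reflect_def inner_add_Basis[OF bB assms]) simp
qed

lemma distr_span_lborel_reflect:
  "distr (span_lborel (insert b B)) borel (reflect b) = span_lborel (insert b B)"
proof (rule distr_eq_if_nn_integral_eq)
  note ins = nn_integral_span_lborel_insert[OF finite_subbasis[OF bB] bB(2)]
  fix f :: "'a \<Rightarrow> ennreal" assume [measurable]: "f \<in> borel_measurable borel"
  have "(\<integral>\<^sup>+x. f (reflect b x) \<partial>span_lborel (insert b B))
      = (\<integral>\<^sup>+x. \<integral>\<^sup>+s. f (reflect b (x + s *\<^sub>R b)) \<partial>lborel \<partial>span_lborel B)"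
    by (rule ins) measurable
  also have "\<dots> = (\<integral>\<^sup>+x. \<integral>\<^sup>+s. f (x + (- s) *\<^sub>R b) \<partial>lborel \<partial>span_lborel B)"
    by (rule nn_integral_cong_AE, use AE_span_lborel[OF finite_subbasis[OF bB]] in eventually_elim)
      (simp only: reflect_add)
  also have "\<dots> = (\<integral>\<^sup>+x. \<integral>\<^sup>+s. f (x + s *\<^sub>R b) \<partial>lborel \<partial>span_lborel B)"
    by (intro nn_integral_cong nn_integral_lborel_uminus[of "\<lambda>s. f (_ + s *\<^sub>R b)"]) measurable
  also have "\<dots> = (\<integral>\<^sup>+x. f x \<partial>span_lborel (insert b B))"
    by (rule ins[symmetric]) measurable
  finally show "(\<integral>\<^sup>+x. f (reflect b x) \<partial>span_lborel (insert b B)) = (\<integral>\<^sup>+x. f x \<partial>span_lborel (insert b B))" .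
qed auto

lemma integral_reflect:
  fixes F :: "'a \<Rightarrow> real"
  assumes "F \<in> borel_measurable borel"
  shows "(LINT x|span_lborel (insert b B). F (reflect b x)) = (LINT x|span_lborel (insert b B). F x)"
  by (rule integral_measure_preserving[OF distr_span_lborel_reflect]) (use assms in auto)

lemma AE_inner_Basis_neq: "AE x in span_lborel (insert b B). inner x b \<noteq> r"
proof -
  have "emeasure (span_lborel (insert b B)) {x. inner x b = r} = (\<integral>\<^sup>+x. indicator {x. inner x b = r} x \<partial>span_lborel (insert b B))"
    by simp
  also have "\<dots> = (\<integral>\<^sup>+x. \<integral>\<^sup>+s. indicator {x. inner x b = r} (x + s *\<^sub>R b) \<partial>lborel \<partial>span_lborel B)"
    by (rule nn_integral_span_lborel_insert[OF finite_subbasis[OF bB] bB(2)]) measurable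
  also have "\<dots> = (\<integral>\<^sup>+x. \<integral>\<^sup>+s. indicator {r} s \<partial>lborel \<partial>span_lborel B)"
    by (rule nn_integral_cong_AE, use AE_span_lborel[OF finite_subbasis[OF bB]] in eventually_elim)
      (auto simp: inner_add_Basis[OF bB] indicator_def intro!: nn_integral_cong)
  also have "\<dots> = 0" by simp
  finally show ?thesis by (intro AE_I[of _ _ "{x. inner x b = r}"]) auto
qed

lemma half_integral_pos:
  assumes f: "gauss_bounded (insert b B) f" "\<forall>x\<in>span (insert b B). f x > 0"
  shows "(LINT x|span_lborel (insert b B). half_power k (inner x b) * f x) > 0"
  unfolding integral_half_power_inner[OF bB f(1)]
  using integrable_slice[OF bB f(1)] f(2) span_insert_add[OF bB]
  by (intro integral_pos_gauss_bounded finite_subbasis[OF bB] subbasis_subset[OF bB] gauss_bounded_half_marginal[OF bB f(1)])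
    (auto intro!: half_power_integral_pos)

text \<open>The mass above height r is continuous in r, because level hyperplanes are null sets, and
  runs from the full mass to 0; the intermediate value theorem gives r. The mass below r is then the
  other half, again since the hyperplane itself is null.\<close>

lemma half_plane_bisection:
  assumes g: "gauss_bounded (insert b B) g" "\<forall>x\<in>span (insert b B). g x > 0"
  obtains r where "(LINT x|span_lborel (insert b B). half_power 0 (inner x b - r) * g x) = (LINT x|span_lborel (insert b B). g x) / 2"
    "(LINT x|span_lborel (insert b B). half_power 0 (r - inner x b) * g x) = (LINT x|span_lborel (insert b B). g x) / 2"
proof -
  let ?M = "span_lborel (insert b B)"
  have J: "finite (insert b B)" using finite_subbasis[OF bB] by simp
  note [measurable] = gauss_boundedD(1)[OF g(1)]
  have int: "integrable ?M g" by (rule integrable_gauss_bounded[OF J bB(1) g(1)])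
  have gpos: "(LINT x|?M. g x) > 0"
    by (rule integral_pos_gauss_bounded[OF J bB(1) g(1)]) (use g(2) in auto)
  define \<Phi> where "\<Phi> r = (LINT x|?M. half_power 0 (inner x b - r) * g x)" for r
  have hp_le: "half_power 0 t \<le> 1" for t by (simp add: half_power_def)
  have lim: "(\<lambda>n. \<Phi> (r n)) \<longlonglongrightarrow> (LINT x|?M. l x * g x)"
    if "AE x in ?M. (\<lambda>n. half_power 0 (inner x b - r n)) \<longlonglongrightarrow> l x" "l \<in> borel_measurable borel" for r l
    unfolding \<Phi>_def
  proof (rule integral_dominated_convergence[where w = "\<lambda>x. \<bar>g x\<bar>"])
    show "AE x in ?M. (\<lambda>n. half_power 0 (inner x b - r n) * g x) \<longlonglongrightarrow> l x * g x"
      using that(1) by eventually_elim (rule tendsto_mult_right)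
    show "AE x in ?M. norm (half_power 0 (inner x b - r n) * g x) \<le> \<bar>g x\<bar>" for n
      by (rule AE_I2) (auto simp: abs_mult intro!: mult_left_le_one_le hp_le)
  qed (use int that in auto)
  have cont: "continuous_on S \<Phi>" for S
    unfolding continuous_on_sequentially comp_def
  proof (intro allI ballI impI, elim conjE)
    fix r and a :: real assume r: "r \<longlonglongrightarrow> a"
    show "(\<lambda>n. \<Phi> (r n)) \<longlonglongrightarrow> \<Phi> a"
      unfolding \<Phi>_def[of a]
    proof (rule lim)
      show "AE x in ?M. (\<lambda>n. half_power 0 (inner x b - r n)) \<longlonglongrightarrow> half_power 0 (inner x b - a)"
        using AE_inner_Basis_neq[of a]
      proof eventually_elim
        case (elim x)
        have "isCont (half_power 0) (inner x b - a)"
        proof (cases "inner x b > a")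
          case True
          have "continuous_on {0<..} (half_power 0)"
            by (rule continuous_on_eq[of _ "\<lambda>_. 1"]) (auto simp: half_power_def)
          then show ?thesis using True by (simp add: continuous_on_eq_continuous_at)
        next
          case False
          have "continuous_on {..<0} (half_power 0)"
            by (rule continuous_on_eq[of _ "\<lambda>_. 0"]) (auto simp: half_power_def)
          then show ?thesis using False elim by (simp add: continuous_on_eq_continuous_at)
        qed
        then show ?case
          by (rule isCont_tendsto_compose) (intro tendsto_intros r)
      qed
    qed measurable
  qed
  have "(\<lambda>n. \<Phi> (real n)) \<longlonglongrightarrow> (LINT x|?M. 0 * g x)"
  proof (rule lim, rule AE_I2, rule tendsto_eventually)
    show "\<forall>\<^sub>F n in sequentially. half_power 0 (inner x b - real n) = 0" for x :: 'a
      using eventually_compose_filterlim[OF eventually_gt_at_top[of "inner x b"] filterlim_real_sequentially]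
      by eventually_elim (simp add: half_power_def)
  qed simp
  then have "(\<lambda>n. \<Phi> (real n)) \<longlonglongrightarrow> 0" by simp
  then have "\<forall>\<^sub>F n in sequentially. \<Phi> (real n) < (LINT x|?M. g x) / 2"
    by (rule order_tendstoD) (use gpos in simp)
  moreover have "(\<lambda>n. \<Phi> (- real n)) \<longlonglongrightarrow> (LINT x|?M. 1 * g x)"
  proof (rule lim, rule AE_I2, rule tendsto_eventually)
    show "\<forall>\<^sub>F n in sequentially. half_power 0 (inner x b - - real n) = 1" for x :: 'a
      using eventually_compose_filterlim[OF eventually_gt_at_top[of "- inner x b"] filterlim_real_sequentially]
      by eventually_elim (simp add: half_power_def)
  qed simp
  then have "\<forall>\<^sub>F n in sequentially. (LINT x|?M. g x) / 2 < \<Phi> (- real n)"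
    by (rule order_tendstoD) (use gpos in simp)
  ultimately have "\<forall>\<^sub>F n in sequentially. \<Phi> (real n) < (LINT x|?M. g x) / 2 \<and> (LINT x|?M. g x) / 2 < \<Phi> (- real n)"
    by eventually_elim simp
  then obtain n where n: "\<Phi> (real n) < (LINT x|?M. g x) / 2" "(LINT x|?M. g x) / 2 < \<Phi> (- real n)"
    by (auto simp: eventually_sequentially)
  have "\<exists>x\<ge>- real n. x \<le> real n \<and> \<Phi> x = (LINT x|?M. g x) / 2"
    by (rule IVT2') (use n cont in auto)
  then obtain r where r: "\<Phi> r = (LINT x|?M. g x) / 2" by blast
  have i2: "integrable ?M (\<lambda>x. half_power 0 (inner x b - r) * g x)"
    by (rule Bochner_Integration.integrable_bound[OF int])
      (auto simp: abs_mult intro!: mult_left_le_one_le hp_le)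
  have "(LINT x|?M. half_power 0 (r - inner x b) * g x) = (LINT x|?M. g x - half_power 0 (inner x b - r) * g x)"
    by (rule integral_cong_AE, measurable, use AE_inner_Basis_neq[of r] in eventually_elim)
      (auto simp: half_power_def)
  also have "\<dots> = (LINT x|?M. g x) / 2"
    using r int i2 by (simp add: \<Phi>_def)
  finally show ?thesis using that r unfolding \<Phi>_def by blast
qed

end

section \<open>Gaussian constants and dimension zero\<close>

lemma half_moment_even: "half_moment (2 * k) = sqrt (2 * pi) * (fact (2 * k) / (2 ^ k * fact k)) / 2"
proof -
  let ?h = "half_power (2 * k)"
  have int: "integrable lborel (\<lambda>s. ?h s * exp (- s\<^sup>2 / 2))"
    using integrable_half_power_gauss[of "1/2" "2 * k"] by simp
  have "(LINT s|lborel. ?h s * exp (- s\<^sup>2 / 2)) = (LINT s|lborel. ?h (- s) * exp (- s\<^sup>2 / 2))"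
    using lborel_integral_real_affine[of "-1" "\<lambda>s. ?h s * exp (- s\<^sup>2 / 2)" 0] by simp
  moreover have "integrable lborel (\<lambda>s. ?h (- s) * exp (- s\<^sup>2 / 2))"
    using lborel_integrable_real_affine[OF int, of "-1" 0] by simp
  ultimately have "2 * half_moment (2 * k) = (LINT s|lborel. ?h s * exp (- s\<^sup>2 / 2) + ?h (- s) * exp (- s\<^sup>2 / 2))"
    using int by (simp add: half_moment_def)
  also have "\<dots> = (LINT s|lborel. sqrt (2 * pi) * (std_normal_density s * s ^ (2 * k)))"
    by (rule integral_cong_AE, simp, simp, use AE_lborel_singleton[of 0] in eventually_elim)
      (auto simp: half_power_def std_normal_density_def)
  also have "\<dots> = sqrt (2 * pi) * (fact (2 * k) / (2 ^ k * fact k))"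
    using integral_std_normal_moment_even[of k] by simp
  finally show ?thesis by simp
qed

text \<open>Multiplied by 4, for the two halves of both functions, this is the factor 2 * pi by
  which the bound grows per dimension. Exponents 0 and 2 agree because the zeroth and second moments
  of the standard normal law are both 1.\<close>

lemma half_moment_sq: "(half_moment 0)\<^sup>2 = pi / 2" "(half_moment 2)\<^sup>2 = pi / 2"
proof -
  have "half_moment 0 = sqrt (2 * pi) / 2" "half_moment 2 = sqrt (2 * pi) / 2"
    using half_moment_even[of 0] half_moment_even[of 1] by simp_all
  then show "(half_moment 0)\<^sup>2 = pi / 2" "(half_moment 2)\<^sup>2 = pi / 2"
    by (simp_all only: power_divide) simp_all
qed

text \<open>Lets a Gaussian rate be recovered from the mass it produces on the half-line.\<close>

lemma half_power_gauss_strict_antimono: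
  assumes "0 < \<mu>" "\<mu> < \<nu>"
  shows "(LINT s|lborel. half_power k s * exp (- \<nu> * s\<^sup>2 / 2)) < (LINT s|lborel. half_power k s * exp (- \<mu> * s\<^sup>2 / 2))"
proof -
  have i: "integrable lborel (\<lambda>s. half_power k s * exp (- \<mu> * s\<^sup>2 / 2))" if "\<mu> > 0" for \<mu>
    using integrable_half_power_gauss[of "\<mu> / 2" k] that by simp
  have "0 < (LINT s|lborel. half_power k s * (exp (- \<mu> * s\<^sup>2 / 2) - exp (- \<nu> * s\<^sup>2 / 2)))"
    using i[of \<mu>] i[of \<nu>] assms by (intro half_power_integral_pos) (auto simp: right_diff_distrib)
  also have "\<dots> = (LINT s|lborel. half_power k s * exp (- \<mu> * s\<^sup>2 / 2)) - (LINT s|lborel. half_power k s * exp (- \<nu> * s\<^sup>2 / 2))"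
    using i[of \<mu>] i[of \<nu>] assms by (simp add: right_diff_distrib)
  finally show ?thesis by simp
qed

lemma integral_span_lborel_empty:
  fixes f :: "'a::euclidean_space \<Rightarrow> real"
  assumes "f \<in> borel_measurable borel" "f 0 \<ge> 0"
  shows "(LINT x|span_lborel {}. f x) = f 0"
proof -
  have "AE x in span_lborel {}. x \<in> span ({} :: 'a set)" by (rule AE_span_lborel) simp
  then have "AE x in span_lborel {}. 0 \<le> f x" by eventually_elim (use assms in auto)
  then show ?thesis
    using assms by (subst integral_eq_nn_integral) (auto simp: nn_integral_span_lborel_empty cong: measurable_cong_sets)
qed

text \<open>Integration is evaluation at 0, so the claim is f 0 * g 0 \<le> 1; in case of equality
  the identity maps with constant f 0 form the pair.\<close>

lemma santalo_empty: "santalo ({} :: 'a::euclidean_space set)"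
  unfolding santalo_def
proof (intro allI impI)
  fix f g :: "'a \<Rightarrow> real"
  assume *: "gauss_bounded {} f" "gauss_bounded {} g" "\<forall>x\<in>span {}. 0 < f x" "\<forall>x\<in>span {}. 0 < g x"
    "\<forall>x\<in>span {}. \<forall>y\<in>span {}. f x * g y \<le> exp (- inner x y)"
  have eq: "(LINT x|span_lborel {}. f x) = f 0" "(LINT x|span_lborel {}. g x) = g 0"
    using * by (auto intro!: integral_span_lborel_empty gauss_boundedD intro: less_imp_le)
  have "gauss_pair {} f g" if "f 0 * g 0 = 1"
    unfolding gauss_pair_def
    by (intro exI[of _ "\<lambda>x. x"] exI[of _ "f 0"])
      (use * that in \<open>auto simp: dual_linear_maps_def linear_ident field_simps\<close>)
  then show "(LINT x|span_lborel {}. f x) * (LINT x|span_lborel {}. g x) \<le> (2 * pi) ^ card ({} :: 'a set) \<and>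
     ((LINT x|span_lborel {}. f x) * (LINT x|span_lborel {}. g x) = (2 * pi) ^ card ({} :: 'a set) \<longrightarrow> gauss_pair {} f g)"
    unfolding eq using * by auto
qed

section \<open>Induction on the dimension\<close>

context
  fixes B :: "'a::euclidean_space set" and b :: 'a
  assumes bB: "insert b B \<subseteq> Basis" "b \<notin> B"
begin

lemma inner_b_b: "inner b b = 1"
  using subbasis_mem[OF bB] by (simp add: inner_Basis)

lemma reflect_simps: "inner (reflect b x) b = - inner x b" "reflect b (reflect b x) = x"
proof -
  show e: "inner (reflect b x) b = - inner x b"
    by (simp add: reflect_def inner_diff_left inner_b_b)
  then show "reflect b (reflect b x) = x"
    by (simp add: reflect_def[of b "reflect b x"]) (simp add: reflect_def)
qed

lemma inner_reflect:
  assumes "i \<in> B" shows "inner (reflect b x) i = inner x i"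
proof -
  have "inner b i = 0" using bB assms by (auto simp: inner_Basis)
  then show ?thesis by (simp add: reflect_def inner_diff_left)
qed

lemma inner_sum_scaled:
  assumes "j \<in> B"
  shows "inner (\<Sum>i\<in>B. c i *\<^sub>R i) j = c j"
proof -
  have "inner i j = (if i = j then 1 else 0)" if "i \<in> B" for i
    by (rule inner_Basis) (use bB(1) that assms in auto)
  then have "inner (\<Sum>i\<in>B. c i *\<^sub>R i) j = (\<Sum>i\<in>B. if i = j then c i else 0)"
    unfolding inner_sum_left by (intro sum.cong) auto
  then show ?thesis using assms finite_subbasis[OF bB] by simp
qed

lemma span_insert_cases:
  assumes "x \<in> span (insert b B)"
  obtains v where "v \<in> span B" "x = v + inner x b *\<^sub>R b"
proof -
  obtain v t where v: "v \<in> span B" "x = v + t *\<^sub>R b"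
    using span_insert_decompose[OF assms] .
  then have "inner x b = t" using inner_add_Basis[OF bB v(1)] by simp
  with v that show ?thesis by auto
qed

lemma span_mono_insert: "x \<in> span B \<Longrightarrow> x \<in> span (insert b B)"
  using span_mono[of B "insert b B"] by auto

lemma b_mem_span: "b \<in> span (insert b B)"
  by (rule span_base) simp

lemma reflect_mem_span: "x \<in> span (insert b B) \<Longrightarrow> reflect b x \<in> span (insert b B)"
  unfolding reflect_def by (intro span_diff span_scale b_mem_span)

lemma gauss_bounded_reflect:
  assumes g: "gauss_bounded (insert b B) g" and z: "z \<in> span (insert b B)"
  shows "gauss_bounded (insert b B) (\<lambda>x. g (reflect b x + z))"
  by (rule gauss_bounded_affine[OF g linear_reflect linear_reflect reflect_mem_span reflect_simps(2) z])

text \<open>Block-diagonal extension: the given maps act on the projection x - <x, b> b, and the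
  axis b is scaled by sqrt \<mu> and by its inverse, which preserves the pairing.\<close>

lemma dual_linear_maps_insert:
  assumes D: "dual_linear_maps B A A'" and \<mu>: "\<mu> > 0"
  defines "C \<equiv> \<lambda>x. A (x - inner x b *\<^sub>R b) + (sqrt \<mu> * inner x b) *\<^sub>R b"
    and "C' \<equiv> \<lambda>x. A' (x - inner x b *\<^sub>R b) + (inner x b / sqrt \<mu>) *\<^sub>R b"
  shows "dual_linear_maps (insert b B) C C'"
    and "\<And>x s. x \<in> span B \<Longrightarrow> (norm (C (x + s *\<^sub>R b)))\<^sup>2 = (norm (A x))\<^sup>2 + \<mu> * s\<^sup>2"
    and "\<And>x s. x \<in> span B \<Longrightarrow> (norm (C' (x + s *\<^sub>R b)))\<^sup>2 = (norm (A' x))\<^sup>2 + s\<^sup>2 / \<mu>"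
proof -
  have lin: "linear A" "linear A'" and AB: "\<And>x. x \<in> span B \<Longrightarrow> A x \<in> span B" "\<And>x. x \<in> span B \<Longrightarrow> A' x \<in> span B"
    and inn: "\<And>x y. x \<in> span B \<Longrightarrow> y \<in> span B \<Longrightarrow> inner (A x) (A' y) = inner x y"
    using D by (auto simp: dual_linear_maps_def)
  have CC: "C (x + s *\<^sub>R b) = A x + (sqrt \<mu> * s) *\<^sub>R b" "C' (x + s *\<^sub>R b) = A' x + (s / sqrt \<mu>) *\<^sub>R b"
    if "x \<in> span B" for x s
    using inner_add_Basis[OF bB that, of s] by (simp_all add: C_def C'_def)
  show "(norm (C (x + s *\<^sub>R b)))\<^sup>2 = (norm (A x))\<^sup>2 + \<mu> * s\<^sup>2" if "x \<in> span B" for x s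
    unfolding CC(1)[OF that] norm_add_Basis[OF bB AB(1)[OF that]] using \<mu> by (simp add: power_mult_distrib)
  show "(norm (C' (x + s *\<^sub>R b)))\<^sup>2 = (norm (A' x))\<^sup>2 + s\<^sup>2 / \<mu>" if "x \<in> span B" for x s
    unfolding CC(2)[OF that] norm_add_Basis[OF bB AB(2)[OF that]] using \<mu> by (simp add: power_divide)
  have "linear C"
    unfolding C_def by (rule linearI) (simp_all add: linear_add[OF lin(1)] linear_diff[OF lin(1)] linear_scale[OF lin(1)] inner_add_left algebra_simps)
  moreover have "linear C'"
    unfolding C'_def by (rule linearI) (simp_all add: linear_add[OF lin(2)] linear_diff[OF lin(2)] linear_scale[OF lin(2)] inner_add_left algebra_simps add_divide_distrib)
  moreover have "C x \<in> span (insert b B)" "C' x \<in> span (insert b B)" if xJ: "x \<in> span (insert b B)" for x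
  proof -
    obtain v where v: "v \<in> span B" "x = v + inner x b *\<^sub>R b" using span_insert_cases[OF xJ] .
    show "C x \<in> span (insert b B)" "C' x \<in> span (insert b B)"
      by (subst v(2), subst CC[OF v(1)], rule span_insert_add[OF bB], rule AB[OF v(1)])+
  qed
  moreover have "inner (C x) (C' y) = inner x y" if xJ: "x \<in> span (insert b B)" and yJ: "y \<in> span (insert b B)" for x y
  proof -
    obtain v where v: "v \<in> span B" "x = v + inner x b *\<^sub>R b" using span_insert_cases[OF xJ] .
    obtain u where u: "u \<in> span B" "y = u + inner y b *\<^sub>R b" using span_insert_cases[OF yJ] .
    define s where "s = inner x b"
    define t where "t = inner y b"
    have x: "x = v + s *\<^sub>R b" and y: "y = u + t *\<^sub>R b" using v u by (simp_all add: s_def t_def)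
    show ?thesis
      unfolding x y CC[OF v(1)] CC[OF u(1)]
      using \<mu> inn[OF v(1) u(1)] span_Basis_orthogonal[OF bB v(1)] span_Basis_orthogonal[OF bB u(1)]
        span_Basis_orthogonal[OF bB AB(1)[OF v(1)]] span_Basis_orthogonal[OF bB AB(2)[OF u(1)]] inner_b_b
      by (simp add: inner_add_left inner_add_right)
  qed
  ultimately show "dual_linear_maps (insert b B) C C'" by (auto simp: dual_linear_maps_def)
qed

lemma dual_shear_inner:
  assumes "w \<in> span B"
  shows "inner (x + inner x b *\<^sub>R w) (y - inner w y *\<^sub>R b) = inner x y"
    and "inner (x + inner w x *\<^sub>R b) (y - inner y b *\<^sub>R w) = inner x y"
  using span_Basis_orthogonal[OF bB assms]
  by (simp_all add: inner_add_left inner_add_right inner_diff_left inner_diff_right inner_commute)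

lemma dual_linear_maps_shear:
  assumes D: "dual_linear_maps (insert b B) C C'" and w: "w \<in> span B"
  shows "dual_linear_maps (insert b B) (\<lambda>x. C (x + inner w x *\<^sub>R b)) (\<lambda>x. C' (x - inner x b *\<^sub>R w))"
proof -
  have lin: "linear C" "linear C'" using D by (auto simp: dual_linear_maps_def)
  have 1: "x + inner w x *\<^sub>R b \<in> span (insert b B)" "x - inner x b *\<^sub>R w \<in> span (insert b B)"
    if "x \<in> span (insert b B)" for x
    using that b_mem_span span_mono_insert[OF w] by (auto intro!: span_add span_diff span_scale)
  have "linear (\<lambda>x. C (x + inner w x *\<^sub>R b))"
    by (rule linearI) (simp_all add: linear_add[OF lin(1)] linear_scale[OF lin(1)] inner_add_right algebra_simps)
  moreover have "linear (\<lambda>x. C' (x - inner x b *\<^sub>R w))"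
    by (rule linearI) (simp_all add: linear_add[OF lin(2)] linear_diff[OF lin(2)] linear_scale[OF lin(2)] inner_add_left algebra_simps)
  ultimately show ?thesis
    using D 1 dual_shear_inner(2)[OF w] unfolding dual_linear_maps_def by (auto simp: image_subset_iff)
qed

lemma integral_inner_eq_0:
  assumes f: "gauss_bounded (insert b B) f"
    and bary: "\<forall>i\<in>insert b B. (LINT x|span_lborel (insert b B). inner x i * f x) = 0"
    and z: "z \<in> span (insert b B)"
  shows "(LINT x|span_lborel (insert b B). inner x z * f x) = 0"
proof -
  have int: "integrable (span_lborel (insert b B)) (\<lambda>x. inner x a * f x)" for a
    using finite_subbasis[OF bB] by (intro integrable_gauss_bounded bB gauss_bounded_inner f) simp
  show ?thesis
    using z
  proof (induction z rule: span_induct_alt)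
    case (step c x y)
    then have "(LINT y|span_lborel (insert b B). inner y x * f y) = 0" using bary by blast
    then show ?case
      using int step by (simp add: inner_add_right distrib_right mult.assoc)
  qed simp
qed

end

lemma exp_eq_add_one_iff: "exp t = 1 + t \<longleftrightarrow> t = (0::real)"
proof
  assume e: "exp t = 1 + t"
  show "t = 0"
  proof (rule ccontr)
    assume "t \<noteq> 0"
    have "1 + t / 2 \<le> exp (t / 2)" by (rule exp_ge_add_one_self)
    have t: "t > -1" using e exp_gt_zero[of t] by linarith
    then have "(1 + t / 2)\<^sup>2 \<le> (exp (t / 2))\<^sup>2"
      using \<open>1 + t / 2 \<le> exp (t / 2)\<close> by (intro power_mono) auto
    also have "(exp (t / 2))\<^sup>2 = exp t" by (simp flip: exp_double)
    finally have "1 + t + t\<^sup>2 / 4 \<le> 1 + t"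
      unfolding e by (simp add: power2_sum power_divide)
    then show False using \<open>t \<noteq> 0\<close> by simp
  qed
qed simp

text \<open>Integrate exp t \<ge> 1 + t against f with t = <z, x>; the linear term disappears by
  centring. Equality forces <z, x> = 0 almost everywhere. This pays for moving the other function by
  z in the bisection step.\<close>

lemma exponential_tilt_integral:
  fixes f :: "'a::euclidean_space \<Rightarrow> real"
  assumes B: "finite B" "B \<subseteq> Basis" and f: "gauss_bounded B f" "\<forall>x\<in>span B. f x > 0"
    and z: "z \<in> span B" "(LINT x|span_lborel B. inner x z * f x) = 0"
  shows "(LINT x|span_lborel B. f x) \<le> (LINT x|span_lborel B. exp (inner z x) * f x)"
    and "(LINT x|span_lborel B. exp (inner z x) * f x) = (LINT x|span_lborel B. f x) \<Longrightarrow> z = 0"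
proof -
  define d where "d x = exp (inner z x) * f x - f x - inner x z * f x" for x
  have int: "integrable (span_lborel B) f" "integrable (span_lborel B) (\<lambda>x. exp (inner z x) * f x)"
    "integrable (span_lborel B) (\<lambda>x. inner x z * f x)"
    by (intro integrable_gauss_bounded B f gauss_bounded_exp_inner gauss_bounded_inner)+
  have id: "integrable (span_lborel B) d" unfolding d_def using int by auto
  have d: "(LINT x|span_lborel B. d x) = (LINT x|span_lborel B. exp (inner z x) * f x) - (LINT x|span_lborel B. f x)"
    unfolding d_def using int z(2) by simp
  have d_eq: "d x = (exp (inner z x) - (1 + inner z x)) * f x" for x
    by (simp add: d_def algebra_simps inner_commute)
  have nn: "AE x in span_lborel B. 0 \<le> d x"
    using AE_span_lborel[OF B(1)]
  proof eventually_elim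
    case (elim x)
    with f(2) have "f x \<ge> 0" by (simp add: less_imp_le)
    then show ?case using exp_ge_add_one_self[of "inner z x"] by (simp add: d_eq)
  qed
  show "(LINT x|span_lborel B. f x) \<le> (LINT x|span_lborel B. exp (inner z x) * f x)"
    using integral_nonneg_AE[OF nn] d by simp
  assume "(LINT x|span_lborel B. exp (inner z x) * f x) = (LINT x|span_lborel B. f x)"
  then have "AE x in span_lborel B. d x = 0"
    using d integral_nonneg_eq_0_iff_AE[OF id nn] by simp
  then have "AE x in span_lborel B. inner z x = 0"
    using AE_span_lborel[OF B(1)]
  proof eventually_elim
    case (elim x)
    then have "exp (inner z x) - (1 + inner z x) = 0" using f(2) by (force simp: d_eq)
    then show ?case using exp_eq_add_one_iff[of "inner z x"] by simp
  qed
  then show "z = 0" by (rule eq_0_if_AE_inner_eq_0[OF B z(1)])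
qed

text \<open>The barycentres of the two halves of a bisected density span a line that is transversal to the
  bisecting hyperplane; \<open>w\<close> is its slope and \<open>z\<close> the point where it meets the hyperplane.\<close>

lemma balancing_shear:
  fixes B :: "'a::euclidean_space set"
  assumes bB: "insert b B \<subseteq> Basis" "b \<notin> B"
    and g: "gauss_bounded (insert b B) g" "\<forall>x\<in>span (insert b B). g x > 0"
  obtains w z where "w \<in> span B" "z \<in> span (insert b B)"
    "(LINT x|span_lborel (insert b B). half_power 0 (inner x b) * g (x + inner x b *\<^sub>R w + z)) = (LINT x|span_lborel (insert b B). g x) / 2"
    "(LINT x|span_lborel (insert b B). half_power 0 (- inner x b) * g (x + inner x b *\<^sub>R w + z)) = (LINT x|span_lborel (insert b B). g x) / 2"
    "\<forall>i\<in>B. (LINT x|span_lborel (insert b B). half_power 0 (inner x b) * (inner x i * g (x + inner x b *\<^sub>R w + z))) = 0"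
    "\<forall>i\<in>B. (LINT x|span_lborel (insert b B). half_power 0 (- inner x b) * (inner x i * g (x + inner x b *\<^sub>R w + z))) = 0"
proof -
  let ?J = "insert b B" and ?M = "span_lborel (insert b B)"
  note fin = finite_subbasis[OF bB]
  have J: "finite ?J" using fin by simp
  note [measurable] = gauss_boundedD(1)[OF g(1)]
  obtain r where r: "(LINT x|?M. half_power 0 (inner x b - r) * g x) = (LINT x|?M. g x) / 2"
    "(LINT x|?M. half_power 0 (r - inner x b) * g x) = (LINT x|?M. g x) / 2"
    using half_plane_bisection[OF bB g] .
  define m where "m = (LINT x|?M. g x) / 2"
  have m: "m > 0"
    unfolding m_def using integral_pos_gauss_bounded[OF J bB(1) g(1)] g(2) by simp
  have hp_le: "half_power 0 t \<le> 1" for t by (simp add: half_power_def)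
  have int_g: "integrable ?M g" by (rule integrable_gauss_bounded[OF J bB(1) g(1)])
  have int_i: "integrable ?M (\<lambda>x. inner x i * g x)" for i
    by (rule integrable_gauss_bounded[OF J bB(1) gauss_bounded_inner[OF g(1)]])
  have iu: "integrable ?M (\<lambda>x. half_power 0 (\<sigma> x) * G x)" if "integrable ?M G" "\<sigma> \<in> borel_measurable borel" for G :: "'a \<Rightarrow> real" and \<sigma>
  proof -
    note [measurable] = that(2)
    have [measurable]: "G \<in> borel_measurable borel" using that(1) by auto
    show ?thesis
      by (rule Bochner_Integration.integrable_bound[OF that(1)])
        (auto simp: abs_mult intro!: mult_left_le_one_le hp_le)
  qed
  have tr: "(LINT x|?M. F (x + z)) = (LINT x|?M. F x)" if "z \<in> span ?J" "F \<in> borel_measurable borel" for F :: "'a \<Rightarrow> real" and z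
    by (rule integral_span_lborel_translate[OF J that])
  have rb: "r *\<^sub>R b \<in> span ?J" by (intro span_scale b_mem_span[OF bB])
  \<comment> \<open>First moments of the height above the bisecting hyperplane over the upper and
    lower halves. Their strict signs make np - nm positive, so the slope below is well
    defined.\<close>
  define np where "np = (LINT x|?M. half_power 0 (inner x b - r) * ((inner x b - r) * g x))"
  define nm where "nm = (LINT x|?M. half_power 0 (r - inner x b) * ((inner x b - r) * g x))"
  define mp where "mp i = (LINT x|?M. half_power 0 (inner x b - r) * (inner x i * g x))" for i
  define mm where "mm i = (LINT x|?M. half_power 0 (r - inner x b) * (inner x i * g x))" for i
  have np: "np > 0"
  proof -
    have "np = (LINT x|?M. half_power 1 (inner x b - r) * g x)"
      unfolding np_def by (rule Bochner_Integration.integral_cong) (auto simp: half_power_def)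
    also have "\<dots> = (LINT x|?M. half_power 1 (inner (x + r *\<^sub>R b) b - r) * g (x + r *\<^sub>R b))"
      by (rule tr[OF rb, symmetric]) measurable
    also have "\<dots> = (LINT x|?M. half_power 1 (inner x b) * g (x + r *\<^sub>R b))"
      by (simp add: inner_add_left inner_b_b[OF bB])
    also have "\<dots> > 0"
    proof (rule half_integral_pos[OF bB])
      show "gauss_bounded ?J (\<lambda>x. g (x + r *\<^sub>R b))"
        by (rule gauss_bounded_affine[OF g(1), where L = "\<lambda>x. x" and L' = "\<lambda>x. x"]) (use rb in \<open>auto simp: linear_ident\<close>)
      show "\<forall>x\<in>span ?J. g (x + r *\<^sub>R b) > 0" using g(2) rb by (auto intro!: span_add)
    qed
    finally show ?thesis .
  qed
  have nm: "nm < 0"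
  proof -
    have "nm = (LINT x|?M. - (half_power 1 (r - inner x b) * g x))"
      unfolding nm_def by (rule Bochner_Integration.integral_cong) (auto simp: half_power_def algebra_simps)
    then have "- nm = (LINT x|?M. half_power 1 (r - inner x b) * g x)" by simp
    also have "\<dots> = (LINT x|?M. half_power 1 (r - inner (x + r *\<^sub>R b) b) * g (x + r *\<^sub>R b))"
      by (rule tr[OF rb, symmetric]) measurable
    also have "\<dots> = (LINT x|?M. half_power 1 (r - inner (reflect b x + r *\<^sub>R b) b) * g (reflect b x + r *\<^sub>R b))"
      by (rule integral_reflect[OF bB, symmetric]) measurable
    also have "\<dots> = (LINT x|?M. half_power 1 (inner x b) * g (reflect b x + r *\<^sub>R b))"
      by (simp add: inner_add_left inner_b_b[OF bB] reflect_simps[OF bB])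
    also have "\<dots> > 0"
    proof (rule half_integral_pos[OF bB])
      show "gauss_bounded ?J (\<lambda>x. g (reflect b x + r *\<^sub>R b))"
        by (rule gauss_bounded_reflect[OF bB g(1) rb])
      show "\<forall>x\<in>span ?J. g (reflect b x + r *\<^sub>R b) > 0" using g(2) rb reflect_mem_span[OF bB] by (auto intro!: span_add)
    qed
    finally show ?thesis by simp
  qed
  \<comment> \<open>In each coordinate i of \<open>B\<close> the two balance equations are mp = z_i
    * m + w_i * np and mm = z_i * m + w_i * nm. Subtracting them gives w, and then either one gives
    z.\<close>
  define w where "w = (\<Sum>i\<in>B. ((mp i - mm i) / (np - nm)) *\<^sub>R i)"
  have w: "w \<in> span B" unfolding w_def by (intro span_sum span_scale span_base)
  have wi: "inner w i = (mp i - mm i) / (np - nm)" if "i \<in> B" for i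
    unfolding w_def by (rule inner_sum_scaled[OF bB that])
  define v where "v = (\<Sum>i\<in>B. ((mp i - np * inner w i) / m) *\<^sub>R i)"
  have v: "v \<in> span B" unfolding v_def by (intro span_sum span_scale span_base)
  define z where "z = v + r *\<^sub>R b"
  have z: "z \<in> span ?J" unfolding z_def by (rule span_insert_add[OF bB v])
  have zb: "inner z b = r" unfolding z_def by (rule inner_add_Basis[OF bB v])
  have bi: "inner b i = 0" if "i \<in> B" for i using bB that by (auto simp: inner_Basis)
  have zi: "inner z i = (mp i - np * inner w i) / m" if "i \<in> B" for i
    unfolding z_def using inner_sum_scaled[OF bB that] bi[OF that] by (simp add: inner_add_left v_def)
  have zi1: "mp i - inner z i * m - inner w i * np = 0" if "i \<in> B" for i
    using m by (simp add: zi[OF that])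
  have zi2: "mm i - inner z i * m - inner w i * nm = 0" if "i \<in> B" for i
  proof -
    have "inner w i * (np - nm) = mp i - mm i" using np nm by (simp add: wi[OF that])
    then show ?thesis using zi1[OF that] by (simp add: algebra_simps)
  qed
  have wb: "inner w b = 0" using span_Basis_orthogonal[OF bB w] by simp
  have sh: "(LINT x|?M. F (x + inner x b *\<^sub>R w + z)) = (LINT x|?M. F x)" if "F \<in> borel_measurable borel" for F :: "'a \<Rightarrow> real"
  proof -
    have "(LINT x|?M. F (x + inner x b *\<^sub>R w + z)) = (LINT x|?M. F (x + z))"
      by (rule integral_measure_preserving[OF distr_span_lborel_shear[OF bB w]]) (use that in auto)
    then show ?thesis using tr[OF z that] by simp
  qed
  have Tb: "inner (x + inner x b *\<^sub>R w + z) b - r = inner x b" for x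
    by (simp add: inner_add_left wb zb)
  have Ti: "inner (x + inner x b *\<^sub>R w + z) i - inner z i - inner x b * inner w i = inner x i" for x i
    by (simp add: inner_add_left)
  show ?thesis
  proof (rule that[OF w z])
    have "(LINT x|?M. half_power 0 (inner (x + inner x b *\<^sub>R w + z) b - r) * g (x + inner x b *\<^sub>R w + z))
        = (LINT x|?M. half_power 0 (inner x b - r) * g x)"
      by (rule sh) measurable
    then show "(LINT x|?M. half_power 0 (inner x b) * g (x + inner x b *\<^sub>R w + z)) = (LINT x|?M. g x) / 2"
      unfolding Tb using r by simp
    have "(LINT x|?M. half_power 0 (- (inner (x + inner x b *\<^sub>R w + z) b - r)) * g (x + inner x b *\<^sub>R w + z))
        = (LINT x|?M. half_power 0 (- (inner x b - r)) * g x)"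
      by (rule sh) measurable
    then show "(LINT x|?M. half_power 0 (- inner x b) * g (x + inner x b *\<^sub>R w + z)) = (LINT x|?M. g x) / 2"
      unfolding Tb using r by simp
    \<comment> \<open>The function \<sigma> stands for the identity or for negation, so both halves
      follow from one computation.\<close>
    have bal: "(LINT x|?M. half_power 0 (\<sigma> (inner x b)) * (inner x i * g (x + inner x b *\<^sub>R w + z)))
       = (LINT x|?M. half_power 0 (\<sigma> (inner x b - r)) * (inner x i * g x))
         - inner z i * (LINT x|?M. half_power 0 (\<sigma> (inner x b - r)) * g x)
         - inner w i * (LINT x|?M. half_power 0 (\<sigma> (inner x b - r)) * ((inner x b - r) * g x))"
      if [measurable]: "\<sigma> \<in> borel_measurable borel" for \<sigma> i
    proof -
      let ?h = "\<lambda>x. half_power 0 (\<sigma> (inner x b - r))"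
      have int_b: "integrable ?M (\<lambda>x. (inner x b - r) * g x)"
        using int_i[of b] int_g by (simp add: left_diff_distrib)
      have i3: "integrable ?M (\<lambda>x. ?h x * (inner x i * g x))" "integrable ?M (\<lambda>x. ?h x * g x)"
        "integrable ?M (\<lambda>x. ?h x * ((inner x b - r) * g x))"
        by (rule iu, rule int_i int_g int_b, measurable)+
      have "(LINT x|?M. half_power 0 (\<sigma> (inner x b)) * (inner x i * g (x + inner x b *\<^sub>R w + z)))
        = (LINT x|?M. (\<lambda>y. ?h y * ((inner y i - inner z i - (inner y b - r) * inner w i) * g y)) (x + inner x b *\<^sub>R w + z))"
        by (simp only: Tb Ti)
      also have "\<dots> = (LINT y|?M. ?h y * ((inner y i - inner z i - (inner y b - r) * inner w i) * g y))"
        by (rule sh) measurable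
      also have "\<dots> = (LINT y|?M. ?h y * (inner y i * g y) - inner z i * (?h y * g y) - inner w i * (?h y * ((inner y b - r) * g y)))"
        by (rule Bochner_Integration.integral_cong) (auto simp: algebra_simps)
      also have "\<dots> = (LINT y|?M. ?h y * (inner y i * g y)) - inner z i * (LINT y|?M. ?h y * g y) - inner w i * (LINT y|?M. ?h y * ((inner y b - r) * g y))"
        using i3 by simp
      finally show ?thesis .
    qed
    show "\<forall>i\<in>B. (LINT x|?M. half_power 0 (inner x b) * (inner x i * g (x + inner x b *\<^sub>R w + z))) = 0"
      using bal[of "\<lambda>t. t"] zi1 r(1) by (simp add: mp_def np_def m_def)
    show "\<forall>i\<in>B. (LINT x|?M. half_power 0 (- inner x b) * (inner x i * g (x + inner x b *\<^sub>R w + z))) = 0"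
      using bal[of "\<lambda>t. - t"] zi2 r(2) by (simp add: mm_def nm_def m_def)
  qed
qed

text \<open>The balancing shear and translation are applied to g, so that each half of the result
  \<open>p\<close> has mass m and is centred along \<open>B\<close>. On f the shear acts by its
  inverse transpose, and the translation becomes the factor exp <z, .>, which preserves the duality
  bound. The half-space inequality, with the roles of the two functions exchanged, bounds m times
  each half of \<open>q\<close>; the total of \<open>q\<close> is an exponential tilt of the centred
  f, hence at least the integral of f.\<close>

lemma santalo_insert:
  fixes B :: "'a::euclidean_space set"
  assumes bB: "insert b B \<subseteq> Basis" "b \<notin> B" and S: "santalo B"
  shows "santalo (insert b B)"
  unfolding santalo_def
proof (intro allI impI)
  let ?J = "insert b B" and ?M = "span_lborel (insert b B)"
  fix f g :: "'a \<Rightarrow> real"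
  assume f: "gauss_bounded ?J f" and g: "gauss_bounded ?J g"
    and fpos: "\<forall>x\<in>span ?J. f x > 0" and gpos: "\<forall>x\<in>span ?J. g x > 0"
    and fg: "\<forall>x\<in>span ?J. \<forall>y\<in>span ?J. f x * g y \<le> exp (- inner x y)"
    and bary: "\<forall>i\<in>?J. (LINT x|?M. inner x i * f x) = 0"
  note fin = finite_subbasis[OF bB]
  have J: "finite ?J" using fin by simp
  note [measurable] = gauss_boundedD(1)[OF g] gauss_boundedD(1)[OF f]
  define m where "m = (LINT x|?M. g x) / 2"
  have m: "m > 0" unfolding m_def using integral_pos_gauss_bounded[OF J bB(1) g] gpos by simp
  obtain w z where w: "w \<in> span B" and z: "z \<in> span ?J"
    and half: "(LINT x|?M. half_power 0 (inner x b) * g (x + inner x b *\<^sub>R w + z)) = m"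
      "(LINT x|?M. half_power 0 (- inner x b) * g (x + inner x b *\<^sub>R w + z)) = m"
    and bal: "\<forall>i\<in>B. (LINT x|?M. half_power 0 (inner x b) * (inner x i * g (x + inner x b *\<^sub>R w + z))) = 0"
      "\<forall>i\<in>B. (LINT x|?M. half_power 0 (- inner x b) * (inner x i * g (x + inner x b *\<^sub>R w + z))) = 0"
    using balancing_shear[OF bB g gpos] unfolding m_def by blast
  define sh where "sh x = x + inner x b *\<^sub>R w" for x
  define sh' where "sh' x = x - inner x b *\<^sub>R w" for x
  define ds where "ds y = y - inner w y *\<^sub>R b" for y
  define ds' where "ds' y = y + inner w y *\<^sub>R b" for y
  have wb: "inner w b = 0" "inner b w = 0" using span_Basis_orthogonal[OF bB w] by auto
  have lin: "linear sh" "linear sh'" "linear ds" "linear ds'"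
    unfolding sh_def sh'_def ds_def ds'_def
    by (rule linearI; simp add: inner_add_left inner_add_right algebra_simps)+
  have inv: "sh' (sh x) = x" "sh (sh' x) = x" "ds' (ds x) = x" "ds (ds' x) = x" for x
    using wb by (simp_all add: sh_def sh'_def ds_def ds'_def inner_add_left inner_diff_left inner_add_right inner_diff_right)
  have mem: "sh x \<in> span ?J" "ds x \<in> span ?J" "sh' x \<in> span ?J" "ds' x \<in> span ?J" if "x \<in> span ?J" for x
    unfolding sh_def ds_def sh'_def ds'_def
    using that b_mem_span[OF bB] span_mono_insert[OF bB w] by (auto intro!: span_add span_diff span_scale)
  define p where "p x = g (sh x + z)" for x
  define q where "q y = exp (inner z (ds y)) * f (ds y)" for y
  have p: "gauss_bounded ?J p"
    unfolding p_def by (rule gauss_bounded_affine[OF g lin(1,2) mem(1) inv(1) z])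
  have q: "gauss_bounded ?J q"
    using gauss_bounded_affine[OF gauss_bounded_exp_inner[OF f, of z] lin(3,4) mem(2) inv(3) span_zero]
    by (simp add: q_def[abs_def])
  have ppos: "\<forall>x\<in>span ?J. p x > 0" and qpos: "\<forall>x\<in>span ?J. q x > 0"
    unfolding p_def q_def using gpos fpos mem z by (auto intro!: span_add mult_pos_pos)
  have pq: "p x * q y \<le> exp (- inner x y)" if "x \<in> span ?J" "y \<in> span ?J" for x y
  proof -
    have "f (ds y) * g (sh x + z) \<le> exp (- inner (ds y) (sh x + z))"
      using fg mem that z by (auto intro!: span_add)
    also have "inner (ds y) (sh x + z) = inner x y + inner z (ds y)"
      using dual_shear_inner(1)[OF bB w, of x y]
      by (simp add: sh_def ds_def inner_add_right inner_commute)
    finally have "exp (inner z (ds y)) * (f (ds y) * g (sh x + z)) \<le> exp (inner z (ds y)) * exp (- (inner x y + inner z (ds y)))"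
      by (intro mult_left_mono) auto
    then show ?thesis by (simp add: p_def q_def mult_ac flip: exp_add)
  qed
  note half = half[folded sh_def, folded p_def] and bal = bal[folded sh_def, folded p_def]
  \<comment> \<open>The bound for one half-space; four times it is the bound in the next
    dimension.\<close>
  define X where "X = (2 * pi) ^ card B * (half_moment 0)\<^sup>2"
  have refl_add: "reflect b (x + s *\<^sub>R b) = x + (- s) *\<^sub>R b" if "x \<in> span B" for x s
    by (rule reflect_add[OF bB that])
  have p_refl: "gauss_bounded ?J (\<lambda>x. p (reflect b x))" and q_refl: "gauss_bounded ?J (\<lambda>x. q (reflect b x))"
    using gauss_bounded_reflect[OF bB p span_zero] gauss_bounded_reflect[OF bB q span_zero] by simp_all
  note [measurable] = gauss_boundedD(1)[OF p] gauss_boundedD(1)[OF q]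
  have le1: "\<forall>x\<in>span B. \<forall>y\<in>span B. \<forall>s>0. \<forall>t>0. p (x + s *\<^sub>R b) * q (y + t *\<^sub>R b) \<le> exp (- (inner x y + s * t))"
  proof (intro ballI allI impI)
    fix x y and s t :: real assume xy: "x \<in> span B" "y \<in> span B"
    show "p (x + s *\<^sub>R b) * q (y + t *\<^sub>R b) \<le> exp (- (inner x y + s * t))"
      using pq[OF span_insert_add[OF bB xy(1), of s] span_insert_add[OF bB xy(2), of t]]
        span_Basis_orthogonal[OF bB xy(1)] span_Basis_orthogonal[OF bB xy(2)] inner_b_b[OF bB]
      by (simp add: inner_add_left inner_add_right mult.commute)
  qed
  \<comment> \<open>The lower half becomes an upper half after reflecting both functions, since the
    reflection preserves the inner product.\<close>
  have le2: "\<forall>x\<in>span B. \<forall>y\<in>span B. \<forall>s>0. \<forall>t>0. p (reflect b (x + s *\<^sub>R b)) * q (reflect b (y + t *\<^sub>R b)) \<le> exp (- (inner x y + s * t))"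
  proof (intro ballI allI impI)
    fix x y and s t :: real assume xy: "x \<in> span B" "y \<in> span B"
    show "p (reflect b (x + s *\<^sub>R b)) * q (reflect b (y + t *\<^sub>R b)) \<le> exp (- (inner x y + s * t))"
      unfolding refl_add[OF xy(1)] refl_add[OF xy(2)]
      using pq[OF span_insert_add[OF bB xy(1), of "- s"] span_insert_add[OF bB xy(2), of "- t"]]
        span_Basis_orthogonal[OF bB xy(1)] span_Basis_orthogonal[OF bB xy(2)] inner_b_b[OF bB]
      by (simp add: inner_add_left inner_add_right inner_diff_left inner_diff_right mult.commute)
  qed
  have refl: "(LINT x|?M. half_power 0 (inner x b) * F (reflect b x)) = (LINT x|?M. half_power 0 (- inner x b) * F x)"
    if [measurable]: "F \<in> borel_measurable borel" for F :: "'a \<Rightarrow> real"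
    using integral_reflect[OF bB, of "\<lambda>x. half_power 0 (- inner x b) * F x"] by (simp add: reflect_simps[OF bB])
  have bal2: "\<forall>i\<in>B. (LINT x|?M. half_power 0 (inner x b) * (inner x i * p (reflect b x))) = 0"
  proof
    fix i assume "i \<in> B"
    then show "(LINT x|?M. half_power 0 (inner x b) * (inner x i * p (reflect b x))) = 0"
      using refl[of "\<lambda>x. inner x i * p x"] bal(2) by (simp add: inner_reflect[OF bB])
  qed
  have pos2: "\<forall>x\<in>span ?J. p (reflect b x) > 0" "\<forall>x\<in>span ?J. q (reflect b x) > 0"
    using ppos qpos reflect_mem_span[OF bB] by auto
  note H1 = half_space_santalo[OF bB S p ppos q qpos le1 bal(1), folded X_def, unfolded half]
  note H2 = half_space_santalo[OF bB S p_refl pos2(1) q_refl pos2(2) le2 bal2, folded X_def,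
      unfolded refl[OF gauss_boundedD(1)[OF p]] refl[OF gauss_boundedD(1)[OF q]] half]
  define qp where "qp = (LINT x|?M. half_power 0 (inner x b) * q x)"
  define qm where "qm = (LINT x|?M. half_power 0 (- inner x b) * q x)"
  have int_q: "integrable ?M q" by (rule integrable_gauss_bounded[OF J bB(1) q])
  have hp_le: "half_power 0 t \<le> 1" for t by (simp add: half_power_def)
  have "integrable ?M (\<lambda>x. half_power 0 (inner x b) * q x)" "integrable ?M (\<lambda>x. half_power 0 (- inner x b) * q x)"
    by (rule Bochner_Integration.integrable_bound[OF int_q]; auto simp: abs_mult intro!: mult_left_le_one_le hp_le)+
  then have "qp + qm = (LINT x|?M. half_power 0 (inner x b) * q x + half_power 0 (- inner x b) * q x)"
    by (simp add: qp_def qm_def)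
  also have "\<dots> = (LINT x|?M. q x)"
    by (rule integral_cong_AE, measurable, use AE_inner_Basis_neq[OF bB, of 0] in eventually_elim)
      (auto simp: half_power_def)
  also have "\<dots> = (LINT y|?M. exp (inner z y) * f y)"
    using integral_measure_preserving[OF distr_span_lborel_dual_shear[OF bB w], of "\<lambda>y. exp (inner z y) * f y"]
    by (simp add: q_def[abs_def] ds_def[abs_def])
  finally have qpm: "qp + qm = (LINT y|?M. exp (inner z y) * f y)" .
  note tilt = exponential_tilt_integral[OF J bB(1) f fpos z integral_inner_eq_0[OF bB f bary z], folded qpm]
  have X2: "4 * X = (2 * pi) ^ card ?J"
    unfolding X_def half_moment_sq using fin bB(2) by simp
  have g2m: "(LINT x|?M. g x) = 2 * m" by (simp add: m_def)
  have qle: "m * qp \<le> X" "m * qm \<le> X"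
    using H1(1) H2(1) by (simp_all add: qp_def qm_def)
  have fle: "m * (LINT x|?M. f x) \<le> m * (qp + qm)" using tilt(1) m by simp
  have "(LINT x|?M. f x) * (LINT x|?M. g x) \<le> (2 * pi) ^ card ?J"
    unfolding g2m X2[symmetric] using fle qle by (simp add: algebra_simps)
  moreover have "gauss_pair ?J f g" if eq: "(LINT x|?M. f x) * (LINT x|?M. g x) = (2 * pi) ^ card ?J"
  proof -
    \<comment> \<open>Equality in the sum forces equality in each half and in the tilt estimate; the
      latter gives z = 0, so no translation occurred.\<close>
    have "m * (LINT x|?M. f x) = 2 * X" using eq unfolding g2m X2[symmetric] by simp
    then have e: "m * qp = X" "m * qm = X" "m * (LINT x|?M. f x) = m * (qp + qm)"
      using fle qle by (simp_all add: algebra_simps)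
    then have "qp + qm = (LINT x|?M. f x)" using m by simp
    then have z0: "z = 0" by (rule tilt(2))
    obtain A A' \<beta> \<mu> where D: "dual_linear_maps B A A'" and \<beta>: "\<beta> > 0" and \<mu>: "\<mu> > 0"
      and P: "\<And>x s. x \<in> span B \<Longrightarrow> s \<ge> 0 \<Longrightarrow> p (x + s *\<^sub>R b) = \<beta> * exp (- ((norm (A x))\<^sup>2 + \<mu> * s\<^sup>2) / 2)"
      and Q: "\<And>x s. x \<in> span B \<Longrightarrow> s \<ge> 0 \<Longrightarrow> q (x + s *\<^sub>R b) = exp (- ((norm (A' x))\<^sup>2 + s\<^sup>2 / \<mu>) / 2) / \<beta>"
      using H1(2) e(1) unfolding qp_def by blast
    obtain A2 A2' \<beta>2 \<mu>2 where D2: "dual_linear_maps B A2 A2'" and \<beta>2: "\<beta>2 > 0" and \<mu>2: "\<mu>2 > 0"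
      and P2: "\<And>x s. x \<in> span B \<Longrightarrow> s \<ge> 0 \<Longrightarrow> p (reflect b (x + s *\<^sub>R b)) = \<beta>2 * exp (- ((norm (A2 x))\<^sup>2 + \<mu>2 * s\<^sup>2) / 2)"
      and Q2: "\<And>x s. x \<in> span B \<Longrightarrow> s \<ge> 0 \<Longrightarrow> q (reflect b (x + s *\<^sub>R b)) = exp (- ((norm (A2' x))\<^sup>2 + s\<^sup>2 / \<mu>2) / 2) / \<beta>2"
      using H2(2) e(2) unfolding qm_def by blast
    have P2': "p (x + (- s) *\<^sub>R b) = \<beta>2 * exp (- ((norm (A2 x))\<^sup>2 + \<mu>2 * s\<^sup>2) / 2)"
      and Q2': "q (x + (- s) *\<^sub>R b) = exp (- ((norm (A2' x))\<^sup>2 + s\<^sup>2 / \<mu>2) / 2) / \<beta>2" if "x \<in> span B" "s \<ge> 0" for x s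
      using P2[OF that] Q2[OF that] unfolding refl_add[OF that(1)] by auto
    \<comment> \<open>The Gaussian descriptions of the two halves overlap on the hyperplane s = 0.
      There they must share the constant and the quadratic forms on \<open>span B\<close>, but the
      rates along b remain invisible.\<close>
    have b2: "\<beta>2 = \<beta>"
      using P[of 0 0] P2'[of 0 0] D D2 by (auto simp: dual_linear_maps_def linear_0 span_zero)
    have A2: "(norm (A2 x))\<^sup>2 = (norm (A x))\<^sup>2" "(norm (A2' x))\<^sup>2 = (norm (A' x))\<^sup>2" if "x \<in> span B" for x
      using P[OF that, of 0] P2'[OF that, of 0] Q[OF that, of 0] Q2'[OF that, of 0] \<beta> by (auto simp: b2)
    \<comment> \<open>The rates along b are matched through the masses: both halves of
      \<open>p\<close> have the same integral m, which is strictly decreasing in the rate.\<close>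
    define I where "I \<nu> = (LINT s|lborel. half_power 0 s * exp (- \<nu> * s\<^sup>2 / 2))" for \<nu>
    have halfI: "(LINT x|span_lborel B. LINT s|lborel. half_power 0 s * F (x + s *\<^sub>R b)) = (LINT x|span_lborel B. \<beta> * exp (- (norm (A x))\<^sup>2 / 2)) * I \<nu>"
      if F: "\<And>x s. x \<in> span B \<Longrightarrow> s > 0 \<Longrightarrow> F (x + s *\<^sub>R b) = \<beta> * exp (- ((norm (A x))\<^sup>2 + \<nu> * s\<^sup>2) / 2)"
        and [measurable]: "F \<in> borel_measurable borel" for F \<nu>
    proof -
      have "linear A" using D by (simp add: dual_linear_maps_def)
      then have [measurable]: "A \<in> borel_measurable borel"
        by (intro borel_measurable_continuous_onI linear_continuous_on) (simp add: linear_conv_bounded_linear)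
      have "(LINT x|span_lborel B. LINT s|lborel. half_power 0 s * F (x + s *\<^sub>R b)) = (LINT x|span_lborel B. (\<beta> * exp (- (norm (A x))\<^sup>2 / 2)) * I \<nu>)"
      proof (rule integral_cong_AE, measurable, use AE_span_lborel[OF fin] in eventually_elim)
        case (elim x)
        have eq: "half_power 0 s * F (x + s *\<^sub>R b) = (\<beta> * exp (- (norm (A x))\<^sup>2 / 2)) * (half_power 0 s * exp (- \<nu> * s\<^sup>2 / 2))" for s
        proof (cases "s > 0")
          case True
          have "exp (- ((norm (A x))\<^sup>2 + \<nu> * s\<^sup>2) / 2) = exp (- (norm (A x))\<^sup>2 / 2) * exp (- \<nu> * s\<^sup>2 / 2)"
            by (simp add: field_simps flip: exp_add)
          then show ?thesis using F[OF elim True] by simp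
        qed (simp add: half_power_def)
        show ?case unfolding I_def by (simp only: eq integral_mult_right_zero)
      qed
      then show ?thesis by simp
    qed
    have mI: "m = (LINT x|span_lborel B. \<beta> * exp (- (norm (A x))\<^sup>2 / 2)) * I \<mu>"
      using half(1) integral_half_power_inner[OF bB p, of 0] halfI[of p \<mu>] P by simp
    have "m = (LINT x|?M. half_power 0 (inner x b) * p (reflect b x))"
      using refl[of p] half(2) by simp
    also have "\<dots> = (LINT x|span_lborel B. \<beta> * exp (- (norm (A x))\<^sup>2 / 2)) * I \<mu>2"
      using integral_half_power_inner[OF bB p_refl, of 0] halfI[of "\<lambda>x. p (reflect b x)" \<mu>2] P2 by (simp add: b2 A2(1))
    finally have "I \<mu> = I \<mu>2" using mI m by auto
    then have mu2: "\<mu>2 = \<mu>"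
    proof (cases \<mu> \<mu>2 rule: linorder_cases)
      case less
      with half_power_gauss_strict_antimono[OF \<mu> less, of 0] \<open>I \<mu> = I \<mu>2\<close> show ?thesis by (simp add: I_def)
    next
      case greater
      with half_power_gauss_strict_antimono[OF \<mu>2 greater, of 0] \<open>I \<mu> = I \<mu>2\<close> show ?thesis by (simp add: I_def)
    qed simp
    have PA: "p (x + s *\<^sub>R b) = \<beta> * exp (- ((norm (A x))\<^sup>2 + \<mu> * s\<^sup>2) / 2)" if "x \<in> span B" for x s
      using P[OF that, of s] P2'[OF that, of "- s"] A2[OF that] b2 mu2 by (cases "s \<ge> 0") auto
    have QA: "q (x + s *\<^sub>R b) = exp (- ((norm (A' x))\<^sup>2 + s\<^sup>2 / \<mu>) / 2) / \<beta>" if "x \<in> span B" for x s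
      using Q[OF that, of s] Q2'[OF that, of "- s"] A2[OF that] b2 mu2 by (cases "s \<ge> 0") auto
    define C where "C x = A (x - inner x b *\<^sub>R b) + (sqrt \<mu> * inner x b) *\<^sub>R b" for x
    define C' where "C' x = A' (x - inner x b *\<^sub>R b) + (inner x b / sqrt \<mu>) *\<^sub>R b" for x
    note CC = dual_linear_maps_insert[OF bB D \<mu>, folded C_def C'_def]
    have pC: "p x = \<beta> * exp (- (norm (C x))\<^sup>2 / 2)" "q x = exp (- (norm (C' x))\<^sup>2 / 2) / \<beta>" if xJ: "x \<in> span ?J" for x
    proof -
      obtain v where v: "v \<in> span B" "x = v + inner x b *\<^sub>R b" using span_insert_cases[OF bB xJ] .
      define s where "s = inner x b"
      have x: "x = v + s *\<^sub>R b" using v(2) by (simp add: s_def)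
      show "p x = \<beta> * exp (- (norm (C x))\<^sup>2 / 2)" "q x = exp (- (norm (C' x))\<^sup>2 / 2) / \<beta>"
        unfolding x CC(2,3)[OF v(1)] PA[OF v(1)] QA[OF v(1)] by simp_all
    qed
    \<comment> \<open>Undo the shears. Since f comes from \<open>q\<close> and g from
      \<open>p\<close>, the two maps trade places and the constant becomes 1 / \<beta>.\<close>
    have "dual_linear_maps ?J (\<lambda>x. C' (ds' x)) (\<lambda>x. C (sh' x))"
      using dual_linear_maps_shear[OF bB dual_linear_maps_commute[OF CC(1)] w] by (simp add: ds'_def sh'_def)
    moreover have "g x = exp (- (norm (C (sh' x)))\<^sup>2 / 2) / (1 / \<beta>)" if "x \<in> span ?J" for x
      using pC(1)[OF mem(3)[OF that]] by (simp add: p_def inv z0)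
    moreover have "f x = 1 / \<beta> * exp (- (norm (C' (ds' x)))\<^sup>2 / 2)" if "x \<in> span ?J" for x
      using pC(2)[OF mem(4)[OF that]] by (simp add: q_def inv z0)
    ultimately show ?thesis
      unfolding gauss_pair_def using \<beta> by (intro exI[of _ "\<lambda>x. C' (ds' x)"] exI[of _ "\<lambda>x. C (sh' x)"] exI[of _ "1 / \<beta>"]) auto
  qed
  ultimately show "(LINT x|?M. f x) * (LINT x|?M. g x) \<le> (2 * pi) ^ card ?J \<and>
     ((LINT x|?M. f x) * (LINT x|?M. g x) = (2 * pi) ^ card ?J \<longrightarrow> gauss_pair ?J f g)"
    by blast
qed

theorem santalo_subset_Basis:
  assumes "B \<subseteq> (Basis :: 'a::euclidean_space set)"
  shows "santalo B"
proof -
  have "finite B" using assms by (rule finite_subset) simp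
  then show ?thesis
    using assms by (induction B rule: finite_induct) (auto intro: santalo_empty santalo_insert)
qed

section \<open>The weighted inequality in a given direction\<close>

definition axis_scale :: "'a::euclidean_space \<Rightarrow> real \<Rightarrow> 'a \<Rightarrow> 'a" where
  "axis_scale b a x = x + ((a - 1) * inner x b) *\<^sub>R b"

lemma linear_axis_scale: "linear (axis_scale b a)"
  unfolding axis_scale_def[abs_def] by (rule linearI) (simp_all add: inner_add_left algebra_simps)

lemma borel_measurable_axis_scale [measurable]: "axis_scale b a \<in> borel_measurable borel"
  unfolding axis_scale_def[abs_def] by measurable

context
  fixes B :: "'a::euclidean_space set" and b :: 'a
  assumes bB: "insert b B \<subseteq> Basis" "b \<notin> B"
begin

lemma axis_scale_mem: "x \<in> span (insert b B) \<Longrightarrow> axis_scale b a x \<in> span (insert b B)"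
  unfolding axis_scale_def by (intro span_add span_scale b_mem_span[OF bB])

lemma inner_axis_scale: "inner (axis_scale b a x) b = a * inner x b"
  by (simp add: axis_scale_def inner_add_left inner_b_b[OF bB] algebra_simps)

lemma axis_scale_inverse: "a \<noteq> 0 \<Longrightarrow> axis_scale b (1 / a) (axis_scale b a x) = x"
  using inner_axis_scale[of a x]
  by (simp add: axis_scale_def[of b "1 / a" "axis_scale b a x"])
    (simp add: axis_scale_def field_simps flip: scaleR_add_left)

lemma inner_axis_scale_dual:
  assumes a: "a \<noteq> 0"
  shows "inner (axis_scale b (1 / a) x) (axis_scale b a y) = inner x y"
proof -
  have "inner b y = inner y b" by (rule inner_commute)
  then have "inner (axis_scale b (1 / a) x) (axis_scale b a y)
      = inner x y + inner x b * inner y b * ((a - 1) + (1 / a - 1) + (1 / a - 1) * (a - 1))"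
    by (simp only: axis_scale_def inner_add_left inner_add_right inner_scaleR_left inner_scaleR_right inner_b_b[OF bB])
      (simp only: algebra_simps)
  also have "(a - 1) + (1 / a - 1) + (1 / a - 1) * (a - 1) = 0" using a by (simp add: field_simps)
  finally show ?thesis by simp
qed

lemma axis_scale_add: "x \<in> span B \<Longrightarrow> axis_scale b a (x + s *\<^sub>R b) = x + (a * s) *\<^sub>R b"
  unfolding axis_scale_def using inner_add_Basis[OF bB, of x s]
  by (simp add: add.assoc scaleR_add_left[symmetric] algebra_simps del: scaleR_add_left)

lemma gauss_bounded_axis_scale:
  assumes h: "gauss_bounded (insert b B) h" and a: "a \<noteq> 0"
  shows "gauss_bounded (insert b B) (\<lambda>x. h (axis_scale b a x))"
  using gauss_bounded_affine[OF h linear_axis_scale linear_axis_scale axis_scale_mem axis_scale_inverse[OF a] span_zero] by simp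

lemma integral_axis_scale:
  assumes h: "gauss_bounded (insert b B) h" and a: "a \<noteq> 0"
  shows "(LINT x|span_lborel (insert b B). h (axis_scale b a x)) = (LINT x|span_lborel (insert b B). h x) / \<bar>a\<bar>"
proof -
  note fin = finite_subbasis[OF bB] and sub = subbasis_subset[OF bB]
  note ins = integral_span_lborel_insert(1)[OF fin sub bB(2)]
  have J: "finite (insert b B)" using fin by simp
  note [measurable] = gauss_boundedD(1)[OF h] gauss_boundedD(1)[OF gauss_bounded_axis_scale[OF h a]]
  have "(LINT x|span_lborel (insert b B). h (axis_scale b a x))
      = (LINT x|span_lborel B. LINT s|lborel. h (axis_scale b a (x + s *\<^sub>R b)))"
    by (rule ins[OF integrable_gauss_bounded[OF J bB(1) gauss_bounded_axis_scale[OF h a]]])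
  also have "\<dots> = (LINT x|span_lborel B. (LINT s|lborel. h (x + s *\<^sub>R b)) / \<bar>a\<bar>)"
  proof (rule integral_cong_AE, measurable, use AE_span_lborel[OF fin] in eventually_elim)
    case (elim x)
    have "(LINT s|lborel. h (x + s *\<^sub>R b)) = \<bar>a\<bar> * (LINT s|lborel. h (x + (a * s) *\<^sub>R b))"
      using lborel_integral_real_affine[OF a, of "\<lambda>s. h (x + s *\<^sub>R b)" 0] by simp
    then show ?case using a by (simp add: axis_scale_add[OF elim])
  qed
  also have "\<dots> = (LINT x|span_lborel (insert b B). h x) / \<bar>a\<bar>"
    using ins[OF integrable_gauss_bounded[OF J bB(1) h]] by simp
  finally show ?thesis .
qed

end

lemma half_integral_even:
  fixes F :: "'a::euclidean_space \<Rightarrow> real"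
  assumes J: "finite J" "J \<subseteq> Basis" and b: "b \<in> Basis" and F: "gauss_bounded J F" and even: "\<And>x. F (- x) = F x"
  shows "(LINT x|span_lborel J. (inner x b)\<^sup>2 * F x) = 2 * (LINT x|span_lborel J. half_power 2 (inner x b) * F x)"
proof -
  note [measurable] = gauss_boundedD(1)[OF F]
  have int: "integrable (span_lborel J) (\<lambda>x. half_power 2 (inner x b) * F x)"
    by (rule integrable_half_power_inner[OF J F]) (use b in simp)
  have eq: "half_power 2 (inner x (- b)) * F x = half_power 2 (inner (- x) b) * F (- x)" for x
    by (simp add: even)
  have int': "integrable (span_lborel J) (\<lambda>x. half_power 2 (inner x (- b)) * F x)"
    by (rule integrable_half_power_inner[OF J F]) (use b in simp)
  have e: "(LINT x|span_lborel J. half_power 2 (inner x (- b)) * F x) = (LINT x|span_lborel J. half_power 2 (inner x b) * F x)"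
    unfolding eq by (rule integral_span_lborel_uminus[OF J(1)]) measurable
  have "(inner x b)\<^sup>2 * F x = half_power 2 (inner x b) * F x + half_power 2 (inner x (- b)) * F x" for x
    by (simp add: half_power_def)
  then have "(LINT x|span_lborel J. (inner x b)\<^sup>2 * F x) = (LINT x|span_lborel J. half_power 2 (inner x b) * F x + half_power 2 (inner x (- b)) * F x)"
    by simp
  also have "\<dots> = 2 * (LINT x|span_lborel J. half_power 2 (inner x b) * F x)"
    using int int' e by simp
  finally show ?thesis .
qed

text \<open>The linear change of variables makes \<open>u\<close> the last coordinate functional and moves the barycentre
  of the weighted half onto the last axis; the vector \<open>v\<close> is that axis.\<close>

theorem directional_moment_santalo:
  fixes f g :: "'a::euclidean_space \<Rightarrow> real" and u :: 'a
  assumes f: "gauss_bounded Basis f" "\<And>x. f x > 0" "\<And>x. f (- x) = f x"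
    and g: "gauss_bounded Basis g" "\<And>x. g x > 0" "\<And>x. g (- x) = g x"
    and le: "\<And>x y. f x * g y \<le> exp (- inner x y)" and u: "u \<noteq> 0"
  obtains v where "inner v u = 1"
    "(LINT x|lborel. (inner x u)\<^sup>2 * f x) * (LINT y|lborel. (inner y v)\<^sup>2 * g y) \<le> (2 * pi) ^ DIM('a)"
    "(LINT x|lborel. (inner x u)\<^sup>2 * f x) * (LINT y|lborel. (inner y v)\<^sup>2 * g y) = (2 * pi) ^ DIM('a) \<Longrightarrow>
      \<exists>(E :: 'a \<Rightarrow> 'a) \<beta>. linear E \<and> \<beta> > 0 \<and> (\<forall>y. g y = exp (- (norm (E y))\<^sup>2 / 2) / \<beta>)"
proof -
  \<comment> \<open>The nonzero coordinate c of u along b makes the axis scaling invertible, so that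
    u can be carried to b by a scaling and a shear.\<close>
  obtain b :: 'a where b: "b \<in> Basis" "inner u b \<noteq> 0"
    using u euclidean_all_zero_iff[of u] by auto
  define B where "B = Basis - {b}"
  have ins: "insert b B = Basis" using b by (auto simp: B_def)
  have bB: "insert b B \<subseteq> Basis" "b \<notin> B" using ins by (auto simp: B_def)
  have spanU: "x \<in> span (insert b B)" for x unfolding ins by simp
  let ?J = "insert b B" and ?M = "span_lborel (insert b B)"
  have M: "?M = lborel" unfolding ins by (rule span_lborel_Basis)
  note fin = finite_subbasis[OF bB]
  have J: "finite ?J" using fin by simp
  have S: "santalo B" by (rule santalo_subset_Basis) (auto simp: B_def)
  define c where "c = inner u b"
  have c: "c \<noteq> 0" "1 / c \<noteq> 0" using b by (auto simp: c_def)
  obtain uB where uB: "uB \<in> span B" "u = uB + c *\<^sub>R b"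
    using span_insert_cases[OF bB spanU[of u]] unfolding c_def .
  define sh where "sh w x = x + inner x b *\<^sub>R w" for w x
  define ds where "ds w y = y - inner w y *\<^sub>R b" for w y
  define sh' where "sh' w x = x - inner x b *\<^sub>R w" for w x
  define ds' where "ds' w y = y + inner w y *\<^sub>R b" for w y
  have lin: "linear (sh w)" "linear (ds w)" "linear (sh' w)" "linear (ds' w)" for w
    unfolding sh_def ds_def sh'_def ds'_def by (rule linearI; simp add: inner_add_left inner_add_right algebra_simps)+
  have wb: "inner w b = 0" "inner b w = 0" if "w \<in> span B" for w using span_Basis_orthogonal[OF bB that] by auto
  have inv: "sh' w (sh w x) = x" "ds' w (ds w x) = x" "sh w (sh' w x) = x" "ds w (ds' w x) = x" if "w \<in> span B" for w x
    using wb[OF that] by (simp_all add: sh_def sh'_def ds_def ds'_def inner_add_left inner_diff_left inner_add_right inner_diff_right)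
  have dual: "inner (sh w x) (ds w y) = inner x y" "inner (ds w x) (sh w y) = inner x y" if "w \<in> span B" for w x y
    using dual_shear_inner(1)[OF bB that, of x y] dual_shear_inner(1)[OF bB that, of y x]
    by (simp_all add: sh_def ds_def inner_commute)
  have gbc: "gauss_bounded ?J (\<lambda>x. h (L x))" if "gauss_bounded ?J h" "linear L" "linear L'" "\<And>x. L' (L x) = x" for h :: "'a \<Rightarrow> real" and L L'
    using gauss_bounded_affine[OF that(1-3), where z = 0] spanU that(4) by simp
  define f1 where "f1 x = f (axis_scale b (1 / c) (ds uB x))" for x
  define g1 where "g1 y = g (axis_scale b c (sh uB y))" for y
  have f': "gauss_bounded ?J f" and g': "gauss_bounded ?J g" using f(1) g(1) unfolding ins by auto
  have f1: "gauss_bounded ?J f1"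
    unfolding f1_def by (rule gbc[OF gauss_bounded_axis_scale[OF bB f' c(2)] lin(2) lin(4) inv(2)[OF uB(1)]])
  have g1: "gauss_bounded ?J g1"
    unfolding g1_def by (rule gbc[OF gauss_bounded_axis_scale[OF bB g' c(1)] lin(1) lin(3) inv(1)[OF uB(1)]])
  have f1pos: "\<forall>x\<in>span ?J. f1 x > 0" by (simp add: f1_def f(2))
  note [measurable] = gauss_boundedD(1)[OF f'] gauss_boundedD(1)[OF g'] gauss_boundedD(1)[OF f1] gauss_boundedD(1)[OF g1]
  have shi: "(LINT x|?M. F (sh w x)) = (LINT x|?M. F x)" if "w \<in> span B" "F \<in> borel_measurable borel" for F :: "'a \<Rightarrow> real" and w
    unfolding sh_def by (rule integral_measure_preserving[OF distr_span_lborel_shear[OF bB that(1)]]) (use that in auto)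
  have dsi: "(LINT x|?M. F (ds w x)) = (LINT x|?M. F x)" if "w \<in> span B" "F \<in> borel_measurable borel" for F :: "'a \<Rightarrow> real" and w
    unfolding ds_def by (rule integral_measure_preserving[OF distr_span_lborel_dual_shear[OF bB that(1)]]) (use that in auto)
  \<comment> \<open>Exponent 3 is the weight of exponent 2 times the height, so \<mu> i / N is the
    slope of the line from 0 to the barycentre of the weighted upper half. A shear along this slope
    centres that half with no translation, and therefore keeps both functions even.\<close>
  define N where "N = (LINT x|?M. half_power 3 (inner x b) * f1 x)"
  have N: "N > 0" unfolding N_def by (rule half_integral_pos[OF bB f1 f1pos])
  define \<mu> where "\<mu> i = (LINT x|?M. half_power 2 (inner x b) * (inner x i * f1 x))" for i
  define w where "w = (\<Sum>i\<in>B. (\<mu> i / N) *\<^sub>R i)"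
  have w: "w \<in> span B" unfolding w_def by (intro span_sum span_scale span_base)
  have wi: "inner w j = \<mu> j / N" if "j \<in> B" for j
    unfolding w_def by (rule inner_sum_scaled[OF bB that])
  define T where "T x = axis_scale b (1 / c) (ds uB (sh w x))" for x
  define T' where "T' y = axis_scale b c (sh uB (ds w y))" for y
  have TT: "inner (T x) (T' y) = inner x y" for x y
    unfolding T_def T'_def using inner_axis_scale_dual[OF bB c(1)] dual[OF uB(1)] dual[OF w] by simp
  have linT: "linear T" "linear T'"
    unfolding T_def[abs_def] T'_def[abs_def]
    using linear_compose[OF linear_compose[OF lin(1)[of w] lin(2)[of uB]] linear_axis_scale[of b "1/c"]]
      linear_compose[OF linear_compose[OF lin(2)[of w] lin(1)[of uB]] linear_axis_scale[of b c]]
    by (simp_all add: o_def)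
  define p where "p x = f (T x)" for x
  define q where "q y = g (T' y)" for y
  have p: "gauss_bounded ?J p"
    using gbc[OF f1 lin(1) lin(3) inv(1)[OF w]] by (simp add: p_def[abs_def] T_def f1_def)
  have q: "gauss_bounded ?J q"
    using gbc[OF g1 lin(2) lin(4) inv(2)[OF w]] by (simp add: q_def[abs_def] T'_def g1_def)
  have pf1: "p x = f1 (sh w x)" and qg1: "q x = g1 (ds w x)" for x by (simp_all add: p_def q_def T_def T'_def f1_def g1_def)
  have ppos: "\<forall>x\<in>span ?J. p x > 0" and qpos: "\<forall>x\<in>span ?J. q x > 0"
    by (simp_all add: p_def q_def f(2) g(2))
  have peven: "p (- x) = p x" and qeven: "q (- x) = q x" for x
    by (simp_all add: p_def q_def linear_neg[OF linT(1)] linear_neg[OF linT(2)] f(3) g(3))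
  have pq: "p x * q y \<le> exp (- inner x y)" for x y
    using le[of "T x" "T' y"] by (simp add: p_def q_def TT)
  have le1: "\<forall>x\<in>span B. \<forall>y\<in>span B. \<forall>s>0. \<forall>t>0. p (x + s *\<^sub>R b) * q (y + t *\<^sub>R b) \<le> exp (- (inner x y + s * t))"
  proof (intro ballI allI impI)
    fix x y and s t :: real assume xy: "x \<in> span B" "y \<in> span B"
    show "p (x + s *\<^sub>R b) * q (y + t *\<^sub>R b) \<le> exp (- (inner x y + s * t))"
      using pq[of "x + s *\<^sub>R b" "y + t *\<^sub>R b"] wb[OF xy(1)] wb[OF xy(2)] inner_b_b[OF bB]
      by (simp add: inner_add_left inner_add_right mult.commute)
  qed
  have shb: "inner (sh w x) b = inner x b" for x by (simp add: sh_def inner_add_left wb[OF w])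
  have bary: "\<forall>i\<in>B. (LINT x|?M. half_power 2 (inner x b) * (inner x i * p x)) = 0"
  proof
    fix i assume i: "i \<in> B"
    have eq: "inner (sh w x) i - inner x b * inner w i = inner x i" for x
      by (simp add: sh_def inner_add_left)
    have "(LINT x|?M. half_power 2 (inner x b) * (inner x i * p x))
        = (LINT x|?M. half_power 2 (inner (sh w x) b) * ((inner (sh w x) i - inner (sh w x) b * inner w i) * f1 (sh w x)))"
      by (simp only: pf1 eq shb)
    also have "\<dots> = (LINT x|?M. half_power 2 (inner x b) * ((inner x i - inner x b * inner w i) * f1 x))"
      by (rule shi[OF w]) measurable
    also have "\<dots> = (LINT x|?M. half_power 2 (inner x b) * (inner x i * f1 x) - inner w i * (half_power 3 (inner x b) * f1 x))"
      by (rule Bochner_Integration.integral_cong) (auto simp: half_power_def algebra_simps power2_eq_square power3_eq_cube)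
    also have "\<dots> = \<mu> i - inner w i * N"
      unfolding \<mu>_def N_def using b(1)
        integrable_half_power_inner[OF J bB(1) gauss_bounded_inner[OF f1, of i], of b 2]
        integrable_half_power_inner[OF J bB(1) f1, of b 3] by simp
    also have "\<dots> = 0" using N by (simp add: wi[OF i])
    finally show "(LINT x|?M. half_power 2 (inner x b) * (inner x i * p x)) = 0" .
  qed
  note H = half_space_santalo[OF bB S p ppos q qpos le1 bary]
  \<comment> \<open>By construction u = \<open>T' b\<close>; duality of \<open>T\<close> and
    \<open>T'\<close> turns <., b> into <., u> on the side of f and into <., v> on the side of
    g.\<close>
  define v where "v = T b"
  have uT: "u = T' b"
  proof -
    have "T' b = axis_scale b c (uB + 1 *\<^sub>R b)"
      using wb[OF w] inner_b_b[OF bB] by (simp add: T'_def sh_def ds_def add.commute)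
    then show ?thesis using axis_scale_add[OF bB uB(1), of c 1] uB(2) by simp
  qed
  have vu: "inner v u = 1" unfolding v_def uT TT by (rule inner_b_b[OF bB])
  have gb2: "gauss_bounded ?J (\<lambda>x. (inner x a)\<^sup>2 * h x)" if "gauss_bounded ?J h" for h a
    by (rule gauss_bounded_inner_power[OF that])
  \<comment> \<open>Shears preserve volume, so only the axis scaling contributes a Jacobian: |c|
    here and 1 / |c| for g, which cancel in the product.\<close>
  have If: "(LINT x|?M. (inner x b)\<^sup>2 * p x) = \<bar>c\<bar> * (LINT x|?M. (inner x u)\<^sup>2 * f x)"
  proof -
    have xb: "inner x b = inner (T x) u" for x unfolding uT TT ..
    note gf = gb2[OF f', of u]
    note [measurable] = gauss_boundedD(1)[OF gf] gauss_boundedD(1)[OF gauss_bounded_axis_scale[OF bB gf c(2)]]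
    have [measurable]: "ds uB \<in> borel_measurable borel" unfolding ds_def[abs_def] by measurable
    have "(LINT x|?M. (inner x b)\<^sup>2 * p x) = (LINT x|?M. (\<lambda>x. (inner x u)\<^sup>2 * f x) (T x))"
      by (simp only: xb p_def)
    also have "\<dots> = (LINT x|?M. (\<lambda>x. (inner x u)\<^sup>2 * f x) (axis_scale b (1 / c) (ds uB x)))"
      unfolding T_def by (rule shi[OF w]) measurable
    also have "\<dots> = (LINT x|?M. (\<lambda>x. (inner x u)\<^sup>2 * f x) (axis_scale b (1 / c) x))"
      by (rule dsi[OF uB(1)]) measurable
    also have "\<dots> = (LINT x|?M. (inner x u)\<^sup>2 * f x) / \<bar>1 / c\<bar>"
      by (rule integral_axis_scale[OF bB gf c(2)])
    finally show ?thesis by simp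
  qed
  have Ig: "(LINT x|?M. (inner x b)\<^sup>2 * q x) = (LINT x|?M. (inner x v)\<^sup>2 * g x) / \<bar>c\<bar>"
  proof -
    have xb: "inner x b = inner (T' x) v" for x unfolding v_def using TT[of b x] by (simp add: inner_commute)
    note gg = gb2[OF g', of v]
    note [measurable] = gauss_boundedD(1)[OF gg] gauss_boundedD(1)[OF gauss_bounded_axis_scale[OF bB gg c(1)]]
    have [measurable]: "sh uB \<in> borel_measurable borel" unfolding sh_def[abs_def] by measurable
    have "(LINT x|?M. (inner x b)\<^sup>2 * q x) = (LINT x|?M. (\<lambda>x. (inner x v)\<^sup>2 * g x) (T' x))"
      by (simp only: xb q_def)
    also have "\<dots> = (LINT x|?M. (\<lambda>x. (inner x v)\<^sup>2 * g x) (axis_scale b c (sh uB x)))"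
      unfolding T'_def by (rule dsi[OF w]) measurable
    also have "\<dots> = (LINT x|?M. (\<lambda>x. (inner x v)\<^sup>2 * g x) (axis_scale b c x))"
      by (rule shi[OF uB(1)]) measurable
    also have "\<dots> = (LINT x|?M. (inner x v)\<^sup>2 * g x) / \<bar>c\<bar>"
      by (rule integral_axis_scale[OF bB gg c(1)])
    finally show ?thesis .
  qed
  define X where "X = (LINT x|?M. half_power 2 (inner x b) * p x) * (LINT x|?M. half_power 2 (inner x b) * q x)"
  have prod: "(LINT x|?M. (inner x u)\<^sup>2 * f x) * (LINT x|?M. (inner x v)\<^sup>2 * g x) = 4 * X"
  proof -
    have "(LINT x|?M. (inner x u)\<^sup>2 * f x) * (LINT x|?M. (inner x v)\<^sup>2 * g x)
        = (LINT x|?M. (inner x b)\<^sup>2 * p x) * (LINT x|?M. (inner x b)\<^sup>2 * q x)"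
      unfolding If Ig using c by simp
    also have "\<dots> = 4 * X"
      unfolding half_integral_even[OF J bB(1) b(1) p peven] half_integral_even[OF J bB(1) b(1) q qeven] X_def by simp
    finally show ?thesis .
  qed
  have dim: "4 * ((2 * pi) ^ card B * (half_moment 2)\<^sup>2) = (2 * pi) ^ DIM('a)"
  proof -
    have "DIM('a) = Suc (card B)" unfolding ins[symmetric] using fin bB(2) by simp
    then show ?thesis unfolding half_moment_sq by simp
  qed
  show ?thesis
  proof (rule that[OF vu])
    show "(LINT x|lborel. (inner x u)\<^sup>2 * f x) * (LINT y|lborel. (inner y v)\<^sup>2 * g y) \<le> (2 * pi) ^ DIM('a)"
      using H(1) prod unfolding M dim[symmetric] X_def by simp
    assume "(LINT x|lborel. (inner x u)\<^sup>2 * f x) * (LINT y|lborel. (inner y v)\<^sup>2 * g y) = (2 * pi) ^ DIM('a)"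
    then have "X = (2 * pi) ^ card B * (half_moment 2)\<^sup>2"
      using prod unfolding M dim[symmetric] by simp
    then obtain A A' \<beta> \<nu> where D: "dual_linear_maps B A A'" and \<beta>: "\<beta> > 0" and \<nu>: "\<nu> > 0"
      and Q: "\<And>x s. x \<in> span B \<Longrightarrow> s \<ge> 0 \<Longrightarrow> q (x + s *\<^sub>R b) = exp (- ((norm (A' x))\<^sup>2 + s\<^sup>2 / \<nu>) / 2) / \<beta>"
      using H(2) unfolding X_def by blast
    have linA: "linear A'" using D by (simp add: dual_linear_maps_def)
    \<comment> \<open>The half-space statement describes \<open>q\<close> for s \<ge> 0 only;
      evenness of \<open>q\<close> and of the quadratic form extends it to the other side.\<close>
    have QA: "q (x + s *\<^sub>R b) = exp (- ((norm (A' x))\<^sup>2 + s\<^sup>2 / \<nu>) / 2) / \<beta>" if x: "x \<in> span B" for x s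
    proof (cases "s \<ge> 0")
      case False
      have "q (x + s *\<^sub>R b) = q (- x + (- s) *\<^sub>R b)" using qeven[of "x + s *\<^sub>R b"] by simp
      then show ?thesis using Q[OF span_neg[OF x], of "- s"] False by (simp add: linear_neg[OF linA])
    qed (rule Q[OF x])
    define C where "C x = A (x - inner x b *\<^sub>R b) + (sqrt \<nu> * inner x b) *\<^sub>R b" for x
    define C' where "C' x = A' (x - inner x b *\<^sub>R b) + (inner x b / sqrt \<nu>) *\<^sub>R b" for x
    note CC = dual_linear_maps_insert[OF bB D \<nu>, folded C_def C'_def]
    have linC: "linear C'" using CC(1) by (simp add: dual_linear_maps_def)
    have qC: "q x = exp (- (norm (C' x))\<^sup>2 / 2) / \<beta>" for x
    proof -
      obtain y where v: "y \<in> span B" "x = y + inner x b *\<^sub>R b" using span_insert_cases[OF bB spanU[of x]] .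
      define s where "s = inner x b"
      have x: "x = y + s *\<^sub>R b" using v(2) by (simp add: s_def)
      show ?thesis unfolding x CC(3)[OF v(1)] QA[OF v(1)] by simp
    qed
    \<comment> \<open>The inverse of \<open>T'\<close>, which carries the Gaussian form of
      \<open>q\<close> back to g.\<close>
    define R where "R y = ds' w (sh' uB (axis_scale b (1 / c) y))" for y
    have linR: "linear R"
      unfolding R_def[abs_def]
      using linear_compose[OF linear_compose[OF linear_axis_scale[of b "1/c"] lin(3)[of uB]] lin(4)[of w]]
      by (simp add: o_def)
    have TR: "T' (R y) = y" for y
      unfolding T'_def R_def using inv[OF w] inv[OF uB(1)] axis_scale_inverse[OF bB c(2), of y] by simp
    have "g y = exp (- (norm (C' (R y)))\<^sup>2 / 2) / \<beta>" for y
      using qC[of "R y"] by (simp add: q_def TR)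
    moreover have "linear (\<lambda>y. C' (R y))" using linear_compose[OF linR linC] by (simp add: o_def)
    ultimately show "\<exists>(E :: 'a \<Rightarrow> 'a) \<beta>. linear E \<and> \<beta> > 0 \<and> (\<forall>y. g y = exp (- (norm (E y))\<^sup>2 / 2) / \<beta>)"
      using \<beta> by (intro exI[of _ "\<lambda>y. C' (R y)"] exI[of _ \<beta>]) auto
  qed
qed

section \<open>Gaussian integration by parts\<close>

text \<open>Bounds the difference quotients of the exponential uniformly in the step size, as
  dominated convergence requires.\<close>

lemma abs_exp_minus_one_le: "\<bar>exp t - 1\<bar> \<le> \<bar>t\<bar> * exp \<bar>t\<bar>" for t :: real
proof (cases "t \<ge> 0")
  case True
  have "1 - t \<le> exp (- t)" using exp_ge_add_one_self[of "- t"] by simp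
  then have "exp t * (1 - t) \<le> exp t * exp (- t)" by (rule mult_left_mono) simp
  then have "exp t - 1 \<le> t * exp t" by (simp add: algebra_simps flip: exp_add)
  then show ?thesis using True by simp
next
  case False
  have "1 + t \<le> exp t" by (rule exp_ge_add_one_self)
  moreover have "\<bar>exp t - 1\<bar> = 1 - exp t" using False by simp
  ultimately have "\<bar>exp t - 1\<bar> \<le> - t" by linarith
  also have "- t * 1 \<le> - t * exp (- t)" using False by (intro mult_left_mono) auto
  finally show ?thesis using False by simp
qed

text \<open>Gaussian integration by parts, obtained by differentiating translation invariance at \<open>0\<close>.\<close>

lemma gauss_integration_by_parts:
  fixes E :: "'a::euclidean_space \<Rightarrow> 'a"
  assumes E: "linear E" and gb: "gauss_bounded Basis (\<lambda>y. exp (- (norm (E y))\<^sup>2 / 2))"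
  shows "(LINT y|lborel. inner y w * (inner (E y) (E v) * exp (- (norm (E y))\<^sup>2 / 2)))
    = inner w v * (LINT y|lborel. exp (- (norm (E y))\<^sup>2 / 2))"
proof -
  define G where "G y = exp (- (norm (E y))\<^sup>2 / 2)" for y
  define a where "a y = inner (E y) (E v)" for y
  have B: "finite (Basis :: 'a set)" "(Basis :: 'a set) \<subseteq> Basis" by auto
  have gb: "gauss_bounded Basis G" using gb by (simp add: G_def[abs_def])
  note [measurable] = gauss_boundedD(1)[OF gb]
  have [measurable]: "E \<in> borel_measurable borel"
    using E by (intro borel_measurable_continuous_onI linear_continuous_on) (simp add: linear_conv_bounded_linear)
  have [measurable]: "a \<in> borel_measurable borel" unfolding a_def[abs_def] by measurable
  have iG: "integrable lborel G" using integrable_gauss_bounded[OF B gb] by (simp add: span_lborel_Basis)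
  have iw: "integrable lborel (\<lambda>y. inner y w * G y)"
    using integrable_gauss_bounded[OF B gauss_bounded_inner[OF gb]] by (simp add: span_lborel_Basis)
  have "(LINT y|lborel. inner (- y) w * G (- y)) = (LINT y|lborel. inner y w * G y)"
    using integral_span_lborel_uminus[OF B(1), of "\<lambda>y. inner y w * G y"] by (simp add: span_lborel_Basis)
  then have w0: "(LINT y|lborel. inner y w * G y) = 0"
    by (simp add: G_def linear_neg[OF E])
  define K where "K = (norm (E v))\<^sup>2"
  define m where "m = (LINT y|lborel. G y)"
  obtain k where k: "k > 0" "\<And>y. norm (E y) \<le> k * norm y" using linear_bounded_pos[OF E] by blast
  define l where "l = k * norm (E v)"
  have al: "\<bar>a y\<bar> \<le> l * norm y" for y
  proof -
    have "\<bar>a y\<bar> \<le> norm (E y) * norm (E v)" unfolding a_def by (rule Cauchy_Schwarz_ineq2)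
    also have "\<dots> \<le> (k * norm y) * norm (E v)" by (intro mult_right_mono k) simp
    finally show ?thesis by (simp add: l_def mult_ac)
  qed
  have le_exp: "t \<le> exp t" for t :: real using exp_ge_add_one_self[of t] by linarith
  \<comment> \<open>Dominates the difference quotients for all steps in (0, 1]. It grows at most
    exponentially in |y|, so the Gaussian factor makes it integrable.\<close>
  define W where "W y = \<bar>inner y w\<bar> * (\<bar>a y\<bar> * exp \<bar>a y\<bar>)" for y
  have Wbd: "\<bar>W y\<bar> \<le> 1 * exp ((norm w + 2 * l) * norm y)" for y
  proof -
    have "\<bar>inner y w\<bar> \<le> exp (norm w * norm y)"
      using Cauchy_Schwarz_ineq2[of y w] le_exp[of "norm w * norm y"] by (simp add: mult.commute)
    moreover have "\<bar>a y\<bar> * exp \<bar>a y\<bar> \<le> exp (l * norm y) * exp (l * norm y)"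
    proof (rule mult_mono)
      show "\<bar>a y\<bar> \<le> exp (l * norm y)" using al[of y] le_exp[of "l * norm y"] by linarith
    qed (use al[of y] in auto)
    ultimately have "W y \<le> exp (norm w * norm y) * (exp (l * norm y) * exp (l * norm y))"
      unfolding W_def by (rule mult_mono) auto
    then show ?thesis by (simp add: W_def algebra_simps flip: exp_add)
  qed
  have [measurable]: "W \<in> borel_measurable borel" unfolding W_def[abs_def] by measurable
  have iW: "integrable lborel (\<lambda>y. W y * G y)"
    using integrable_gauss_bounded_mult[OF B gb, of W 1 "norm w + 2 * l"] Wbd by (simp add: span_lborel_Basis)
  have bd: "\<bar>(exp (- s * a y) - 1) / s\<bar> \<le> \<bar>a y\<bar> * exp \<bar>a y\<bar>" if s: "s > 0" "s \<le> 1" for s y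
  proof -
    have "\<bar>exp (- s * a y) - 1\<bar> \<le> s * \<bar>a y\<bar> * exp (s * \<bar>a y\<bar>)"
      using abs_exp_minus_one_le[of "- s * a y"] s by (simp add: abs_mult)
    also have "\<dots> \<le> s * \<bar>a y\<bar> * exp \<bar>a y\<bar>"
      using s by (intro mult_left_mono) (auto intro!: mult_left_le_one_le)
    finally show ?thesis using s by (simp add: abs_divide divide_le_eq mult_ac)
  qed
  \<comment> \<open>The integral of the quotient is computed exactly before any limit: the
    translated Gaussian is G y * exp (- s * a y) * exp (- s^2 * K / 2), while translation
    invariance, with the odd first moment equal to 0, evaluates its integral against <y, w>.\<close>
  have quot: "(LINT y|lborel. inner y w * (((exp (- s * a y) - 1) / s) * G y)) = - inner v w * m * exp (s\<^sup>2 * K / 2)"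
    if s: "s > 0" "s \<le> 1" for s
  proof -
    have iq: "integrable lborel (\<lambda>y. inner y w * (((exp (- s * a y) - 1) / s) * G y))"
    proof (rule Bochner_Integration.integrable_bound[OF iW])
      show "AE y in lborel. norm (inner y w * (((exp (- s * a y) - 1) / s) * G y)) \<le> norm (W y * G y)"
      proof (rule AE_I2)
        fix y
        have "\<bar>inner y w\<bar> * (\<bar>(exp (- s * a y) - 1) / s\<bar> * \<bar>G y\<bar>) \<le> \<bar>inner y w\<bar> * ((\<bar>a y\<bar> * exp \<bar>a y\<bar>) * \<bar>G y\<bar>)"
          by (intro mult_left_mono mult_right_mono bd s) auto
        then show "norm (inner y w * (((exp (- s * a y) - 1) / s) * G y)) \<le> norm (W y * G y)"
          unfolding W_def by (simp only: real_norm_def abs_mult abs_abs abs_exp_cancel mult.assoc)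
      qed
    qed measurable
    have Gs: "G (y + s *\<^sub>R v) = G y * exp (- s * a y) * exp (- (s\<^sup>2 * K / 2))" for y
    proof -
      have "(norm (E (y + s *\<^sub>R v)))\<^sup>2 = (norm (E y))\<^sup>2 + 2 * (s * a y) + s\<^sup>2 * K"
        unfolding K_def a_def power2_norm_eq_inner linear_add[OF E] linear_scale[OF E]
        by (simp add: inner_add_left inner_add_right inner_commute power2_eq_square)
      then have "- (norm (E (y + s *\<^sub>R v)))\<^sup>2 / 2 = - (norm (E y))\<^sup>2 / 2 + - s * a y + - (s\<^sup>2 * K / 2)"
        by (simp add: field_simps)
      then show ?thesis by (simp only: G_def exp_add)
    qed
    have "(LINT y|lborel. inner y w * G (y + s *\<^sub>R v)) = (LINT y|lborel. (\<lambda>y. (inner y w - s * inner v w) * G y) (y + s *\<^sub>R v))"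
      by (simp add: inner_add_left)
    also have "\<dots> = (LINT y|lborel. (inner y w - s * inner v w) * G y)"
      using integral_span_lborel_translate[OF B(1), of "s *\<^sub>R v" "\<lambda>y. (inner y w - s * inner v w) * G y"]
      by (simp add: span_lborel_Basis)
    also have "\<dots> = - s * inner v w * m"
      using iG iw w0 by (simp add: left_diff_distrib m_def)
    finally have 1: "(LINT y|lborel. inner y w * G (y + s *\<^sub>R v)) = - s * inner v w * m" .
    define d where "d y = inner y w * (((exp (- s * a y) - 1) / s) * G y)" for y
    have "inner y w * G (y + s *\<^sub>R v) = exp (- (s\<^sup>2 * K / 2)) * (s * d y + inner y w * G y)" for y
      unfolding Gs d_def using s by (simp add: field_simps)
    then have "(LINT y|lborel. inner y w * G (y + s *\<^sub>R v)) = exp (- (s\<^sup>2 * K / 2)) * (s * (LINT y|lborel. d y))"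
      using iq[folded d_def] iw w0 by simp
    with 1 have "exp (s\<^sup>2 * K / 2) * (exp (- (s\<^sup>2 * K / 2)) * (s * (LINT y|lborel. d y)))
        = exp (s\<^sup>2 * K / 2) * (- s * inner v w * m)" by simp
    then have "s * (LINT y|lborel. d y) = s * (- inner v w * m * exp (s\<^sup>2 * K / 2))"
      by (simp add: mult_ac flip: mult.assoc exp_add)
    then have "(LINT y|lborel. d y) = - inner v w * m * exp (s\<^sup>2 * K / 2)"
      using s by (simp only: mult_cancel_left) simp
    then show ?thesis by (simp only: d_def)
  qed
  define s where "s n = 1 / real (Suc n)" for n
  have s: "s n > 0" "s n \<le> 1" for n by (auto simp: s_def)
  have s0: "s \<longlonglongrightarrow> 0" unfolding s_def[abs_def] using LIMSEQ_inverse_real_of_nat by (simp add: inverse_eq_divide)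
  have "(\<lambda>n. LINT y|lborel. inner y w * (((exp (- s n * a y) - 1) / s n) * G y)) \<longlonglongrightarrow> (LINT y|lborel. inner y w * (- a y * G y))"
  proof (rule integral_dominated_convergence[OF _ _ iW])
    show "AE y in lborel. (\<lambda>n. inner y w * (((exp (- s n * a y) - 1) / s n) * G y)) \<longlonglongrightarrow> inner y w * (- a y * G y)"
    proof (rule AE_I2, intro tendsto_mult_left tendsto_mult_right)
      fix y
      have "((\<lambda>t. exp (- t * a y)) has_real_derivative - a y) (at 0)"
        by (auto intro!: derivative_eq_intros)
      then have "(\<lambda>t. (exp (- t * a y) - exp (- 0 * a y)) / (t - 0)) \<midarrow>0\<rightarrow> - a y"
        unfolding has_field_derivative_iff .
      then have "(\<lambda>t. (exp (- t * a y) - 1) / t) \<midarrow>0\<rightarrow> - a y" by simp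
      moreover have "filterlim s (at 0) sequentially"
        using s0 s by (auto simp: filterlim_at intro!: always_eventually less_imp_neq[THEN not_sym])
      ultimately show "(\<lambda>n. (exp (- s n * a y) - 1) / s n) \<longlonglongrightarrow> - a y"
        by (rule filterlim_compose)
    qed
    show "AE y in lborel. norm (inner y w * (((exp (- s n * a y) - 1) / s n) * G y)) \<le> W y * G y" for n
    proof (rule AE_I2)
      fix y
      have "\<bar>inner y w\<bar> * (\<bar>(exp (- s n * a y) - 1) / s n\<bar> * G y) \<le> \<bar>inner y w\<bar> * ((\<bar>a y\<bar> * exp \<bar>a y\<bar>) * G y)"
        by (intro mult_left_mono mult_right_mono bd s) (auto simp: G_def)
      moreover have "\<bar>G y\<bar> = G y" by (simp add: G_def)
      ultimately show "norm (inner y w * (((exp (- s n * a y) - 1) / s n) * G y)) \<le> W y * G y"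
        unfolding W_def by (simp only: real_norm_def abs_mult mult.assoc)
    qed
  qed measurable
  moreover have "(\<lambda>n. LINT y|lborel. inner y w * (((exp (- s n * a y) - 1) / s n) * G y)) \<longlonglongrightarrow> - inner v w * m * exp (0\<^sup>2 * K / 2)"
    unfolding quot[OF s] by (intro tendsto_intros s0) simp
  ultimately have "(LINT y|lborel. inner y w * (- a y * G y)) = - inner v w * m * exp (0\<^sup>2 * K / 2)"
    by (rule LIMSEQ_unique)
  then show ?thesis by (simp add: a_def m_def inner_commute G_def)
qed

section \<open>Layer-cake formula for second moments\<close>

lemma nn_integral_lborel_scaleR:
  fixes F :: "'a::euclidean_space \<Rightarrow> ennreal"
  assumes [measurable]: "F \<in> borel_measurable borel" and r: "r > 0"
  shows "(\<integral>\<^sup>+x. F x \<partial>lborel) = ennreal (r ^ DIM('a)) * (\<integral>\<^sup>+x. F (r *\<^sub>R x) \<partial>lborel)"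
  by (subst lborel_affine[of r 0])
    (use r in \<open>simp_all add: nn_integral_density nn_integral_distr nn_integral_cmult\<close>)

text \<open>Of the exponent, the dimension comes from the Jacobian and the 2 from the quadratic
  weight.\<close>

lemma nn_integral_sublevel_scale:
  fixes h :: "'a::euclidean_space \<Rightarrow> real"
  assumes [measurable]: "h \<in> borel_measurable borel" and hom: "\<And>t x. t > 0 \<Longrightarrow> h (t *\<^sub>R x) = t * h x" and r: "r > 0"
  shows "(\<integral>\<^sup>+x. ennreal ((inner x u)\<^sup>2) * indicator {x. h x \<le> r} x \<partial>lborel)
    = ennreal (r ^ (DIM('a) + 2)) * (\<integral>\<^sup>+x. ennreal ((inner x u)\<^sup>2) * indicator {x. h x \<le> 1} x \<partial>lborel)"
proof -
  have "(\<integral>\<^sup>+x. ennreal ((inner x u)\<^sup>2) * indicator {x. h x \<le> r} x \<partial>lborel)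
     = ennreal (r ^ DIM('a)) * (\<integral>\<^sup>+x. ennreal ((inner (r *\<^sub>R x) u)\<^sup>2) * indicator {x. h x \<le> r} (r *\<^sub>R x) \<partial>lborel)"
    by (rule nn_integral_lborel_scaleR[OF _ r]) measurable
  also have "(\<integral>\<^sup>+x. ennreal ((inner (r *\<^sub>R x) u)\<^sup>2) * indicator {x. h x \<le> r} (r *\<^sub>R x) \<partial>lborel)
     = (\<integral>\<^sup>+x. ennreal (r\<^sup>2) * (ennreal ((inner x u)\<^sup>2) * indicator {x. h x \<le> 1} x) \<partial>lborel)"
    by (rule nn_integral_cong) (use r in \<open>auto simp: hom indicator_def power_mult_distrib ennreal_mult\<close>)
  also have "\<dots> = ennreal (r\<^sup>2) * (\<integral>\<^sup>+x. ennreal ((inner x u)\<^sup>2) * indicator {x. h x \<le> 1} x \<partial>lborel)"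
    by (rule nn_integral_cmult) measurable
  finally have "(\<integral>\<^sup>+x. ennreal ((inner x u)\<^sup>2) * indicator {x. h x \<le> r} x \<partial>lborel)
    = ennreal (r ^ DIM('a)) * (ennreal (r\<^sup>2) * (\<integral>\<^sup>+x. ennreal ((inner x u)\<^sup>2) * indicator {x. h x \<le> 1} x \<partial>lborel))" .
  moreover have "ennreal (r ^ (DIM('a) + 2)) = ennreal (r ^ DIM('a)) * ennreal (r\<^sup>2)"
    by (subst ennreal_mult[symmetric]) (use r in \<open>auto simp: power_add power2_eq_square\<close>)
  ultimately show ?thesis by (simp only: mult.assoc)
qed

text \<open>Writes exp (- c^2 / 2) as a superposition of indicators of c \<le> r with density r *
  exp (- r^2 / 2), so a Gaussian in h becomes a mixture of sublevel sets of h.\<close>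

lemma nn_integral_gauss_tail:
  assumes "c \<ge> 0"
  shows "(\<integral>\<^sup>+r. ennreal (half_power 1 r * exp (- r\<^sup>2 / 2)) * indicator {c..} r \<partial>lborel) = ennreal (exp (- c\<^sup>2 / 2))"
proof -
  have "(\<integral>\<^sup>+r. ennreal (half_power 1 r * exp (- r\<^sup>2 / 2)) * indicator {c..} r \<partial>lborel)
     = (\<integral>\<^sup>+r. ennreal (r * exp (- r\<^sup>2 / 2)) * indicator {c..} r \<partial>lborel)"
    using assms by (intro nn_integral_cong) (auto simp: indicator_def half_power_def)
  also have "\<dots> = ennreal (0 - - exp (- c\<^sup>2 / 2))"
  proof (rule nn_integral_FTC_atLeast)
    show "((\<lambda>r. - exp (- r\<^sup>2 / 2)) has_real_derivative r * exp (- r\<^sup>2 / 2)) (at r)" for r :: real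
      by (auto intro!: derivative_eq_intros)
    show "((\<lambda>r::real. - exp (- r\<^sup>2 / 2)) \<longlongrightarrow> 0) at_top"
      by real_asymp
  qed (use assms in auto)
  finally show ?thesis by simp
qed

text \<open>The layer density contributes one power of r and scaling the sublevel set contributes
  DIM + 2, hence \<open>half_moment (DIM('a) + 3)\<close>. This constant does not depend on h, so
  one conversion factor serves a body, its polar and the ball.\<close>

lemma moment_layer_cake:
  fixes h :: "'a::euclidean_space \<Rightarrow> real"
  assumes [measurable]: "h \<in> borel_measurable borel" and hom: "\<And>t x. t > 0 \<Longrightarrow> h (t *\<^sub>R x) = t * h x" and nn: "\<And>x. h x \<ge> 0"
  shows "(LINT x|lborel. (inner x u)\<^sup>2 * exp (- (h x)\<^sup>2 / 2)) = half_moment (DIM('a) + 3) * (LINT x:{x. h x \<le> 1}|lborel. (inner x u)\<^sup>2)"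
proof -
  define I where "I r = (\<integral>\<^sup>+x. ennreal ((inner x u)\<^sup>2) * indicator {x. h x \<le> r} x \<partial>lborel)" for r
  have "(\<integral>\<^sup>+x. ennreal ((inner x u)\<^sup>2 * exp (- (h x)\<^sup>2 / 2)) \<partial>lborel)
     = (\<integral>\<^sup>+x. ennreal ((inner x u)\<^sup>2) * (\<integral>\<^sup>+r. ennreal (half_power 1 r * exp (- r\<^sup>2 / 2)) * indicator {h x..} r \<partial>lborel) \<partial>lborel)"
    by (rule nn_integral_cong) (subst nn_integral_gauss_tail[OF nn], simp add: ennreal_mult)
  also have "\<dots> = (\<integral>\<^sup>+x. \<integral>\<^sup>+r. ennreal ((inner x u)\<^sup>2) * (ennreal (half_power 1 r * exp (- r\<^sup>2 / 2)) * indicator {h x..} r) \<partial>lborel \<partial>lborel)"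
    by (intro nn_integral_cong nn_integral_cmult[symmetric]) measurable
  also have "\<dots> = (\<integral>\<^sup>+x. \<integral>\<^sup>+r. ennreal (half_power 1 r * exp (- r\<^sup>2 / 2)) * (ennreal ((inner x u)\<^sup>2) * indicator {x. h x \<le> r} x) \<partial>lborel \<partial>lborel)"
    by (intro nn_integral_cong) (auto simp: indicator_def mult_ac)
  also have "\<dots> = (\<integral>\<^sup>+r. \<integral>\<^sup>+x. ennreal (half_power 1 r * exp (- r\<^sup>2 / 2)) * (ennreal ((inner x u)\<^sup>2) * indicator {x. h x \<le> r} x) \<partial>lborel \<partial>lborel)"
    by (rule lborel_pair.Fubini') measurable
  also have "\<dots> = (\<integral>\<^sup>+r. ennreal (half_power 1 r * exp (- r\<^sup>2 / 2)) * I r \<partial>lborel)"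
    unfolding I_def by (intro nn_integral_cong nn_integral_cmult) measurable
  also have "\<dots> = (\<integral>\<^sup>+r. ennreal (half_power (DIM('a) + 3) r * exp (- r\<^sup>2 / 2)) * I 1 \<partial>lborel)"
  proof (rule nn_integral_cong)
    fix r :: real
    show "ennreal (half_power 1 r * exp (- r\<^sup>2 / 2)) * I r = ennreal (half_power (DIM('a) + 3) r * exp (- r\<^sup>2 / 2)) * I 1"
    proof (cases "r > 0")
      case True
      have "half_power (DIM('a) + 3) r * exp (- r\<^sup>2 / 2) = (half_power 1 r * exp (- r\<^sup>2 / 2)) * r ^ (DIM('a) + 2)"
        using True by (simp add: half_power_def numeral_3_eq_3 numeral_2_eq_2)
      then have "ennreal (half_power (DIM('a) + 3) r * exp (- r\<^sup>2 / 2))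
          = ennreal (half_power 1 r * exp (- r\<^sup>2 / 2)) * ennreal (r ^ (DIM('a) + 2))"
        by (subst ennreal_mult[symmetric]) (use True in auto)
      moreover have "I r = ennreal (r ^ (DIM('a) + 2)) * I 1"
        unfolding I_def by (rule nn_integral_sublevel_scale[OF assms(1) hom True])
      ultimately show ?thesis by (simp only: mult.assoc)
    qed (simp add: half_power_def)
  qed
  also have "\<dots> = (\<integral>\<^sup>+r. ennreal (half_power (DIM('a) + 3) r * exp (- r\<^sup>2 / 2)) \<partial>lborel) * I 1"
    by (rule nn_integral_multc) measurable
  finally have eq: "(\<integral>\<^sup>+x. ennreal ((inner x u)\<^sup>2 * exp (- (h x)\<^sup>2 / 2)) \<partial>lborel)
     = (\<integral>\<^sup>+r. ennreal (half_power (DIM('a) + 3) r * exp (- r\<^sup>2 / 2)) \<partial>lborel) * I 1" .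
  have "(LINT x|lborel. (inner x u)\<^sup>2 * exp (- (h x)\<^sup>2 / 2)) = enn2real (\<integral>\<^sup>+x. ennreal ((inner x u)\<^sup>2 * exp (- (h x)\<^sup>2 / 2)) \<partial>lborel)"
    by (rule integral_eq_nn_integral) auto
  moreover have "half_moment (DIM('a) + 3) = enn2real (\<integral>\<^sup>+r. ennreal (half_power (DIM('a) + 3) r * exp (- r\<^sup>2 / 2)) \<partial>lborel)"
    unfolding half_moment_def by (rule integral_eq_nn_integral) auto
  moreover have "(LINT x:{x. h x \<le> 1}|lborel. (inner x u)\<^sup>2) = enn2real (I 1)"
    unfolding set_lebesgue_integral_def I_def
    by (subst integral_eq_nn_integral) (auto simp: indicator_def intro!: arg_cong[where f = enn2real] nn_integral_cong)
  ultimately show ?thesis unfolding eq by (simp add: enn2real_mult)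
qed

lemma moment_sublevel_scale:
  fixes h :: "'a::euclidean_space \<Rightarrow> real"
  assumes [measurable]: "h \<in> borel_measurable borel" and hom: "\<And>t x. t > 0 \<Longrightarrow> h (t *\<^sub>R x) = t * h x" and r: "r > 0"
  shows "(LINT x:{x. h x \<le> r}|lborel. (inner x u)\<^sup>2) = r ^ (DIM('a) + 2) * (LINT x:{x. h x \<le> 1}|lborel. (inner x u)\<^sup>2)"
proof -
  have "(LINT x:{x. h x \<le> t}|lborel. (inner x u)\<^sup>2)
      = enn2real (\<integral>\<^sup>+x. ennreal ((inner x u)\<^sup>2) * indicator {x. h x \<le> t} x \<partial>lborel)" for t
    unfolding set_lebesgue_integral_def
    by (subst integral_eq_nn_integral) (auto simp: indicator_def intro!: arg_cong[where f = enn2real] nn_integral_cong)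
  then show ?thesis
    unfolding nn_integral_sublevel_scale[OF assms] using r by (simp add: nn_integral_sublevel_scale[OF assms] enn2real_mult)
qed

section \<open>Support functions and polar bodies\<close>

text \<open>Applied to the polar body this is the gauge of the original body, so one notion covers
  both functions of the argument.\<close>

definition support_function :: "'a::euclidean_space set \<Rightarrow> 'a \<Rightarrow> real" where
  "support_function K x = (SUP y\<in>K. inner x y)"

text \<open>For a ball around an interior point x, symmetry adds the opposite ball, and z is the
  midpoint of x + z and - (x - z).\<close>

lemma symmetric_convex_body_contains_ball:
  fixes K :: "'a::euclidean_space set"
  assumes "convex_body K" "symmetric_set K"
  obtains \<rho> where "\<rho> > 0" "cball 0 \<rho> \<subseteq> K"
proof -
  obtain x where "x \<in> interior K" using assms(1) by (auto simp: convex_body_def)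
  then obtain e where e: "e > 0" "cball x e \<subseteq> K" using mem_interior_cball by blast
  have "convex K" using assms(1) by (simp add: convex_body_def)
  have "z \<in> K" if "norm z \<le> e" for z
  proof -
    have "x + z \<in> K" "x - z \<in> K" using e(2) that by (auto simp: subset_iff dist_norm)
    then have "- (x - z) \<in> K" using assms(2) unfolding symmetric_set_def by blast
    with \<open>x + z \<in> K\<close> \<open>convex K\<close> have "(1/2) *\<^sub>R (x + z) + (1/2) *\<^sub>R (- (x - z)) \<in> K"
      by (intro convexD) auto
    also have "(1/2) *\<^sub>R (x + z) + (1/2) *\<^sub>R (- (x - z)) = z"
      by (simp add: algebra_simps flip: scaleR_add_left)
    finally show ?thesis .
  qed
  then have "cball 0 e \<subseteq> K" by auto
  with e(1) that show ?thesis by blast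
qed

context
  fixes K :: "'a::euclidean_space set"
  assumes K: "convex_body K" "symmetric_set K"
begin

lemma convex_body_bounded: "bounded K"
  using K(1) by (simp add: convex_body_def compact_imp_bounded)

lemma zero_mem_convex_body: "0 \<in> K"
proof -
  obtain \<rho> where "\<rho> > 0" "cball 0 \<rho> \<subseteq> K" using symmetric_convex_body_contains_ball[OF K] .
  then show ?thesis by (intro subsetD[of "cball 0 \<rho>" K]) auto
qed

lemma support_function_bdd: "bdd_above ((\<lambda>y. inner x y) ` K)"
proof -
  obtain R where R: "\<And>y. y \<in> K \<Longrightarrow> norm y \<le> R" using convex_body_bounded by (auto simp: bounded_iff)
  have "inner x y \<le> norm x * R" if "y \<in> K" for y
    using norm_cauchy_schwarz[of x y] mult_left_mono[OF R[OF that] norm_ge_zero[of x]] by linarith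
  then show ?thesis by (auto intro!: bdd_aboveI[of _ "norm x * R"])
qed

lemma inner_le_support_function: "y \<in> K \<Longrightarrow> inner x y \<le> support_function K x"
  unfolding support_function_def by (rule cSUP_upper[OF _ support_function_bdd])

lemma support_function_le_iff: "support_function K x \<le> c \<longleftrightarrow> (\<forall>y\<in>K. inner x y \<le> c)"
  unfolding support_function_def
  using zero_mem_convex_body by (intro cSUP_le_iff support_function_bdd) auto

lemma polar_body_eq_sublevel: "polar_body K = {x. support_function K x \<le> 1}"
  by (auto simp: polar_body_def support_function_le_iff)

lemma support_function_nonneg: "support_function K x \<ge> 0"
  using inner_le_support_function[OF zero_mem_convex_body, of x] by simp

lemma support_function_scale:
  assumes "t > 0" shows "support_function K (t *\<^sub>R x) = t * support_function K x"
proof (rule antisym)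
  show "support_function K (t *\<^sub>R x) \<le> t * support_function K x"
    using assms by (auto simp: support_function_le_iff intro: inner_le_support_function)
  have "support_function K x \<le> support_function K (t *\<^sub>R x) / t"
    unfolding support_function_le_iff
    using assms inner_le_support_function[of _ "t *\<^sub>R x"] by (auto simp: pos_le_divide_eq mult.commute)
  then show "t * support_function K x \<le> support_function K (t *\<^sub>R x)"
    using assms by (simp add: pos_le_divide_eq mult.commute)
qed

lemma support_function_minus: "support_function K (- x) = support_function K x"
proof -
  have "support_function K (- x) \<le> support_function K x" for x
    unfolding support_function_le_iff
  proof
    fix y assume "y \<in> K"
    then have "- y \<in> K" using K(2) unfolding symmetric_set_def by blast
    then show "inner (- x) y \<le> support_function K x" using inner_le_support_function[of "- y" x] by simp
  qed
  from this[of x] this[of "- x"] show ?thesis by simp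
qed

lemma support_function_lower:
  obtains \<rho> where "\<rho> > 0" "\<And>x. \<rho> * norm x \<le> support_function K x"
proof -
  obtain \<rho> where \<rho>: "\<rho> > 0" "cball 0 \<rho> \<subseteq> K" using symmetric_convex_body_contains_ball[OF K] .
  have "\<rho> * norm x \<le> support_function K x" for x
  proof (cases "x = 0")
    case False
    have "(\<rho> / norm x) *\<^sub>R x \<in> K" using \<rho> False by (intro subsetD[OF \<rho>(2)]) simp
    from inner_le_support_function[OF this, of x] show ?thesis
      using False by (simp add: power2_norm_eq_inner[symmetric] power2_eq_square)
  qed (use support_function_nonneg in simp)
  with \<rho>(1) that show ?thesis by blast
qed

lemma continuous_on_support_function: "continuous_on S (support_function K)"
proof -
  obtain R where R: "R > 0" "\<And>y. y \<in> K \<Longrightarrow> norm y \<le> R" using convex_body_bounded by (auto simp: bounded_pos)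
  have le: "support_function K x \<le> support_function K y + R * norm (x - y)" for x y
    unfolding support_function_le_iff
  proof
    fix z assume z: "z \<in> K"
    have "inner x z = inner y z + inner (x - y) z" by (simp add: inner_diff_left)
    moreover have "inner (x - y) z \<le> norm (x - y) * R"
      using norm_cauchy_schwarz[of "x - y" z] mult_left_mono[OF R(2)[OF z] norm_ge_zero[of "x - y"]] by linarith
    ultimately show "inner x z \<le> support_function K y + R * norm (x - y)"
      using inner_le_support_function[OF z, of y] by (simp add: mult.commute)
  qed
  show ?thesis
  proof (rule lipschitz_on_continuous_on)
    show "R-lipschitz_on S (support_function K)"
    proof (rule lipschitz_onI)
      show "dist (support_function K x) (support_function K y) \<le> R * dist x y" for x y
        using le[of x y] le[of y x] by (simp add: dist_norm norm_minus_commute abs_le_iff)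
    qed (use R in simp)
  qed
qed

lemma borel_measurable_support_function: "support_function K \<in> borel_measurable borel"
  by (rule borel_measurable_continuous_onI[OF continuous_on_support_function])

text \<open>A ball inside the body bounds the support function below by a multiple of the norm, and
  this is the required decay.\<close>

lemma gauss_bounded_support_function: "gauss_bounded Basis (\<lambda>x. exp (- (support_function K x)\<^sup>2 / 2))"
proof -
  obtain \<rho> where \<rho>: "\<rho> > 0" "\<And>x. \<rho> * norm x \<le> support_function K x" using support_function_lower by blast
  have "\<bar>exp (- (support_function K x)\<^sup>2 / 2)\<bar> \<le> 1 * exp (- (\<rho>\<^sup>2 / 2) * (norm x)\<^sup>2)" for x
    using power_mono[OF \<rho>(2)[of x], of 2] \<rho>(1) by (simp add: power_mult_distrib)
  moreover have "\<rho>\<^sup>2 / 2 > 0" using \<rho>(1) by simp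
  ultimately have "\<exists>C e. e > 0 \<and> (\<forall>x\<in>span Basis. \<bar>exp (- (support_function K x)\<^sup>2 / 2)\<bar> \<le> C * exp (- e * (norm x)\<^sup>2))"
    by blast
  moreover note [measurable] = borel_measurable_support_function
  ultimately show ?thesis
    unfolding gauss_bounded_def by (intro conjI continuous_intros continuous_on_support_function) auto
qed

lemma polar_polar_body: "polar_body (polar_body K) = K"
proof
  show "K \<subseteq> polar_body (polar_body K)" by (auto simp: polar_body_def inner_commute)
  show "polar_body (polar_body K) \<subseteq> K"
  proof
    fix z assume z: "z \<in> polar_body (polar_body K)"
    show "z \<in> K"
    proof (rule ccontr)
      assume "z \<notin> K"
      moreover have "convex K" "closed K" using K(1) by (auto simp: convex_body_def compact_imp_closed)
      ultimately obtain a \<beta> where a: "inner a z < \<beta>" "\<forall>x\<in>K. \<beta> < inner a x"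
        using separating_hyperplane_closed_point[of K z] by blast
      \<comment> \<open>Since 0 lies in \<open>K\<close>, the separating level is negative. Dividing
        the normal by it reverses the inequalities: the quotient belongs to the polar body and takes
        a value above 1 at z.\<close>
      have \<beta>: "\<beta> < 0" using a(2) zero_mem_convex_body by force
      have "(1 / \<beta>) *\<^sub>R a \<in> polar_body K"
        unfolding polar_body_def
      proof (clarify)
        fix y assume "y \<in> K"
        then have "\<beta> < inner a y" using a(2) by blast
        then show "inner ((1 / \<beta>) *\<^sub>R a) y \<le> 1" using \<beta> by (simp add: divide_le_eq)
      qed
      then have "inner z ((1 / \<beta>) *\<^sub>R a) \<le> 1" using z unfolding polar_body_def[of "polar_body K"] by blast
      then show False using a(1) \<beta> by (simp add: divide_le_eq inner_commute)
    qed
  qed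
qed

end

text \<open>Cauchy-Schwarz for the gauge of K and its dual norm: y divided by its support value lies
  in the polar body. With s * t \<le> (s^2 + t^2) / 2 it yields the duality bound for the two
  functions.\<close>

lemma inner_le_support_function_mult:
  fixes K :: "'a::euclidean_space set"
  assumes K: "convex_body K" "symmetric_set K" and P: "convex_body (polar_body K)" "symmetric_set (polar_body K)"
  shows "inner x y \<le> support_function (polar_body K) x * support_function K y"
proof (cases "y = 0")
  case True
  then show ?thesis using support_function_nonneg[OF K] support_function_nonneg[OF P] by simp
next
  case False
  obtain \<rho> where \<rho>: "\<rho> > 0" "\<And>x. \<rho> * norm x \<le> support_function K x" using support_function_lower[OF K] by blast
  define h where "h = support_function K y"
  have "0 < \<rho> * norm y" using \<rho>(1) False by simp
  then have h: "h > 0" unfolding h_def using \<rho>(2)[of y] by linarith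
  have "(1 / h) *\<^sub>R y \<in> polar_body K"
    unfolding polar_body_eq_sublevel[OF K] using support_function_scale[OF K, of "1 / h" y] h by (simp add: h_def)
  from inner_le_support_function[OF P this, of x]
  show ?thesis using h by (simp add: h_def pos_divide_le_eq)
qed

lemma polar_body_cball:
  fixes r :: real
  assumes r: "r > 0"
  shows "polar_body (cball 0 r) = (cball 0 (1 / r) :: 'a::euclidean_space set)"
proof (intro set_eqI iffI)
  fix x :: 'a assume x: "x \<in> polar_body (cball 0 r)"
  show "x \<in> cball 0 (1 / r)"
  proof (cases "x = 0")
    case False
    have "(r / norm x) *\<^sub>R x \<in> cball 0 r" using r False by simp
    then have "inner x ((r / norm x) *\<^sub>R x) \<le> 1" using x unfolding polar_body_def by blast
    then have "r * norm x \<le> 1" using False by (simp add: power2_norm_eq_inner[symmetric] power2_eq_square)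
    then show ?thesis using r by (simp add: pos_le_divide_eq mult.commute)
  qed (use r in simp)
next
  fix x :: 'a assume "x \<in> cball 0 (1 / r)"
  then have x: "norm x * r \<le> 1" using r by (simp add: pos_le_divide_eq)
  show "x \<in> polar_body (cball 0 r)"
    unfolding polar_body_def
  proof (clarify)
    fix y :: 'a assume "y \<in> cball 0 r"
    then have "norm x * norm y \<le> norm x * r" by (intro mult_left_mono) auto
    then show "inner x y \<le> 1" using norm_cauchy_schwarz[of x y] x by linarith
  qed
qed

section \<open>Isotropy, the equality case and the conclusion\<close>

text \<open>Integration by parts with the identity map reduces the second moment to the total mass
  of the Gaussian.\<close>

lemma gauss_moment:
  fixes u :: "'a::euclidean_space"
  shows "(LINT x|lborel. (inner x u)\<^sup>2 * exp (- (norm x)\<^sup>2 / 2)) = (norm u)\<^sup>2 * sqrt (2 * pi) ^ DIM('a)"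
proof -
  have gb: "gauss_bounded Basis (\<lambda>y::'a. exp (- (norm y)\<^sup>2 / 2))"
    unfolding gauss_bounded_def
  proof (intro conjI)
    show "\<exists>C e. e > 0 \<and> (\<forall>y\<in>span Basis. \<bar>exp (- (norm (y::'a))\<^sup>2 / 2)\<bar> \<le> C * exp (- e * (norm y)\<^sup>2))"
      by (rule exI[of _ 1], rule exI[of _ "1/2"]) simp
  qed (auto intro!: continuous_intros)
  have "(LINT x|lborel. (inner x u)\<^sup>2 * exp (- (norm x)\<^sup>2 / 2)) = inner u u * (LINT y::'a|lborel. exp (- (norm y)\<^sup>2 / 2))"
    using gauss_integration_by_parts[OF linear_ident gb, of u u] by (simp add: power2_eq_square mult.assoc)
  also have "(LINT y::'a|lborel. exp (- (norm y)\<^sup>2 / 2)) = sqrt (2 * pi) ^ DIM('a)"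
    by (subst integral_eq_nn_integral)
      (use nn_integral_gauss[of "Basis :: 'a set" "1/2"] in \<open>auto simp: span_lborel_Basis mult.commute\<close>)
  finally show ?thesis by (simp add: power2_norm_eq_inner)
qed

lemma isotropic_moment:
  fixes L :: "'a::euclidean_space set"
  assumes "isotropic L"
  obtains m where "\<And>u. (LINT x:L|lborel. (inner x u)\<^sup>2) = m * (norm u)\<^sup>2"
proof
  show "(LINT x:L|lborel. (inner x u)\<^sup>2) = ((LINT x:L|lborel. (norm x)\<^sup>2) / real DIM('a)) * (norm u)\<^sup>2" for u
    using assms unfolding isotropic_def by (simp add: mult.commute)
qed

text \<open>Integration by parts turns isotropy of the second moments into conformality of \<open>E\<close>.\<close>

lemma norm_linear_if_gauss_isotropic:
  fixes E :: "'a::euclidean_space \<Rightarrow> 'a"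
  assumes E: "linear E" and gb: "gauss_bounded Basis (\<lambda>y. exp (- (norm (E y))\<^sup>2 / 2))"
    and iso: "\<And>u. (LINT y|lborel. (inner y u)\<^sup>2 * exp (- (norm (E y))\<^sup>2 / 2)) = c * (norm u)\<^sup>2"
  obtains l where "l \<ge> 0" "\<And>v. norm (E v) = l * norm v"
proof -
  define G where "G y = exp (- (norm (E y))\<^sup>2 / 2)" for y
  have gb: "gauss_bounded Basis G" using gb by (simp add: G_def[abs_def])
  have B: "finite (Basis :: 'a set)" "(Basis :: 'a set) \<subseteq> Basis" by auto
  have int: "integrable lborel (\<lambda>y. inner y a * (inner y b * G y))" for a b
    using integrable_gauss_bounded[OF B gauss_bounded_inner[OF gauss_bounded_inner[OF gb]]] by (simp add: span_lborel_Basis)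
  have sq: "(LINT y|lborel. inner y u * (inner y u * G y)) = c * (norm u)\<^sup>2" for u
    using iso[of u] by (simp add: G_def power2_eq_square mult.assoc)
  have pol: "(LINT y|lborel. inner y a * (inner y b * G y)) = c * inner a b" for a b
  proof -
    have "c * (norm (a + b))\<^sup>2 = (LINT y|lborel. inner y a * (inner y a * G y) + 2 * (inner y a * (inner y b * G y)) + inner y b * (inner y b * G y))"
      unfolding sq[symmetric] by (rule Bochner_Integration.integral_cong) (auto simp: inner_add_right algebra_simps)
    also have "\<dots> = c * (norm a)\<^sup>2 + 2 * (LINT y|lborel. inner y a * (inner y b * G y)) + c * (norm b)\<^sup>2"
      using int[of a a] int[of a b] int[of b b] by (simp add: sq)
    finally show ?thesis
      by (simp add: power2_norm_eq_inner inner_add_left inner_add_right inner_commute[of b a] algebra_simps)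
  qed
  define m where "m = (LINT y|lborel. G y)"
  have "G x > 0" for x by (simp add: G_def)
  then have m: "m > 0"
    unfolding m_def using integral_pos_gauss_bounded[OF B gb] by (simp add: span_lborel_Basis)
  \<comment> \<open>The same integral is evaluated twice: by parts it is m * |v|^2, and by polarised
    isotropy, after moving \<open>E\<close> across as an adjoint, it is c * |E v|^2.\<close>
  have key: "c * (norm (E v))\<^sup>2 = m * (norm v)\<^sup>2" for v
  proof -
    have "inner v v * m = (LINT y|lborel. inner y v * (inner (E y) (E v) * G y))"
      using gauss_integration_by_parts[OF E gb[unfolded G_def[abs_def]], of v v] by (simp add: m_def G_def)
    also have "\<dots> = (LINT y|lborel. inner y v * (inner y (adjoint E (E v)) * G y))"
      by (simp add: adjoint_works[OF E])
    also have "\<dots> = c * inner v (adjoint E (E v))" by (rule pol)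
    also have "\<dots> = c * (norm (E v))\<^sup>2"
      by (simp add: adjoint_works[OF E] power2_norm_eq_inner)
    finally show ?thesis by (simp add: power2_norm_eq_inner mult.commute)
  qed
  \<comment> \<open>A unit vector shows c to be positive, so that the identity can be solved for |E
    v|.\<close>
  obtain b :: 'a where "b \<in> Basis" using nonempty_Basis by blast
  then have "c * (norm (E b))\<^sup>2 = m" using key[of b] by simp
  with m have "0 < c * (norm (E b))\<^sup>2" by simp
  then have c: "c > 0" by (simp add: zero_less_mult_iff)
  show ?thesis
  proof (rule that[of "sqrt (m / c)"])
    show "norm (E v) = sqrt (m / c) * norm v" for v
    proof -
      have "(norm (E v))\<^sup>2 = m / c * (norm v)\<^sup>2" using key[of v] c by (simp add: field_simps)
      then have "sqrt ((norm (E v))\<^sup>2) = sqrt (m / c) * sqrt ((norm v)\<^sup>2)" by (simp only: real_sqrt_mult)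
      then show ?thesis by simp
    qed
  qed (use m c in simp)
qed

theorem mainTheorem2:
  fixes K :: "'a::euclidean_space set" and u :: 'a
  assumes "convex_body K" and "symmetric_set K"
    and "isotropic (polar_body K)"
    and "u \<noteq> 0"
  shows "(LINT x:K|lborel. (inner x u)\<^sup>2) * (LINT x:polar_body K|lborel. (inner x u)\<^sup>2)
           \<le> (LINT x:cball 0 1|lborel. (inner x u)\<^sup>2)\<^sup>2
         \<and> ((LINT x:K|lborel. (inner x u)\<^sup>2) * (LINT x:polar_body K|lborel. (inner x u)\<^sup>2)
              = (LINT x:cball 0 1|lborel. (inner x u)\<^sup>2)\<^sup>2
            \<longleftrightarrow> (\<exists>r>0. K = cball 0 r))"
proof -
  note K = assms(1,2)
  have P: "convex_body (polar_body K)" "symmetric_set (polar_body K)" using assms(3) by (auto simp: isotropic_def)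
  let ?n = "DIM('a)"
  \<comment> \<open>Common conversion factor between moments of bodies and of their Gaussian
    counterparts. It enters squared on both sides and cancels.\<close>
  define \<kappa> where "\<kappa> = half_moment (?n + 3)"
  have \<kappa>: "\<kappa> > 0" unfolding \<kappa>_def by (rule half_moment_pos)
  define f where "f x = exp (- (support_function (polar_body K) x)\<^sup>2 / 2)" for x
  define g where "g x = exp (- (support_function K x)\<^sup>2 / 2)" for x
  have f: "gauss_bounded Basis f" unfolding f_def[abs_def] by (rule gauss_bounded_support_function[OF P])
  have g: "gauss_bounded Basis g" unfolding g_def[abs_def] by (rule gauss_bounded_support_function[OF K])
  have fg: "f x * g y \<le> exp (- inner x y)" for x y
  proof -
    define s where "s = support_function (polar_body K) x"
    define t where "t = support_function K y"
    have "inner x y \<le> s * t" unfolding s_def t_def by (rule inner_le_support_function_mult[OF K P])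
    also have "\<dots> \<le> (s\<^sup>2 + t\<^sup>2) / 2" using sum_squares_bound[of s t] by simp
    finally have "- s\<^sup>2 / 2 + - t\<^sup>2 / 2 \<le> - inner x y" by (simp add: field_simps)
    then show ?thesis by (simp add: f_def g_def s_def t_def flip: exp_add)
  qed
  have mK: "(LINT x|lborel. (inner x w)\<^sup>2 * f x) = \<kappa> * (LINT x:K|lborel. (inner x w)\<^sup>2)" for w
    using moment_layer_cake[OF borel_measurable_support_function[OF P] support_function_scale[OF P] support_function_nonneg[OF P], of w]
      polar_body_eq_sublevel[OF P] polar_polar_body[OF K] by (simp add: f_def \<kappa>_def)
  have mP: "(LINT x|lborel. (inner x w)\<^sup>2 * g x) = \<kappa> * (LINT x:polar_body K|lborel. (inner x w)\<^sup>2)" for w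
    using moment_layer_cake[OF borel_measurable_support_function[OF K] support_function_scale[OF K] support_function_nonneg[OF K], of w]
      polar_body_eq_sublevel[OF K] by (simp add: g_def \<kappa>_def)
  define b where "b = (LINT x:cball 0 1|lborel. (inner x u)\<^sup>2)"
  have ball: "cball 0 r = {x::'a. norm x \<le> r}" for r by auto
  \<comment> \<open>The ball corresponds to the norm itself, whose Gaussian moment is explicit; this
    expresses (2 * pi)^n through the moment of the ball.\<close>
  have "(norm u)\<^sup>2 * sqrt (2 * pi) ^ ?n = \<kappa> * b"
    using moment_layer_cake[of "norm :: 'a \<Rightarrow> real" u] gauss_moment[of u] unfolding b_def ball \<kappa>_def by simp
  then have "((norm u)\<^sup>2 * sqrt (2 * pi) ^ ?n)\<^sup>2 = (\<kappa> * b)\<^sup>2" by simp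
  moreover have "(sqrt (2 * pi) ^ ?n)\<^sup>2 = (2 * pi) ^ ?n"
  proof -
    have "(sqrt (2 * pi) ^ ?n)\<^sup>2 = (sqrt (2 * pi) * sqrt (2 * pi)) ^ ?n"
      by (simp only: power2_eq_square power_mult_distrib)
    then show ?thesis by simp
  qed
  moreover have "((norm u)\<^sup>2)\<^sup>2 = norm u ^ 4" by (simp flip: power_mult)
  ultimately have mb: "norm u ^ 4 * (2 * pi) ^ ?n = \<kappa>\<^sup>2 * b\<^sup>2"
    by (simp only: power_mult_distrib)
  obtain m where m: "\<And>w. (LINT x:polar_body K|lborel. (inner x w)\<^sup>2) = m * (norm w)\<^sup>2"
    using isotropic_moment[OF assms(3)] by blast
  define a where "a = (LINT x:K|lborel. (inner x u)\<^sup>2)"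
  have a: "a \<ge> 0" unfolding a_def set_lebesgue_integral_def by (rule integral_nonneg_AE) auto
  have m0: "m \<ge> 0"
  proof -
    have "0 \<le> (LINT x:polar_body K|lborel. (inner x u)\<^sup>2)"
      unfolding set_lebesgue_integral_def by (rule integral_nonneg_AE) auto
    then show ?thesis using assms(4) by (simp add: m zero_le_mult_iff)
  qed
  obtain v where v: "inner v u = 1"
    "(LINT x|lborel. (inner x u)\<^sup>2 * f x) * (LINT y|lborel. (inner y v)\<^sup>2 * g y) \<le> (2 * pi) ^ ?n"
    "(LINT x|lborel. (inner x u)\<^sup>2 * f x) * (LINT y|lborel. (inner y v)\<^sup>2 * g y) = (2 * pi) ^ ?n \<Longrightarrow>
      \<exists>(E :: 'a \<Rightarrow> 'a) \<beta>. linear E \<and> \<beta> > 0 \<and> (\<forall>y. g y = exp (- (norm (E y))\<^sup>2 / 2) / \<beta>)"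
  proof (rule directional_moment_santalo[OF f _ _ g _ _ fg assms(4)])
    show "f x > 0" "f (- x) = f x" "g x > 0" "g (- x) = g x" for x
      by (simp_all add: f_def g_def support_function_minus[OF P] support_function_minus[OF K])
  qed blast
  have v2: "\<kappa>\<^sup>2 * (a * (m * (norm v)\<^sup>2)) \<le> (2 * pi) ^ ?n"
    using v(2) unfolding mK mP m a_def[symmetric] by (simp add: power2_eq_square mult_ac)
  have v3: "\<exists>(E :: 'a \<Rightarrow> 'a) \<beta>. linear E \<and> \<beta> > 0 \<and> (\<forall>y. g y = exp (- (norm (E y))\<^sup>2 / 2) / \<beta>)"
    if "\<kappa>\<^sup>2 * (a * (m * (norm v)\<^sup>2)) = (2 * pi) ^ ?n"
    using v(3) that unfolding mK mP m a_def[symmetric] by (simp add: power2_eq_square mult_ac)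
  \<comment> \<open>Cauchy-Schwarz on <v, u> = 1, rearranged so that |u|^2 replaces |v|^2 in the
    isotropic moment at the price of |u|^4, exactly the power in the moment of the ball.\<close>
  have "1 \<le> norm v * norm u" using norm_cauchy_schwarz[of v u] v(1) by simp
  then have "1 \<le> (norm v * norm u)\<^sup>2" by (rule one_le_power)
  then have "norm u ^ 2 * 1 \<le> norm u ^ 2 * (norm v * norm u)\<^sup>2" by (rule mult_left_mono) simp
  moreover have "norm u ^ 2 * (norm v * norm u)\<^sup>2 = norm u ^ 4 * (norm v)\<^sup>2"
    by (simp add: power_mult_distrib power2_eq_square power4_eq_xxxx)
  ultimately have uv: "(norm u)\<^sup>2 \<le> norm u ^ 4 * (norm v)\<^sup>2" by simp
  have chain: "\<kappa>\<^sup>2 * (a * (m * (norm u)\<^sup>2)) \<le> norm u ^ 4 * (\<kappa>\<^sup>2 * (a * (m * (norm v)\<^sup>2)))"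
    using mult_left_mono[OF uv, of "\<kappa>\<^sup>2 * (a * m)"] a m0 by (simp add: mult_ac)
  also have "\<dots> \<le> norm u ^ 4 * (2 * pi) ^ ?n" by (rule mult_left_mono[OF v2]) simp
  finally have main: "a * (m * (norm u)\<^sup>2) \<le> b\<^sup>2" unfolding mb using \<kappa> by simp
  have fwd: "\<exists>r>0. K = cball 0 r" if eq: "a * (m * (norm u)\<^sup>2) = b\<^sup>2"
  proof -
    \<comment> \<open>Equality in the final bound collapses the chain, so the inequality in
      direction v is an equality as well and g is Gaussian.\<close>
    have "norm u ^ 4 * (2 * pi) ^ ?n \<le> norm u ^ 4 * (\<kappa>\<^sup>2 * (a * (m * (norm v)\<^sup>2)))"
      using chain unfolding eq mb by simp
    then have "(2 * pi) ^ ?n \<le> \<kappa>\<^sup>2 * (a * (m * (norm v)\<^sup>2))" using assms(4) by simp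
    with v2 have "\<kappa>\<^sup>2 * (a * (m * (norm v)\<^sup>2)) = (2 * pi) ^ ?n" by (rule antisym)
    from v3[OF this] obtain E :: "'a \<Rightarrow> 'a" and \<beta> where E: "linear E" "\<beta> > 0" "\<And>y. g y = exp (- (norm (E y))\<^sup>2 / 2) / \<beta>"
      by auto
    \<comment> \<open>The support function vanishes at 0, so g 0 = 1 and the constant \<beta> is 1;
      the squared support function is then exactly |E y|^2.\<close>
    have "support_function K 0 = 0"
      using support_function_nonneg[OF K, of 0] support_function_le_iff[OF K, of 0 0] by auto
    then have \<beta>: "\<beta> = 1" using E(3)[of 0] E(2) by (simp add: g_def linear_0[OF E(1)])
    have gE: "g = (\<lambda>y. exp (- (norm (E y))\<^sup>2 / 2))" using E(3) \<beta> by auto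
    have iso: "(LINT y|lborel. (inner y w)\<^sup>2 * exp (- (norm (E y))\<^sup>2 / 2)) = (\<kappa> * m) * (norm w)\<^sup>2" for w
      using mP[of w] m unfolding gE by (simp add: mult.assoc)
    obtain l where l: "l \<ge> 0" "\<And>y. norm (E y) = l * norm y"
      using norm_linear_if_gauss_isotropic[OF E(1) g[unfolded gE] iso] by blast
    have hl: "support_function K y = l * norm y" for y
    proof -
      have "(support_function K y)\<^sup>2 = (norm (E y))\<^sup>2" using E(3)[of y] \<beta> by (simp add: g_def)
      then show ?thesis using support_function_nonneg[OF K, of y] l(1) unfolding l(2) by simp
    qed
    obtain \<rho> where \<rho>: "\<rho> > 0" "\<And>x. \<rho> * norm x \<le> support_function K x" using support_function_lower[OF K] by blast
    have "0 < \<rho> * norm u" using \<rho>(1) assms(4) by simp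
    then have "0 < l * norm u" using \<rho>(2)[of u] unfolding hl by linarith
    then have lpos: "l > 0" using l(1) by (simp add: zero_less_mult_iff)
    have "polar_body K = cball 0 (1 / l)"
      unfolding polar_body_eq_sublevel[OF K] hl using lpos by (auto simp: pos_le_divide_eq mult.commute)
    then have "K = cball 0 l"
      using polar_polar_body[OF K] polar_body_cball[where 'a = 'a and r = "1 / l"] lpos by simp
    with lpos show ?thesis by blast
  qed
  \<comment> \<open>For a ball of radius r the two moments scale by r^(n + 2) and by its reciprocal,
    so the product does not depend on r.\<close>
  have bwd: "a * (m * (norm u)\<^sup>2) = b\<^sup>2" if r: "r > 0" and Kr: "K = cball 0 r" for r
  proof -
    have sc: "(LINT x:cball 0 t|lborel. (inner x u)\<^sup>2) = t ^ (?n + 2) * b" if "t > 0" for t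
      unfolding b_def ball by (rule moment_sublevel_scale[OF _ _ that]) auto
    have "a = r ^ (?n + 2) * b" unfolding a_def Kr by (rule sc[OF r])
    moreover have "m * (norm u)\<^sup>2 = (1 / r) ^ (?n + 2) * b"
      unfolding m[symmetric] Kr polar_body_cball[OF r] by (rule sc) (use r in simp)
    moreover have "r ^ (?n + 2) * (1 / r) ^ (?n + 2) = 1"
      using r by (simp flip: power_mult_distrib)
    moreover have "(r ^ (?n + 2) * b) * ((1 / r) ^ (?n + 2) * b) = (r ^ (?n + 2) * (1 / r) ^ (?n + 2)) * b\<^sup>2"
      by (simp only: mult_ac power2_eq_square)
    ultimately show ?thesis by (simp only: mult_1)
  qed
  show ?thesis
    unfolding m a_def[symmetric] b_def[symmetric] using main fwd bwd by blast
qed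

end
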